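(* Let $D\subset\mathbb{C}^n$ be a bounded homogeneous domain with $0\in D$ and let $\varphi:D\to D$ be holomorphic. Then the composition operator $C_\varphi:f\mapsto f\circ\varphi$ is a bounded operator on the Bloch space $\mathcal{B}$ of $D$. Furthermore, $$1\le\|C_\varphi\|\le\max\{1,\rho(\varphi(0),0)+B_\varphi\}.$$ In particular, if $\varphi(0)=0$, then $1\le\|C_\varphi\|\le\max\{1,B_\varphi\}$.
   Context: A domain $D\subset\mathbb{C}^n$ is homogeneous if its group $\mathrm{Aut}(D)$ of biholomorphic self-maps acts transitively on $D$. For a bounded homogeneous domain $D$, $H_z(u,\overline v)$ ($z\in D$, $u,v\in\mathbb{C}^n$) denotes the Bergman metric, a positive definite Hermitian form invariant under automorphisms, normalized by $H_z(u,\overline v)=\frac12\sum_{j,k}\frac{\partial^2\log K(z,z)}{\partial z_j\partial\overline{z_k}}u_j\overline{v_k}$ with $K$ the Bergman kernel of $D$ (so on the unit disk $H_z(u,\overline u)=|u|^2/(1-|z|^2)^2$). The Bergman distance $\rho(z,w)$ is the infimum of $\int_0^1 H_{\gamma(t)}(\gamma'(t),\overline{\gamma'(t)})^{1/2}dt$ over piecewise smooth curves $\gamma:[0,1]\to D$ from $z$ to $w$. For holomorphic $f:D\to\mathbb{C}$ put $Q_f(z)=\sup_{u\ne0}|(\nabla f)(z)u|/H_z(u,\overline u)^{1/2}$ with $(\nabla f)(z)u=\sum_k\frac{\partial f}{\partial z_k}(z)u_k$, and $\beta_f=\sup_{z\in D}Q_f(z)$. The Bloch space $\mathcal{B}$ of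 $D$ is the Banach space of holomorphic $f$ with $\beta_f<\infty$, with norm $\|f\|_{\mathcal{B}}=|f(0)|+\beta_f$; $\|C_\varphi\|$ is the operator norm on $\mathcal{B}$. The Bergman constant of a holomorphic $\varphi:D\to D$ is $$B_\varphi=\sup_{z\in D}\sup_{u\in\mathbb{C}^n\setminus\{0\}}\frac{H_{\varphi(z)}(J\varphi(z)u,\overline{J\varphi(z)u})^{1/2}}{H_z(u,\overline u)^{1/2}},$$ where $J\varphi(z)$ is the Jacobian matrix $(\partial\varphi_j(z)/\partial z_k)_{j,k}$; it is always finite. *)

theory Defs
  imports "HOL-Analysis.Analysis"
begin

text \<open>
  The space \<open>\<complex>\<^sup>n\<close> is the type \<^typ>\<open>complex ^ 'n\<close>. Functions on a domain \<open>D\<close> are total functions whose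
  values off \<open>D\<close> are irrelevant; all definitions below are meant for open \<open>D\<close>.
\<close>

section \<open>Holomorphic functions and maps of several variables\<close>

text \<open>The derivative is required to be complex linear, i.e. of the form \<open>h \<mapsto> \<Sum>k. a\<^sub>k h\<^sub>k\<close>.\<close>

definition holomorphic_fun_on :: "(complex ^ 'n \<Rightarrow> complex) \<Rightarrow> (complex ^ 'n) set \<Rightarrow> bool" where
  "holomorphic_fun_on f D \<longleftrightarrow>
     (\<forall>z\<in>D. \<exists>a :: complex ^ 'n. (f has_derivative (\<lambda>h. \<Sum>k\<in>UNIV. a $ k * h $ k)) (at z))"

definition holomorphic_map_on :: "(complex ^ 'n \<Rightarrow> complex ^ 'm) \<Rightarrow> (complex ^ 'n) set \<Rightarrow> bool" where
  "holomorphic_map_on g D \<longleftrightarrow> (\<forall>j. holomorphic_fun_on (\<lambda>z. g z $ j) D)"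

definition complex_partial :: "'n \<Rightarrow> (complex ^ 'n \<Rightarrow> complex) \<Rightarrow> complex ^ 'n \<Rightarrow> complex" where
  "complex_partial k f z = deriv (\<lambda>t. f (z + t *s axis k 1)) 0"

definition complex_jacobian :: "(complex ^ 'n \<Rightarrow> complex ^ 'm) \<Rightarrow> complex ^ 'n \<Rightarrow> complex ^ 'n ^ 'm" where
  "complex_jacobian g z = (\<chi> j k. complex_partial k (\<lambda>w. g w $ j) z)"

section \<open>Bounded homogeneous domains\<close>

definition holomorphic_automorphisms :: "(complex ^ 'n) set \<Rightarrow> (complex ^ 'n \<Rightarrow> complex ^ 'n) set" where
  "holomorphic_automorphisms D =
     {g. bij_betw g D D \<and> holomorphic_map_on g D \<and> holomorphic_map_on (inv_into D g) D}"

definition bounded_homogeneous_domain :: "(complex ^ 'n) set \<Rightarrow> bool" where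
  "bounded_homogeneous_domain D \<longleftrightarrow>
     open D \<and> connected D \<and> D \<noteq> {} \<and> bounded D \<and>
     (\<forall>z\<in>D. \<forall>w\<in>D. \<exists>g\<in>holomorphic_automorphisms D. g z = w)"

section \<open>Bergman kernel and Bergman metric\<close>

text \<open>Square-integrable holomorphic functions with respect to Lebesgue measure.\<close>

definition bergman_space :: "(complex ^ 'n) set \<Rightarrow> (complex ^ 'n \<Rightarrow> complex) set" where
  "bergman_space D =
     {f. holomorphic_fun_on f D \<and> set_integrable lborel D (\<lambda>z. (cmod (f z))\<^sup>2)}"

definition is_bergman_kernel ::
    "(complex ^ 'n) set \<Rightarrow> (complex ^ 'n \<Rightarrow> complex ^ 'n \<Rightarrow> complex) \<Rightarrow> bool" where
  "is_bergman_kernel D K \<longleftrightarrow>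
     (\<forall>w\<in>D. (\<lambda>z. K z w) \<in> bergman_space D \<and>
        (\<forall>f\<in>bergman_space D. f w = (LINT z:D|lborel. f z * cnj (K z w))))"

text \<open>A reproducing kernel is unique on \<open>D \<times> D\<close>, so the choice below only concerns values off \<open>D \<times> D\<close>.\<close>

definition bergman_kernel :: "(complex ^ 'n) set \<Rightarrow> complex ^ 'n \<Rightarrow> complex ^ 'n \<Rightarrow> complex" where
  "bergman_kernel D = (SOME K. is_bergman_kernel D K)"

text \<open>
  The Wirtinger operators \<open>\<partial>/\<partial>z\<^sub>k = (\<partial>/\<partial>x\<^sub>k - \<i> \<partial>/\<partial>y\<^sub>k)/2\<close> and
  \<open>\<partial>/\<partial>\<bar>z\<^sub>k = (\<partial>/\<partial>x\<^sub>k + \<i> \<partial>/\<partial>y\<^sub>k)/2\<close>, where \<open>z\<^sub>k = x\<^sub>k + \<i> y\<^sub>k\<close>.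
\<close>

definition real_directional :: "complex ^ 'n \<Rightarrow> (complex ^ 'n \<Rightarrow> complex) \<Rightarrow> complex ^ 'n \<Rightarrow> complex" where
  "real_directional v F z = vector_derivative (\<lambda>t::real. F (z + t *\<^sub>R v)) (at 0)"

definition wirtinger :: "'n \<Rightarrow> (complex ^ 'n \<Rightarrow> complex) \<Rightarrow> complex ^ 'n \<Rightarrow> complex" where
  "wirtinger k F z =
     (real_directional (axis k 1) F z - \<i> * real_directional (axis k \<i>) F z) / 2"

definition wirtinger_bar :: "'n \<Rightarrow> (complex ^ 'n \<Rightarrow> complex) \<Rightarrow> complex ^ 'n \<Rightarrow> complex" where
  "wirtinger_bar k F z =
     (real_directional (axis k 1) F z + \<i> * real_directional (axis k \<i>) F z) / 2"

text \<open>
  \<open>bergman_form D z u v\<close> is \<open>H\<^sub>z(u, \<bar>v)\<close>: linear in \<open>u\<close>, conjugate linear in \<open>v\<close>. The diagonal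
  \<open>K(z,z)\<close> is real and positive, so its logarithm is the real one.
\<close>

definition bergman_form :: "(complex ^ 'n) set \<Rightarrow> complex ^ 'n \<Rightarrow> complex ^ 'n \<Rightarrow> complex ^ 'n \<Rightarrow> complex" where
  "bergman_form D z u v =
     (1/2) * (\<Sum>j\<in>UNIV. \<Sum>k\<in>UNIV.
        wirtinger j (wirtinger_bar k (\<lambda>w. complex_of_real (ln (Re (bergman_kernel D w w))))) z
          * u $ j * cnj (v $ k))"

definition bergman_length :: "(complex ^ 'n) set \<Rightarrow> complex ^ 'n \<Rightarrow> complex ^ 'n \<Rightarrow> real" where
  "bergman_length D z u = sqrt (Re (bergman_form D z u u))"

section \<open>Bergman distance\<close>

text \<open>Smooth on the closed interval, with one-sided derivatives of all orders at the end points.\<close>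

definition smooth_on_interval :: "(real \<Rightarrow> 'a::real_normed_vector) \<Rightarrow> real \<Rightarrow> real \<Rightarrow> bool" where
  "smooth_on_interval \<gamma> a b \<longleftrightarrow>
     (\<exists>d. d 0 = \<gamma> \<and>
        (\<forall>m::nat. \<forall>t\<in>{a..b}. (d m has_vector_derivative d (Suc m) t) (at t within {a..b})))"

text \<open>
  The library's \<^const>\<open>piecewise_C1_differentiable_on\<close> allows the derivative to be unbounded near the
  exceptional points, hence curves whose length integral diverges (and is then \<open>0\<close> by convention).
  Smoothness on each closed piece excludes this.
\<close>

definition piecewise_smooth_path :: "(real \<Rightarrow> 'a::real_normed_vector) \<Rightarrow> bool" where
  "piecewise_smooth_path \<gamma> \<longleftrightarrow>
     path \<gamma> \<and>
     (\<exists>N (s :: nat \<Rightarrow> real). s 0 = 0 \<and> s N = 1 \<and>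
        (\<forall>i<N. s i < s (Suc i) \<and> smooth_on_interval \<gamma> (s i) (s (Suc i))))"

definition bergman_distance :: "(complex ^ 'n) set \<Rightarrow> complex ^ 'n \<Rightarrow> complex ^ 'n \<Rightarrow> real" where
  "bergman_distance D z w =
     (INF \<gamma>\<in>{\<gamma>. piecewise_smooth_path \<gamma> \<and> path_image \<gamma> \<subseteq> D \<and> pathstart \<gamma> = z \<and> pathfinish \<gamma> = w}.
        integral {0..1}
          (\<lambda>t. bergman_length D (\<gamma> t) (vector_derivative \<gamma> (at t within {0..1}))))"

section \<open>Bloch space and operators on it\<close>

text \<open>Suprema are taken in the extended reals, so that they are meaningful without a finiteness proof.\<close>

definition bloch_Q :: "(complex ^ 'n) set \<Rightarrow> (complex ^ 'n \<Rightarrow> complex) \<Rightarrow> complex ^ 'n \<Rightarrow> ereal" where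
  "bloch_Q D f z =
     (SUP u\<in>- {0}. ereal (cmod (\<Sum>k\<in>UNIV. complex_partial k f z * u $ k) / bergman_length D z u))"

definition bloch_seminorm :: "(complex ^ 'n) set \<Rightarrow> (complex ^ 'n \<Rightarrow> complex) \<Rightarrow> ereal" where
  "bloch_seminorm D f = (SUP z\<in>D. bloch_Q D f z)"

definition bloch_space :: "(complex ^ 'n) set \<Rightarrow> (complex ^ 'n \<Rightarrow> complex) set" where
  "bloch_space D = {f. holomorphic_fun_on f D \<and> bloch_seminorm D f < \<infinity>}"

definition bloch_norm :: "(complex ^ 'n) set \<Rightarrow> (complex ^ 'n \<Rightarrow> complex) \<Rightarrow> ereal" where
  "bloch_norm D f = ereal (cmod (f 0)) + bloch_seminorm D f"

definition bounded_operator_on_bloch ::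
    "(complex ^ 'n) set \<Rightarrow> ((complex ^ 'n \<Rightarrow> complex) \<Rightarrow> complex ^ 'n \<Rightarrow> complex) \<Rightarrow> bool" where
  "bounded_operator_on_bloch D T \<longleftrightarrow>
     (\<forall>f\<in>bloch_space D. T f \<in> bloch_space D) \<and>
     (\<forall>f\<in>bloch_space D. \<forall>g\<in>bloch_space D. \<forall>a b. \<forall>z\<in>D.
        T (\<lambda>w. a * f w + b * g w) z = a * T f z + b * T g z) \<and>
     (\<exists>M::real. \<forall>f\<in>bloch_space D. bloch_norm D (T f) \<le> ereal M * bloch_norm D f)"

definition bloch_operator_norm ::
    "(complex ^ 'n) set \<Rightarrow> ((complex ^ 'n \<Rightarrow> complex) \<Rightarrow> complex ^ 'n \<Rightarrow> complex) \<Rightarrow> ereal" where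
  "bloch_operator_norm D T = (SUP f\<in>{f \<in> bloch_space D. bloch_norm D f \<le> 1}. bloch_norm D (T f))"

definition composition_operator ::
    "(complex ^ 'n \<Rightarrow> complex ^ 'n) \<Rightarrow> (complex ^ 'n \<Rightarrow> complex) \<Rightarrow> complex ^ 'n \<Rightarrow> complex" where
  "composition_operator \<phi> f = f \<circ> \<phi>"

definition bergman_constant :: "(complex ^ 'n) set \<Rightarrow> (complex ^ 'n \<Rightarrow> complex ^ 'n) \<Rightarrow> ereal" where
  "bergman_constant D \<phi> =
     (SUP z\<in>D. SUP u\<in>- {0}.
        ereal (bergman_length D (\<phi> z) (complex_jacobian \<phi> z *v u) / bergman_length D z u))"

end

theory Submission
  imports Defs "HOL-Complex_Analysis.Cauchy_Integral_Formula" "HOL-Real_Asymp.Real_Asymp"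
begin

text \<open>
  The two inequalities come from elementary estimates once the Bergman metric is known to be a
  genuine metric. If \<open>|\<nabla>f(z) u| \<le> \<beta> sqrt (H\<^sub>z(u,u))\<close> for all \<open>z\<close> and \<open>u\<close>, then the chain rule gives
  the same bound for \<open>f \<circ> \<phi>\<close> with \<open>\<beta> B(\<phi>)\<close> in place of \<open>\<beta>\<close>, integration along curves gives
  \<open>|f(\<phi>(0)) - f(0)| \<le> \<beta> \<rho>(\<phi>(0),0)\<close>, and
  \<open>|f(0)| + (\<rho> + B) \<beta> \<le> max {1, \<rho> + B} (|f(0)| + \<beta>)\<close>. The constant function 1 gives the lower bound.
  The work lies in three facts that these lines rely on: the Bergman form is positive definite, it
  depends continuously on its base point (so that the length integrals exist), and \<open>B(\<phi>)\<close> is finite.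

  Positivity and finiteness rest on an extremal description of the metric, and continuity comes out on
  the way to it. The Bergman space is complete, because
  the mean value inequality bounds point evaluations locally uniformly; so bounded functionals have
  representers (\<open>bergman_riesz\<close>), and the reproducing kernel \<open>K\<close> exists. The function
  \<open>G(z, w') = K(z, cnj w')\<close> is separately holomorphic and locally bounded, hence holomorphic by
  Osgood's lemma; this makes \<open>log K(z,z)\<close> smooth, with
  continuous derivatives, and turns its Wirtinger derivatives into
  ordinary partial derivatives of \<open>Ln G\<close>. If \<open>e\<close> represents the functional \<open>f \<mapsto> \<nabla>f(w) u\<close> and \<open>e'\<close> is its
  component orthogonal to \<open>K(-,w)\<close>, the resulting formula reads
  \<open>2 K(w,w) H\<^sub>w(u,u) = \<parallel>e'\<parallel>\<^sup>2\<close> (\<open>bergman_length_extremal\<close>). Two consequences are used.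

  First, the metric dominates the Caratheodory metric: if \<open>|F| \<le> R\<close> and \<open>F(w) = 0\<close>, then testing with
  \<open>F K(-,w)\<close> gives \<open>|\<nabla>F(w) u|\<^sup>2 \<le> 2 R\<^sup>2 H\<^sub>w(u,u)\<close> (\<open>caratheodory_le_bergman\<close>); coordinate functions then show
  that \<open>H\<close> is positive definite. Second, an automorphism \<open>g\<close> acts on the Bergman space by the isometry
  \<open>f \<mapsto> det Jg \<cdot> (f \<circ> g)\<close>, since the real Jacobian of \<open>g\<close> is \<open>|det Jg|\<^sup>2\<close>; so automorphisms do not decrease
  the metric, and therefore preserve it (\<open>bergman_length_automorphism\<close>).

  Finiteness of \<open>B(\<phi>)\<close>: given \<open>z\<close>, homogeneity provides an automorphism \<open>h\<close> that moves \<open>\<phi>(z)\<close> to a fixed base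
  point \<open>a\<close>. The length of \<open>J\<phi>(z) u\<close> at \<open>\<phi>(z)\<close> is at most the length of \<open>J(h \<circ> \<phi>)(z) u\<close> at \<open>a\<close>, which is comparable
  to its Euclidean length, and the components of \<open>h \<circ> \<phi> - a\<close> are bounded holomorphic functions that
  vanish at \<open>z\<close>, so the Caratheodory estimate bounds their derivatives by \<open>sqrt (H\<^sub>z(u,u))\<close>.
\<close>

section \<open>Holomorphic functions of several variables\<close>

lemma norm_vec_le_sum_norm: "norm (x :: complex ^ 'n) \<le> (\<Sum>i\<in>UNIV. cmod (x $ i))"
  unfolding norm_vec_def by (rule L2_set_le_sum) simp

lemma norm_axis_complex: "norm (axis k t :: complex ^ 'n) = cmod t"
proof -
  have "(\<Sum>i\<in>UNIV. (cmod (if i = k then t else 0))\<^sup>2) = (\<Sum>i\<in>UNIV. if i = k then (cmod t)\<^sup>2 else 0)"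
    by (intro sum.cong) auto
  then show ?thesis
    by (simp add: norm_vec_def L2_set_def axis_def)
qed

lemma norm_scale_axis [simp]: "norm (t *s axis k (1::complex) :: complex ^ 'n) = cmod t"
proof -
  have "t *s axis k (1::complex) = (axis k t :: complex ^ 'n)"
    by (simp add: vec_eq_iff axis_def)
  then show ?thesis
    by (simp add: norm_axis_complex)
qed

lemma has_derivative_vecI:
  fixes g :: "'a::real_normed_vector \<Rightarrow> complex ^ 'm"
  assumes "\<And>j. ((\<lambda>x. g x $ j) has_derivative (\<lambda>h. g' h $ j)) F"
  shows "(g has_derivative g') F"
proof -
  have bl: "bounded_linear (\<lambda>t::complex. axis j t :: complex ^ 'm)" for j
  proof (rule bounded_linear_intro[where K=1])
    fix t :: complex
    show "norm (axis j t :: complex ^ 'm) \<le> norm t * 1"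
      by (simp add: norm_axis_complex)
  qed (simp_all add: vec_eq_iff axis_def)
  have "((\<lambda>x. \<Sum>j\<in>UNIV. axis j (g x $ j)) has_derivative (\<lambda>h. \<Sum>j\<in>UNIV. axis j (g' h $ j))) F"
    by (intro has_derivative_sum bounded_linear.has_derivative[OF bl] assms)
  moreover have "(\<Sum>j\<in>UNIV. axis j (x $ j)) = x" for x :: "complex ^ 'm"
    by (simp add: vec_eq_iff axis_def if_distrib cong: if_cong)
  ultimately show ?thesis by simp
qed

lemma slice_has_field_derivative:
  fixes f :: "complex ^ 'n \<Rightarrow> complex"
  assumes "(f has_derivative (\<lambda>h. \<Sum>k\<in>UNIV. a $ k * h $ k)) (at (z + t *s u))"
  shows "((\<lambda>t. f (z + t *s u)) has_field_derivative (\<Sum>k\<in>UNIV. a $ k * u $ k)) (at t)"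
proof -
  have 1: "((\<lambda>t. z + t *s u) has_derivative (\<lambda>s. s *s u)) (at t)"
  proof (rule has_derivative_vecI)
    fix j
    show "((\<lambda>t. (z + t *s u) $ j) has_derivative (\<lambda>s. (s *s u) $ j)) (at t)"
      by (auto intro!: derivative_eq_intros)
  qed
  have "((\<lambda>t. f (z + t *s u)) has_derivative (\<lambda>s. \<Sum>k\<in>UNIV. a $ k * (s *s u) $ k)) (at t)"
    using has_derivative_compose[OF 1 assms] by simp
  moreover have "(\<lambda>s. \<Sum>k\<in>UNIV. a $ k * (s *s u) $ k) = (*) (\<Sum>k\<in>UNIV. a $ k * u $ k)"
    by (auto simp: sum_distrib_left mult_ac)
  ultimately show ?thesis
    by (simp add: has_field_derivative_def)
qed

text \<open>Partial derivatives are defined through one-variable slices; this identifies them with the coefficients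
  of the complex linear derivative, to which the rules of differentiation apply.\<close>

lemma complex_partial_eqI:
  fixes z :: "complex ^ 'n"
  assumes "(f has_derivative (\<lambda>h. \<Sum>k\<in>UNIV. a $ k * h $ k)) (at z)"
  shows "complex_partial k f z = a $ k"
proof -
  have "((\<lambda>t. f (z + t *s axis k 1)) has_field_derivative (\<Sum>j\<in>UNIV. a $ j * (axis k 1 :: complex ^ 'n) $ j)) (at 0)"
    by (rule slice_has_field_derivative) (simp add: assms)
  moreover have "(\<Sum>j\<in>UNIV. a $ j * (axis k 1 :: complex ^ 'n) $ j) = a $ k"
    by (simp add: axis_def if_distrib[of "\<lambda>x. a $ _ * x"] cong: if_cong)
  ultimately show ?thesis
    unfolding complex_partial_def by (metis DERIV_imp_deriv)
qed

lemma holomorphic_fun_on_has_derivative: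
  assumes "holomorphic_fun_on f D" "z \<in> D"
  shows "(f has_derivative (\<lambda>h. \<Sum>k\<in>UNIV. complex_partial k f z * h $ k)) (at z)"
proof -
  obtain a where a: "(f has_derivative (\<lambda>h. \<Sum>k\<in>UNIV. a $ k * h $ k)) (at z)"
    using assms unfolding holomorphic_fun_on_def by blast
  then show ?thesis
    by (simp add: complex_partial_eqI[OF a])
qed

lemma holomorphic_fun_onI:
  assumes "\<And>z. z \<in> D \<Longrightarrow> (f has_derivative (\<lambda>h. \<Sum>k\<in>UNIV. a z k * h $ k)) (at z)"
  shows "holomorphic_fun_on f D"
  unfolding holomorphic_fun_on_def
proof
  fix z assume "z \<in> D"
  then show "\<exists>c. (f has_derivative (\<lambda>h. \<Sum>k\<in>UNIV. c $ k * h $ k)) (at z)"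
    by (intro exI[of _ "\<chi> k. a z k"]) (simp add: assms)
qed

lemma complex_partial_eqI_fun:
  assumes "(f has_derivative (\<lambda>h. \<Sum>k\<in>UNIV. a k * h $ k)) (at z)"
  shows "complex_partial k f z = a k"
  using complex_partial_eqI[of f "\<chi> k. a k" z k] assms by simp

lemma holomorphic_fun_on_subset:
  "holomorphic_fun_on f D \<Longrightarrow> E \<subseteq> D \<Longrightarrow> holomorphic_fun_on f E"
  unfolding holomorphic_fun_on_def by blast

lemma holomorphic_fun_on_continuous: "holomorphic_fun_on f D \<Longrightarrow> continuous_on D f"
  by (meson continuous_at_imp_continuous_on has_derivative_continuous holomorphic_fun_on_has_derivative)

lemma holomorphic_fun_on_transform:
  assumes "holomorphic_fun_on f D" "open D" "\<And>z. z \<in> D \<Longrightarrow> g z = f z"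
  shows "holomorphic_fun_on g D"
    and "z \<in> D \<Longrightarrow> complex_partial k g z = complex_partial k f z"
proof -
  have *: "(g has_derivative (\<lambda>h. \<Sum>k\<in>UNIV. complex_partial k f z * h $ k)) (at z)" if "z \<in> D" for z
    using has_derivative_transform_within_open[OF holomorphic_fun_on_has_derivative[OF assms(1) that] assms(2) that]
      assms(3) by metis
  show "holomorphic_fun_on g D"
    by (rule holomorphic_fun_onI) (rule *)
  show "z \<in> D \<Longrightarrow> complex_partial k g z = complex_partial k f z"
    by (rule complex_partial_eqI_fun[OF *])
qed

lemma holomorphic_fun_on_const: "holomorphic_fun_on (\<lambda>_. c) D"
  and complex_partial_const: "complex_partial k (\<lambda>_. c) z = 0"
proof -
  have *: "((\<lambda>_. c) has_derivative (\<lambda>h. \<Sum>k\<in>UNIV. 0 * h $ k)) (at z)" for z :: "complex ^ 'a"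
    by simp
  show "holomorphic_fun_on (\<lambda>_. c) D"
    by (rule holomorphic_fun_onI[where a="\<lambda>_ _. 0"]) simp
  show "complex_partial k (\<lambda>_. c) z = 0" 
    by (simp add: complex_partial_def)
qed

lemma
  assumes "holomorphic_fun_on f D" "holomorphic_fun_on g D"
  shows holomorphic_fun_on_add: "holomorphic_fun_on (\<lambda>z. f z + g z) D"
    and complex_partial_add: "z \<in> D \<Longrightarrow>
      complex_partial k (\<lambda>z. f z + g z) z = complex_partial k f z + complex_partial k g z"
    and holomorphic_fun_on_mult: "holomorphic_fun_on (\<lambda>z. f z * g z) D"
    and complex_partial_mult: "z \<in> D \<Longrightarrow>
      complex_partial k (\<lambda>z. f z * g z) z = complex_partial k f z * g z + f z * complex_partial k g z"
proof -
  note d = holomorphic_fun_on_has_derivative[OF assms(1)] holomorphic_fun_on_has_derivative[OF assms(2)]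
  have *: "((\<lambda>z. f z + g z) has_derivative (\<lambda>h. \<Sum>k\<in>UNIV. (complex_partial k f z + complex_partial k g z) * h $ k)) (at z)"
    if "z \<in> D" for z
    using has_derivative_add[OF d(1)[OF that] d(2)[OF that]]
    by (simp add: sum.distrib algebra_simps)
  have **: "((\<lambda>z. f z * g z) has_derivative
      (\<lambda>h. \<Sum>k\<in>UNIV. (complex_partial k f z * g z + f z * complex_partial k g z) * h $ k)) (at z)"
    if "z \<in> D" for z
    using has_derivative_mult[OF d(1)[OF that] d(2)[OF that]]
    by (simp add: sum.distrib algebra_simps sum_distrib_left sum_distrib_right)
  show "holomorphic_fun_on (\<lambda>z. f z + g z) D"
    by (rule holomorphic_fun_onI) (rule *)
  show "complex_partial k (\<lambda>z. f z + g z) z = complex_partial k f z + complex_partial k g z" if "z \<in> D"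
    by (rule complex_partial_eqI_fun[OF *[OF that]])
  show "holomorphic_fun_on (\<lambda>z. f z * g z) D"
    by (rule holomorphic_fun_onI) (rule **)
  show "complex_partial k (\<lambda>z. f z * g z) z = complex_partial k f z * g z + f z * complex_partial k g z" if "z \<in> D"
    by (rule complex_partial_eqI_fun[OF **[OF that]])
qed

lemma
  assumes "holomorphic_fun_on f D"
  shows holomorphic_fun_on_cmult: "holomorphic_fun_on (\<lambda>z. c * f z) D"
    and complex_partial_cmult: "z \<in> D \<Longrightarrow> complex_partial k (\<lambda>z. c * f z) z = c * complex_partial k f z"
  using holomorphic_fun_on_mult[OF holomorphic_fun_on_const assms, of c]
    complex_partial_mult[OF holomorphic_fun_on_const assms, of z k c] by (simp_all add: complex_partial_const)

lemma holomorphic_fun_on_sum: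
  assumes "\<And>i. i \<in> I \<Longrightarrow> holomorphic_fun_on (f i) D"
  shows "holomorphic_fun_on (\<lambda>z. \<Sum>i\<in>I. f i z) D"
  using assms by (induction I rule: infinite_finite_induct)
    (auto intro: holomorphic_fun_on_const holomorphic_fun_on_add)

lemma holomorphic_fun_on_prod:
  assumes "\<And>i. i \<in> I \<Longrightarrow> holomorphic_fun_on (f i) D"
  shows "holomorphic_fun_on (\<lambda>z. \<Prod>i\<in>I. f i z) D"
  using assms by (induction I rule: infinite_finite_induct)
    (auto intro: holomorphic_fun_on_const holomorphic_fun_on_mult)

lemma
  assumes "holomorphic_fun_on f D" "f ` D \<subseteq> S" "h holomorphic_on S" "open S"
  shows holomorphic_fun_on_compose_outer: "holomorphic_fun_on (\<lambda>z. h (f z)) D"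
    and complex_partial_compose_outer: "z \<in> D \<Longrightarrow>
      complex_partial k (\<lambda>z. h (f z)) z = deriv h (f z) * complex_partial k f z"
proof -
  have *: "((\<lambda>z. h (f z)) has_derivative (\<lambda>v. \<Sum>k\<in>UNIV. (deriv h (f z) * complex_partial k f z) * v $ k)) (at z)"
    if "z \<in> D" for z
  proof -
    have "(h has_field_derivative deriv h (f z)) (at (f z))"
      using assms that by (meson holomorphic_derivI image_subset_iff)
    then have "(h has_derivative (\<lambda>t. deriv h (f z) * t)) (at (f z))"
      by (simp add: has_field_derivative_def)
    from has_derivative_compose[OF holomorphic_fun_on_has_derivative[OF assms(1) that] this]
    show ?thesis
      by (simp add: sum_distrib_left mult_ac)
  qed
  show "holomorphic_fun_on (\<lambda>z. h (f z)) D"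
    by (rule holomorphic_fun_onI) (rule *)
  show "complex_partial k (\<lambda>z. h (f z)) z = deriv h (f z) * complex_partial k f z" if "z \<in> D"
    by (rule complex_partial_eqI_fun[OF *[OF that]])
qed

lemma holomorphic_fun_on_coord: "holomorphic_fun_on (\<lambda>z. z $ k) D"
  and complex_partial_coord: "complex_partial j (\<lambda>z. z $ k) z = (if j = k then 1 else 0)"
proof -
  have *: "((\<lambda>z. z $ k) has_derivative (\<lambda>h. \<Sum>j\<in>UNIV. (if j = k then 1 else 0) * h $ j)) (at z)"
    for z :: "complex ^ 'a"
    by (simp add: if_distrib[of "\<lambda>x. x * _"] bounded_linear_imp_has_derivative bounded_linear_vec_nth cong: if_cong)
  show "holomorphic_fun_on (\<lambda>z. z $ k) D"
    by (rule holomorphic_fun_onI) (rule *)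
  show "complex_partial j (\<lambda>z. z $ k) z = (if j = k then 1 else 0)"
    by (rule complex_partial_eqI_fun[OF *])
qed

lemma holomorphic_map_on_has_derivative:
  assumes "holomorphic_map_on g D" "z \<in> D"
  shows "(g has_derivative (\<lambda>h. complex_jacobian g z *v h)) (at z)"
proof (rule has_derivative_vecI)
  fix j
  show "((\<lambda>x. g x $ j) has_derivative (\<lambda>h. (complex_jacobian g z *v h) $ j)) (at z)"
    using holomorphic_fun_on_has_derivative[of "\<lambda>z. g z $ j" D z] assms
    by (simp add: holomorphic_map_on_def matrix_vector_mult_def complex_jacobian_def)
qed

lemma holomorphic_map_on_continuous: "holomorphic_map_on g D \<Longrightarrow> continuous_on D g"
  by (meson continuous_at_imp_continuous_on has_derivative_continuous holomorphic_map_on_has_derivative)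

lemma
  assumes "holomorphic_fun_on f E" "holomorphic_map_on g D" "g ` D \<subseteq> E"
  shows holomorphic_fun_on_compose: "holomorphic_fun_on (\<lambda>z. f (g z)) D"
    and complex_partial_compose: "z \<in> D \<Longrightarrow> complex_partial k (\<lambda>z. f (g z)) z =
      (\<Sum>j\<in>UNIV. complex_partial j f (g z) * complex_jacobian g z $ j $ k)"
proof -
  have *: "((\<lambda>z. f (g z)) has_derivative (\<lambda>h. \<Sum>k\<in>UNIV. (\<Sum>j\<in>UNIV. complex_partial j f (g z) *
      complex_jacobian g z $ j $ k) * h $ k)) (at z)"
    if "z \<in> D" for z
  proof -
    have "g z \<in> E" using assms that by auto
    have "(\<Sum>j\<in>UNIV. complex_partial j f (g z) * (complex_jacobian g z *v h) $ j) =
       (\<Sum>k\<in>UNIV. (\<Sum>j\<in>UNIV. complex_partial j f (g z) * complex_jacobian g z $ j $ k) * h $ k)" for h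
      unfolding matrix_vector_mult_def
      by (simp add: sum_distrib_left sum_distrib_right mult_ac)(rule sum.swap)
    with has_derivative_compose[OF holomorphic_map_on_has_derivative[OF assms(2) that]
        holomorphic_fun_on_has_derivative[OF assms(1) \<open>g z \<in> E\<close>]]
    show ?thesis by simp
  qed
  show "holomorphic_fun_on (\<lambda>z. f (g z)) D"
    by (rule holomorphic_fun_onI) (rule *)
  show "complex_partial k (\<lambda>z. f (g z)) z =
      (\<Sum>j\<in>UNIV. complex_partial j f (g z) * complex_jacobian g z $ j $ k)" if "z \<in> D"
    by (rule complex_partial_eqI_fun[OF *[OF that]])
qed

lemma complex_directional_compose:
  assumes "holomorphic_fun_on f E" "holomorphic_map_on g D" "g ` D \<subseteq> E" "z \<in> D"
  shows "(\<Sum>k\<in>UNIV. complex_partial k (\<lambda>z. f (g z)) z * u $ k) =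
    (\<Sum>j\<in>UNIV. complex_partial j f (g z) * (complex_jacobian g z *v u) $ j)"
  unfolding complex_partial_compose[OF assms] matrix_vector_mult_def
  by (simp add: sum_distrib_left sum_distrib_right mult_ac) (rule sum.swap)

lemma holomorphic_slice:
  fixes f :: "complex ^ 'n \<Rightarrow> complex"
  assumes "holomorphic_fun_on f D" "\<And>t. t \<in> T \<Longrightarrow> z + t *s u \<in> D"
  shows "(\<lambda>t. f (z + t *s u)) holomorphic_on T"
proof -
  have "((\<lambda>t. f (z + t *s u)) has_field_derivative
      (\<Sum>k\<in>UNIV. (\<chi> k. complex_partial k f (z + t *s u)) $ k * u $ k)) (at t within T)" if "t \<in> T" for t
    by (rule has_field_derivative_at_within, rule slice_has_field_derivative)
      (use holomorphic_fun_on_has_derivative[OF assms(1) assms(2)[OF that]] in simp)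
  then show ?thesis
    unfolding holomorphic_on_def field_differentiable_def by blast
qed

section \<open>Osgood's lemma and holomorphy of partial derivatives\<close>

text \<open>Cauchy's inequality is applied on the circle of half the radius, where \<open>h\<close> is continuous; this costs
  the factor 2.\<close>

lemma cauchy_estimate:
  assumes "h holomorphic_on ball c r" "0 < r" "\<And>t. t \<in> ball c r \<Longrightarrow> cmod (h t) \<le> M"
  shows "cmod (deriv h c) \<le> 2 * M / r"
proof -
  have sub: "ball c (r/2) \<subseteq> ball c r" "cball c (r/2) \<subseteq> ball c r"
    using assms(2) by auto
  have "cmod ((deriv ^^ 1) h c) \<le> fact 1 * M / (r/2) ^ 1"
  proof (rule Cauchy_inequality)
    show "h holomorphic_on ball c (r/2)" "continuous_on (cball c (r/2)) h"
      using holomorphic_on_subset[OF assms(1) sub(1)]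
        continuous_on_subset[OF holomorphic_on_imp_continuous_on[OF assms(1)] sub(2)] by auto
    show "cmod (h x) \<le> M" if "cmod (c - x) = r / 2" for x
      using that assms by (auto simp: dist_norm)
  qed (use assms in auto)
  then show ?thesis by (simp add: mult.commute)
qed

text \<open>A second-order Taylor bound that depends only on a bound for \<open>|h|\<close>. Two Cauchy estimates, on discs of
  radius \<open>r/2\<close> and then \<open>r/4\<close>, bound \<open>h''\<close> by \<open>32 M / r\<^sup>2\<close> on the disc of radius \<open>r/4\<close>.\<close>

lemma cauchy_taylor_estimate:
  assumes "h holomorphic_on ball 0 r" "0 < r" "\<And>t. t \<in> ball 0 r \<Longrightarrow> cmod (h t) \<le> M" "cmod t < r / 4"
  shows "cmod (h t - h 0 - t * deriv h 0) \<le> 32 * M / r^2 * (cmod t)^2"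
proof -
  have M: "M \<ge> 0" using assms(2) assms(3)[of 0] by (auto intro: order_trans[OF norm_ge_zero])
  have d1: "cmod (deriv h s) \<le> 4 * M / r" if "s \<in> ball 0 (r/2)" for s
  proof -
    have sub: "ball s (r/2) \<subseteq> ball 0 r"
      using that by (auto intro!: subsetI simp: dist_norm) 
        (smt (verit, ccfv_SIG) field_sum_of_halves norm_minus_commute norm_triangle_sub)
    have "cmod (deriv h s) \<le> 2 * M / (r/2)"
    proof (rule cauchy_estimate)
      show "h holomorphic_on ball s (r/2)"
        using assms(1) sub by (rule holomorphic_on_subset)
    qed (use assms sub in auto)
    then show ?thesis by simp
  qed
  have hol': "deriv h holomorphic_on ball 0 r"
    using assms by (simp add: holomorphic_deriv)
  have d2: "cmod (deriv (deriv h) s) \<le> 32 * M / r^2" if "s \<in> ball 0 (r/4)" for s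
  proof -
    have sub: "ball s (r/4) \<subseteq> ball 0 (r/2)"
      using that by (auto intro!: subsetI simp: dist_norm)
        (smt (verit, ccfv_SIG) field_sum_of_halves norm_minus_commute norm_triangle_sub)
    have "cmod (deriv (deriv h) s) \<le> 2 * (4 * M / r) / (r/4)"
    proof (rule cauchy_estimate)
      have "ball s (r/4) \<subseteq> ball 0 r"
        using sub assms(2) by (auto dest!: subsetD)
      with hol' show "deriv h holomorphic_on ball s (r/4)"
        by (rule holomorphic_on_subset)
    qed (use assms sub d1 in auto)
    then show ?thesis by (simp add: power2_eq_square)
  qed
  define F where "F i = (deriv ^^ i) h" for i
  have "cmod (F 0 t - (\<Sum>i\<le>1. F i 0 * (t - 0) ^ i / fact i)) \<le> 32 * M / r^2 * cmod (t - 0) ^ Suc 1 / fact 1"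
  proof (rule complex_Taylor[of "ball 0 (r/4)"])
    fix i x assume x: "x \<in> ball (0::complex) (r/4)" "i \<le> (1::nat)"
    have "F i holomorphic_on ball 0 r"
      unfolding F_def using assms by (simp add: holomorphic_higher_deriv)
    then have "(F i has_field_derivative deriv (F i) x) (at x)"
      using x assms by (intro holomorphic_derivI[of _ "ball 0 r"]) auto
    then show "(F i has_field_derivative F (Suc i) x) (at x within ball 0 (r/4))"
      unfolding F_def by (simp add: has_field_derivative_at_within)
  next
    fix x assume "x \<in> ball (0::complex) (r/4)"
    then show "cmod (F (Suc 1) x) \<le> 32 * M / r^2"
      using d2 by (simp add: F_def)
  qed (use assms in auto)
  then show ?thesis
    by (simp add: F_def power2_eq_square algebra_simps)
qed

text \<open>Passing from \<open>0\<close> to \<open>h\<close> by changing one coordinate at a time reduces an estimate in several variables to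
  estimates along coordinate directions; all intermediate points lie in the ball of radius \<open>norm h\<close>.\<close>

lemma telescope_coordinates:
  fixes F :: "complex ^ 'n \<Rightarrow> complex"
    and e :: real
  assumes "\<And>p k. norm p \<le> norm h \<Longrightarrow> norm (p + h $ k *s axis k 1) \<le> norm h \<Longrightarrow> 
      cmod (F (p + h $ k *s axis k 1) - F p - c k) \<le> e"
  shows "cmod (F h - F 0 - (\<Sum>k\<in>UNIV. c k)) \<le> CARD('n) * e"
proof -
  define q where "q A = (\<chi> k. if k \<in> A then h $ k else 0)" for A
  have norm_q: "norm (q A) \<le> norm h" for A
    unfolding q_def norm_vec_def L2_set_def by (intro real_sqrt_le_mono sum_mono) auto
  have "cmod (F (q A) - F (q {}) - (\<Sum>k\<in>A. c k)) \<le> card A * e" if "finite A" for A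
    using that
  proof (induction A)
    case (insert k A)
    have q_insert: "q (insert k A) = q A + h $ k *s axis k 1"
      using insert.hyps by (auto simp: q_def vec_eq_iff axis_def)
    have "cmod (F (q (insert k A)) - F (q A) - c k) \<le> e"
      unfolding q_insert by (rule assms) (use norm_q[of A] norm_q[of "insert k A"] q_insert in auto)
    moreover have "F (q (insert k A)) - F (q {}) - (\<Sum>k\<in>insert k A. c k) =
       (F (q (insert k A)) - F (q A) - c k) + (F (q A) - F (q {}) - (\<Sum>k\<in>A. c k))"
      using insert.hyps by simp
    ultimately have "cmod (F (q (insert k A)) - F (q {}) - (\<Sum>k\<in>insert k A. c k)) \<le> e + card A * e"
      using insert.IH by (simp only: norm_triangle_mono)
    then show ?case
      using insert.hyps by (simp add: algebra_simps)
  qed simp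
  from this[of UNIV] show ?thesis
    by (simp add: q_def zero_vec_def[symmetric])
qed

lemma has_derivative_quadraticI:
  fixes f :: "'a::real_normed_vector \<Rightarrow> 'b::real_normed_vector"
  assumes "bounded_linear f'" "0 < r"
    and "\<And>h. norm h < r \<Longrightarrow> norm (f (z + h) - f z - f' h) \<le> C * (norm h)\<^sup>2"
  shows "(f has_derivative f') (at z)"
  unfolding has_derivative_at
proof
  have "((\<lambda>h. norm (f (z + h) - f z - f' h) / norm h) \<longlongrightarrow> 0) (at 0)"
  proof (rule Lim_null_comparison[where g="\<lambda>h. C * norm h"])
    have "\<forall>\<^sub>F h in at 0. dist h 0 < r"
      using assms(2) by (metis eventually_at)
    then show "\<forall>\<^sub>F h in at 0. norm (norm (f (z + h) - f z - f' h) / norm h) \<le> C * norm h"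
    proof eventually_elim
      case (elim h)
      then have "norm (f (z + h) - f z - f' h) \<le> C * norm h * norm h"
        using assms(3)[of h] by (simp add: power2_eq_square mult.assoc)
      then show ?case
        by (cases "h = 0") (simp_all add: divide_le_eq)
    qed
    show "((\<lambda>h. C * norm h) \<longlongrightarrow> 0) (at 0)"
      by (rule tendsto_eq_intros refl tendsto_norm | simp)+
  qed
  then show "(\<lambda>h. norm (f (z + h) - f z - f' h) / norm h) \<midarrow>0\<rightarrow> 0" .
qed (rule assms(1))

definition separately_holomorphic_on :: "(complex ^ 'n \<Rightarrow> complex) \<Rightarrow> (complex ^ 'n) set \<Rightarrow> bool" where
  "separately_holomorphic_on f S \<longleftrightarrow>
     (\<forall>z\<in>S. \<forall>k. (\<lambda>t. f (z + t *s axis k 1)) field_differentiable at 0)"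

definition locally_bounded_on :: "('a::metric_space \<Rightarrow> complex) \<Rightarrow> 'a set \<Rightarrow> bool" where
  "locally_bounded_on f S \<longleftrightarrow> (\<forall>z\<in>S. \<exists>r>0. \<exists>M. \<forall>w\<in>ball z r. cmod (f w) \<le> M)"

lemma locally_bounded_onE:
  assumes "locally_bounded_on f S" "open S" "z \<in> S"
  obtains r M where "0 < r" "ball z r \<subseteq> S" "\<And>w. w \<in> ball z r \<Longrightarrow> cmod (f w) \<le> M"
proof -
  obtain r M where "0 < r" "\<forall>w\<in>ball z r. cmod (f w) \<le> M"
    using assms unfolding locally_bounded_on_def by blast
  moreover obtain s where "0 < s" "ball z s \<subseteq> S"
    using assms openE by blast
  ultimately show thesis
    by (intro that[of "min r s" M]) auto
qed

lemma locally_bounded_on_continuous: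
  assumes "continuous_on S f" "open S"
  shows "locally_bounded_on f S"
  unfolding locally_bounded_on_def
proof
  fix z assume "z \<in> S"
  then have "isCont f z"
    using assms by (simp add: continuous_on_eq_continuous_at)
  then obtain r where r: "r > 0" "\<And>w. dist w z < r \<Longrightarrow> dist (f w) (f z) < 1"
    unfolding continuous_at_eps_delta by (metis zero_less_one)
  have "cmod (f w) \<le> cmod (f z) + 1" if "w \<in> ball z r" for w
    using r(2)[of w] that norm_triangle_sub[of "f w" "f z"] by (simp add: dist_commute dist_norm)
  with r(1) show "\<exists>r>0. \<exists>M. \<forall>w\<in>ball z r. cmod (f w) \<le> M" by blast
qed

lemma holomorphic_fun_on_separately:
  assumes "holomorphic_fun_on f S"
  shows "separately_holomorphic_on f S"
  unfolding separately_holomorphic_on_def field_differentiable_def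
proof safe
  fix z k assume "z \<in> S"
  show "\<exists>f'. ((\<lambda>t. f (z + t *s axis k 1)) has_field_derivative f') (at 0)"
    by (rule exI, rule slice_has_field_derivative[where a="\<chi> k. complex_partial k f z"])
      (use holomorphic_fun_on_has_derivative[OF assms \<open>z \<in> S\<close>] in simp)
qed

lemma partial_has_field_derivative:
  assumes "holomorphic_fun_on f D" "z \<in> D"
  shows "((\<lambda>t. f (z + t *s axis k 1)) has_field_derivative complex_partial k f z) (at 0)"
proof -
  have "(\<lambda>t. f (z + t *s axis k 1)) field_differentiable at 0"
    using holomorphic_fun_on_separately[OF assms(1)] assms(2) by (simp add: separately_holomorphic_on_def)
  then show ?thesis
    unfolding complex_partial_def by (simp add: DERIV_deriv_iff_field_differentiable)
qed

lemma mem_ball_shift: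
  fixes z :: "complex ^ 'n"
  assumes "w \<in> ball z s" "cmod t < r - s"
  shows "w + t *s axis k 1 \<in> ball z r"
proof -
  have "dist z (w + t *s axis k 1) \<le> dist z w + dist w (w + t *s axis k 1)"
    by (rule dist_triangle)
  also have "dist w (w + t *s axis k 1) = cmod t"
    by (simp add: dist_norm)
  finally show ?thesis using assms by simp
qed

text \<open>The slice is defined near \<open>0\<close> only as long as it stays in the ball on which \<open>f\<close> is controlled: from a point
  at distance less than \<open>s\<close> from the centre one can move by \<open>r - s\<close>.\<close>

lemma separately_holomorphic_slice:
  fixes z :: "complex ^ 'n"
  assumes "separately_holomorphic_on f S" "ball z r \<subseteq> S" "w \<in> ball z s"
  shows "(\<lambda>t. f (w + t *s axis k 1)) holomorphic_on ball 0 (r - s)"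
proof (rule holomorphic_onI)
  fix t :: complex assume t: "t \<in> ball 0 (r - s)"
  then have "w + t *s axis k 1 \<in> S"
    using mem_ball_shift[OF assms(3)] assms(2) by auto
  then obtain D where "((\<lambda>s. f (w + t *s axis k 1 + s *s axis k 1)) has_field_derivative D) (at 0)"
    using assms(1) unfolding separately_holomorphic_on_def field_differentiable_def by blast
  moreover have "w + t *s axis k 1 + s *s axis k 1 = w + (s + t) *s axis k 1" for s
    by (simp add: vec_eq_iff algebra_simps)
  ultimately have "((\<lambda>s. f (w + s *s axis k 1)) has_field_derivative D) (at t)"
    using DERIV_shift[of "\<lambda>s. f (w + s *s axis k 1)" D 0 t] by simp
  then show "(\<lambda>t. f (w + t *s axis k 1)) field_differentiable at t within ball 0 (r - s)"
    using field_differentiable_at_within field_differentiable_def by blast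
qed

text \<open>The one-variable estimates, applied to slices of radius \<open>r/2\<close>. The point is that the bounds are uniform in
  the base point of the slice.\<close>

lemma separately_holomorphic_estimates:
  fixes z :: "complex ^ 'n"
  assumes "separately_holomorphic_on f S" "ball z r \<subseteq> S" "0 < r"
    and M: "\<And>w. w \<in> ball z r \<Longrightarrow> cmod (f w) \<le> M"
    and w: "w \<in> ball z (r/2)"
  shows "cmod (complex_partial k f w) \<le> 4 * M / r"
    and "cmod t < r / 8 \<Longrightarrow>
      cmod (f (w + t *s axis k 1) - f w - t * complex_partial k f w) \<le> 128 * M / r^2 * (cmod t)^2"
proof -
  define h where "h t = f (w + t *s axis k 1)" for t
  have hol: "h holomorphic_on ball 0 (r/2)"
    using separately_holomorphic_slice[OF assms(1,2) w, of k] by (simp add: h_def[abs_def])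
  have bd: "cmod (h t) \<le> M" if "t \<in> ball 0 (r/2)" for t
    unfolding h_def using mem_ball_shift[OF w, of t r] that by (intro M) simp
  have dh: "complex_partial k f w = deriv h 0"
    by (simp add: complex_partial_def h_def[abs_def])
  show "cmod (complex_partial k f w) \<le> 4 * M / r"
    unfolding dh using cauchy_estimate[OF hol _ bd] assms(3) by simp
  show "cmod (f (w + t *s axis k 1) - f w - t * complex_partial k f w) \<le> 128 * M / r^2 * (cmod t)^2"
    if "cmod t < r / 8"
  proof -
    have "h 0 = f w" "h t = f (w + t *s axis k 1)"
      by (simp_all add: h_def)
    then show ?thesis
      using cauchy_taylor_estimate[OF hol _ bd, of t] assms(3) that unfolding dh
      by (simp add: power2_eq_square)
  qed
qed

text \<open>The Cauchy estimates make \<open>f\<close> Lipschitz along coordinate directions, hence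
  Lipschitz by telescoping. The difference of two parallel slices is then small and holomorphic, so its
  derivative at \<open>0\<close> is small, which makes the partial derivatives Lipschitz at \<open>z\<close>. Telescoping the
  second-order Taylor bounds now gives a quadratic error for the linear approximation at \<open>z\<close>.\<close>

theorem osgood:
  fixes f :: "complex ^ 'n \<Rightarrow> complex"
  assumes "open S" "separately_holomorphic_on f S" "locally_bounded_on f S"
  shows "holomorphic_fun_on f S"
proof (rule holomorphic_fun_onI)
  fix z assume "z \<in> S"
  then obtain r M where r: "0 < r" "ball z r \<subseteq> S" and M: "\<And>w. w \<in> ball z r \<Longrightarrow> cmod (f w) \<le> M"
    using locally_bounded_onE[OF assms(3,1)] by metis
  have "M \<ge> 0" using M[of z] r(1) by (simp add: order_trans[OF norm_ge_zero])
  define C where "C = 128 * M / r^2"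
  define L where "L = 4 * M / r + C * r"
  define L2 where "L2 = CARD('n) * L * (64 / r)"
  have pos: "C \<ge> 0" "L \<ge> 0" "L2 \<ge> 0" using \<open>M \<ge> 0\<close> r(1) by (auto simp: C_def L_def L2_def)
  have est: "cmod (complex_partial k f w) \<le> 4 * M / r"
      "cmod t < r / 8 \<Longrightarrow> cmod (f (w + t *s axis k 1) - f w - t * complex_partial k f w) \<le> C * (cmod t)\<^sup>2"
    if "w \<in> ball z (r/2)" for w k t
    using separately_holomorphic_estimates(1)[OF assms(2) r(2,1) M that, of k]
      separately_holomorphic_estimates(2)[OF assms(2) r(2,1) M that, of t k] by (simp_all add: C_def)
  have step: "cmod (f (w + t *s axis k 1) - f w) \<le> L * cmod t"
    if "w \<in> ball z (r/2)" "cmod t < r/8" for w t k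
  proof -
    have "cmod (f (w + t *s axis k 1) - f w) \<le> C * (cmod t)^2 + cmod t * (4 * M / r)"
    proof -
      have "cmod (f (w + t *s axis k 1) - f w) \<le>
          cmod (f (w + t *s axis k 1) - f w - t * complex_partial k f w) + cmod (t * complex_partial k f w)"
        by (metis diff_add_cancel norm_triangle_ineq)
      also have "\<dots> \<le> C * (cmod t)^2 + cmod t * (4 * M / r)"
        unfolding norm_mult using est(2)[OF that] est(1)[OF that(1)]
        by (intro add_mono mult_left_mono) auto
      finally show ?thesis .
    qed
    also have "C * (cmod t)^2 \<le> C * r * cmod t"
      unfolding power2_eq_square mult.assoc using that(2) r(1) pos by (intro mult_left_mono mult_right_mono) auto
    finally show ?thesis by (simp add: L_def algebra_simps)
  qed
  \<comment> \<open>Two points of this ball are less than \<open>r/8\<close> apart, the range of the estimate \<open>step\<close>, and the path between them stays in the ball of radius \<open>r/2\<close>.\<close>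
  have lip: "cmod (f w' - f w) \<le> CARD('n) * (L * dist w' w)"
    if "w \<in> ball z (r/16)" "w' \<in> ball z (r/16)" for w w'
  proof -
    have d: "dist w' w < r/8"
      using dist_triangle3[of w' w z] that by simp
    have "cmod (f (w + (w' - w)) - f (w + 0) - (\<Sum>k\<in>(UNIV::'n set). 0)) \<le> CARD('n) * (L * dist w' w)"
    proof (rule telescope_coordinates)
      fix p :: "complex ^ 'n" and k
      assume p: "norm p \<le> norm (w' - w)"
      have "dist z (w + p) \<le> dist z w + norm p"
        using dist_triangle[of z "w + p" w] by (simp add: dist_norm)
      then have "w + p \<in> ball z (r/2)"
        using p d that r(1) by (simp add: dist_norm)
      moreover have le: "cmod ((w' - w) $ k) \<le> dist w' w"
        unfolding dist_norm by (rule Finite_Cartesian_Product.norm_nth_le)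
      ultimately have "cmod (f (w + p + (w' - w) $ k *s axis k 1) - f (w + p)) \<le> L * cmod ((w' - w) $ k)"
        using d by (intro step) auto
      also have "\<dots> \<le> L * dist w' w"
        using le pos by (intro mult_left_mono)
      finally show "cmod (f (w + (p + (w' - w) $ k *s axis k 1)) - f (w + p) - 0) \<le> L * dist w' w"
        by (simp add: add.assoc)
    qed
    then show ?thesis by simp
  qed
  have part: "cmod (complex_partial k f w - complex_partial k f z) \<le> L2 * dist w z"
    if w: "w \<in> ball z (r/32)" for w k
  proof -
    define h where "h t = f (w + t *s axis k 1) - f (z + t *s axis k 1)" for t
    have hol: "(\<lambda>t. f (v + t *s axis k 1)) holomorphic_on ball 0 (r/32)" if "v \<in> ball z (r/32)" for v
    proof -
      have "ball z (r/16) \<subseteq> S"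
        using r by (auto intro!: subsetD[OF r(2)])
      from separately_holomorphic_slice[OF assms(2) this that, of k] show ?thesis by simp
    qed
    have "(\<lambda>t. f (v + t *s axis k 1)) field_differentiable at 0" if "v \<in> ball z (r/32)" for v
      using holomorphic_on_imp_differentiable_at[OF hol[OF that]] r(1) by auto
    then have "deriv h 0 = complex_partial k f w - complex_partial k f z"
      unfolding h_def complex_partial_def using w r(1) by (intro deriv_diff) auto
    moreover have "cmod (deriv h 0) \<le> 2 * (CARD('n) * (L * dist w z)) / (r/32)"
    proof (rule cauchy_estimate)
      show "h holomorphic_on ball 0 (r/32)"
        unfolding h_def using w r(1) by (intro holomorphic_intros hol) auto
      show "cmod (h t) \<le> CARD('n) * (L * dist w z)" if "t \<in> ball 0 (r/32)" for t
        unfolding h_def using that w r(1) lip[of "z + t *s axis k 1" "w + t *s axis k 1"]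
          mem_ball_shift[of w z "r/32" t "r/16" k] mem_ball_shift[of z z "r/32" t "r/16" k]
        by (auto simp: dist_norm)
    qed (use r in auto)
    moreover have "2 * (CARD('n) * (L * dist w z)) / (r/32) = L2 * dist w z"
      by (simp add: L2_def)
    ultimately show ?thesis by metis
  qed
  have quad: "cmod (f (z + h) - f z - (\<Sum>k\<in>UNIV. complex_partial k f z * h $ k)) \<le> CARD('n) * (C + L2) * (norm h)\<^sup>2"
    if h: "norm h < r/32" for h
  proof -
    have "cmod (f (z + h) - f (z + 0) - (\<Sum>k\<in>UNIV. complex_partial k f z * h $ k)) \<le> CARD('n) * ((C + L2) * (norm h)\<^sup>2)"
    proof (rule telescope_coordinates)
      fix p :: "complex ^ 'n" and k assume p: "norm p \<le> norm h"
      have hk: "cmod (h $ k) \<le> norm h" by (rule Finite_Cartesian_Product.norm_nth_le)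
      have zp: "z + p \<in> ball z (r/32)" "dist (z + p) z = norm p" using p h by (auto simp: dist_norm)
      have "f (z + (p + h $ k *s axis k 1)) - f (z + p) - complex_partial k f z * h $ k =
         (f (z + p + h $ k *s axis k 1) - f (z + p) - h $ k * complex_partial k f (z + p)) +
          h $ k * (complex_partial k f (z + p) - complex_partial k f z)"
        by (simp add: algebra_simps)
      also have "cmod \<dots> \<le> C * (norm h)\<^sup>2 + norm h * (L2 * norm h)"
      proof (rule norm_triangle_mono)
        have "cmod (f (z + p + h $ k *s axis k 1) - f (z + p) - h $ k * complex_partial k f (z + p))
           \<le> C * (cmod (h $ k))\<^sup>2"
          using hk h zp(1) r(1) by (intro est(2)) auto
        also have "\<dots> \<le> C * (norm h)\<^sup>2"
          using hk pos by (intro mult_left_mono power_mono) auto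
        finally show "cmod (f (z + p + h $ k *s axis k 1) - f (z + p) - h $ k * complex_partial k f (z + p))
           \<le> C * (norm h)\<^sup>2" .
        have "cmod (complex_partial k f (z + p) - complex_partial k f z) \<le> L2 * norm h"
          using part[OF zp(1), of k] zp(2) p pos by (metis mult_left_mono order_trans)
        then show "cmod (h $ k * (complex_partial k f (z + p) - complex_partial k f z)) \<le> norm h * (L2 * norm h)"
          unfolding norm_mult using hk by (intro mult_mono) auto
      qed
      finally show "cmod (f (z + (p + h $ k *s axis k 1)) - f (z + p) - complex_partial k f z * h $ k)
          \<le> (C + L2) * (norm h)\<^sup>2"
        by (simp add: algebra_simps power2_eq_square)
    qed
    then show ?thesis by (simp add: mult.assoc)
  qed
  show "(f has_derivative (\<lambda>h. \<Sum>k\<in>UNIV. complex_partial k f z * h $ k)) (at z)"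
  proof (rule has_derivative_quadraticI[where r="r/32", OF _ _ quad])
    show "bounded_linear (\<lambda>h. \<Sum>k\<in>UNIV. complex_partial k f z * h $ k)"
      by (intro bounded_linear_sum bounded_linear_const_mult bounded_linear_vec_nth)
  qed (use r(1) in auto)
qed

text \<open>By Osgood's lemma it is enough to look at slices. Along a slice the partial derivative is the uniform
  limit of holomorphic difference quotients; the Taylor bound controls the error uniformly.\<close>

theorem holomorphic_complex_partial:
  fixes f :: "complex ^ 'n \<Rightarrow> complex"
  assumes "open S" "holomorphic_fun_on f S"
  shows "holomorphic_fun_on (complex_partial k f) S"
proof (rule osgood[OF assms(1)])
  note sep = holomorphic_fun_on_separately[OF assms(2)]
  have lb: "locally_bounded_on f S"
    by (rule locally_bounded_on_continuous[OF holomorphic_fun_on_continuous[OF assms(2)] assms(1)])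
  show "locally_bounded_on (complex_partial k f) S"
    unfolding locally_bounded_on_def
  proof
    fix z assume "z \<in> S"
    then obtain r M where r: "0 < r" "ball z r \<subseteq> S" and M: "\<And>w. w \<in> ball z r \<Longrightarrow> cmod (f w) \<le> M"
      using locally_bounded_onE[OF lb assms(1)] by metis
    show "\<exists>r>0. \<exists>M. \<forall>w\<in>ball z r. cmod (complex_partial k f w) \<le> M"
      using separately_holomorphic_estimates(1)[OF sep r(2,1) M] r(1)
      by (intro exI[of _ "r/2"] conjI exI[of _ "4 * M / r"]) auto
  qed
  show "separately_holomorphic_on (complex_partial k f) S"
    unfolding separately_holomorphic_on_def
  proof (intro ballI allI)
    fix z j assume "z \<in> S"
    then obtain r M where r: "0 < r" "ball z r \<subseteq> S" and M: "\<And>w. w \<in> ball z r \<Longrightarrow> cmod (f w) \<le> M"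
      using locally_bounded_onE[OF lb assms(1)] by metis
    have "M \<ge> 0" using M[of z] r(1) by (simp add: order_trans[OF norm_ge_zero])
    define s where "s n = complex_of_real (r / (16 * (real n + 1)))" for n
    have cmod_s: "cmod (s n) = r / (16 * (real n + 1))" for n
      unfolding s_def norm_of_real using r(1) by simp
    have "cmod (s n) > 0" for n
      unfolding cmod_s using r(1) by simp
    moreover have "cmod (s n) < r / 8" for n
    proof -
      have "8 < 16 * (real n + 1)" by simp
      then show ?thesis
        unfolding cmod_s using r(1) by (intro divide_strict_left_mono) auto
    qed
    ultimately have s: "s n \<noteq> 0" "cmod (s n) < r / 8" for n
      by fastforce+
    define q where "q n t = (f (z + t *s axis j 1 + s n *s axis k 1) - f (z + t *s axis j 1)) / s n" for n t
    have zt: "z + t *s axis j 1 \<in> ball z (r/2)" if "cmod t \<le> r/4" for t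
      using that r(1) by (simp add: dist_norm)
    have est: "cmod (q n t - complex_partial k f (z + t *s axis j 1)) \<le> 128 * M / r^2 * cmod (s n)"
      if "cmod t \<le> r/4" for n t
    proof -
      have "q n t - complex_partial k f (z + t *s axis j 1) =
        (f (z + t *s axis j 1 + s n *s axis k 1) - f (z + t *s axis j 1) - s n * complex_partial k f (z + t *s axis j 1)) / s n"
        using s by (simp add: q_def field_simps)
      also have "cmod \<dots> \<le> (128 * M / r^2 * (cmod (s n))^2) / cmod (s n)"
        unfolding norm_divide
        by (intro divide_right_mono separately_holomorphic_estimates(2)[OF sep r(2,1) M zt] s that) auto
      also have "\<dots> = 128 * M / r^2 * cmod (s n)"
        using s by (simp add: power2_eq_square)
      finally show ?thesis .
    qed
    have "\<forall>\<^sub>F n in sequentially. continuous_on (cball 0 (r/8)) (q n) \<and> q n holomorphic_on ball 0 (r/8)"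
    proof (intro always_eventually allI)
      fix n
      have "(\<lambda>t. f ((z + s n *s axis k 1) + t *s axis j 1)) holomorphic_on ball 0 (r/4)"
        using separately_holomorphic_slice[OF sep r(2), of "z + s n *s axis k 1" "3 * r / 4" j] s(2)[of n] r(1)
        by (simp add: dist_norm)
      then have 1: "(\<lambda>t. f (z + t *s axis j 1 + s n *s axis k 1)) holomorphic_on ball 0 (r/4)"
        by (simp add: add_ac)
      have 2: "(\<lambda>t. f (z + t *s axis j 1)) holomorphic_on ball 0 (r/4)"
        using separately_holomorphic_slice[OF sep r(2), of z "3 * r / 4" j] r(1) by simp
      have *: "q n holomorphic_on ball 0 (r/4)"
        unfolding q_def by (intro holomorphic_intros 1 2 s)
      have "cball 0 (r/8) \<subseteq> ball (0::complex) (r/4)" "ball 0 (r/8) \<subseteq> ball (0::complex) (r/4)"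
        using r(1) by auto
      then show "continuous_on (cball 0 (r/8)) (q n) \<and> q n holomorphic_on ball 0 (r/8)"
        using * holomorphic_on_imp_continuous_on holomorphic_on_subset by blast
    qed
    moreover have "uniform_limit (cball 0 (r/8)) q (\<lambda>t. complex_partial k f (z + t *s axis j 1)) sequentially"
    proof (rule uniform_limitI)
      fix e :: real assume "e > 0"
      have "(\<lambda>n. 128 * M / r^2 * cmod (s n)) \<longlonglongrightarrow> 0"
        unfolding cmod_s by real_asymp
      then have "\<forall>\<^sub>F n in sequentially. 128 * M / r^2 * cmod (s n) < e"
        using \<open>e > 0\<close> by (rule order_tendstoD)
      then show "\<forall>\<^sub>F n in sequentially. \<forall>t\<in>cball 0 (r/8). dist (q n t) (complex_partial k f (z + t *s axis j 1)) < e"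
      proof eventually_elim
        case (elim n)
        show ?case
        proof
          fix t :: complex assume "t \<in> cball 0 (r/8)"
          then have "cmod t \<le> r/4" using r(1) by simp
          from le_less_trans[OF est[OF this] elim]
          show "dist (q n t) (complex_partial k f (z + t *s axis j 1)) < e"
            by (simp add: dist_norm)
        qed
      qed
    qed
    ultimately have "(\<lambda>t. complex_partial k f (z + t *s axis j 1)) holomorphic_on ball 0 (r/8)"
      by (rule holomorphic_uniform_limit) auto
    then show "(\<lambda>t. complex_partial k f (z + t *s axis j 1)) field_differentiable at 0"
      using r(1) holomorphic_on_imp_differentiable_at by auto
  qed
qed

section \<open>Change of variables for biholomorphic maps\<close>

text \<open>The change of variables theorem is available for \<open>real ^ 'm\<close> with a well-ordered index type. Numerals
  supply one: \<open>'n bit0\<close> has twice as many elements as \<open>'n\<close>, and is well-ordered even when \<open>'n\<close> is not. Any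
  bijection with the real basis of \<open>complex ^ 'n\<close> serves as a coordinate frame.\<close>

definition real_frame :: "'n::finite bit0 \<Rightarrow> complex ^ 'n" where
  "real_frame = (SOME b. bij_betw b UNIV Basis)"

lemma bij_real_frame: "bij_betw (real_frame :: 'n::finite bit0 \<Rightarrow> complex ^ 'n) UNIV Basis"
proof -
  have "\<exists>b :: 'n bit0 \<Rightarrow> complex ^ 'n. bij_betw b UNIV Basis"
    by (intro finite_same_card_bij) (auto simp: mult.commute)
  then show ?thesis
    unfolding real_frame_def by (rule someI_ex)
qed

definition to_real_coords :: "complex ^ 'n \<Rightarrow> real ^ 'n::finite bit0" where
  "to_real_coords z = (\<chi> i. z \<bullet> real_frame i)"

definition of_real_coords :: "real ^ 'n::finite bit0 \<Rightarrow> complex ^ 'n" where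
  "of_real_coords x = (\<Sum>i\<in>UNIV. x $ i *\<^sub>R real_frame i)"

lemma real_frame_inner: "real_frame i \<bullet> real_frame j = (if i = j then 1 else 0)"
  using bij_real_frame unfolding bij_betw_def inj_on_def
  by (metis UNIV_I inner_Basis rangeI)

lemma to_of_real_coords [simp]: "to_real_coords (of_real_coords x) = x"
  by (simp add: to_real_coords_def of_real_coords_def vec_eq_iff inner_sum_left real_frame_inner
      if_distrib cong: if_cong)

lemma of_to_real_coords [simp]: "of_real_coords (to_real_coords z) = z"
proof -
  have "(\<Sum>b\<in>Basis. (z \<bullet> b) *\<^sub>R b) = (\<Sum>i\<in>UNIV. (z \<bullet> real_frame i) *\<^sub>R real_frame i)"
    by (rule sum.reindex_bij_betw[OF bij_real_frame, symmetric])
  then show ?thesis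
    by (simp add: to_real_coords_def of_real_coords_def euclidean_representation)
qed

lemma linear_of_real_coords: "linear of_real_coords"
  unfolding of_real_coords_def
  by (intro linearI) (simp_all add: scaleR_add_left sum.distrib scaleR_sum_right)

lemma linear_to_real_coords: "linear to_real_coords"
  by (intro linearI) (simp_all add: to_real_coords_def vec_eq_iff inner_add_left)

lemma to_real_coords_image: "to_real_coords ` A = of_real_coords -` A"
proof safe
  fix x assume "of_real_coords x \<in> A"
  then show "x \<in> to_real_coords ` A"
    by (metis image_eqI to_of_real_coords)
qed simp

lemma continuous_real_coords [continuous_intros]:
  "continuous_on A to_real_coords" "continuous_on B of_real_coords"
  by (auto intro!: linear_continuous_on simp: linear_to_real_coords linear_of_real_coords
      linear_conv_bounded_linear[symmetric])

lemma open_to_real_coords: "open A \<Longrightarrow> open (to_real_coords ` A)"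
  unfolding to_real_coords_image by (rule open_vimage) (auto intro: continuous_real_coords)

lemma lborel_real_coords: "distr lborel borel to_real_coords = (lborel :: (real ^ 'n::finite bit0) measure)"
proof (rule lborel_eqI[symmetric])
  have [measurable]: "to_real_coords \<in> borel \<rightarrow>\<^sub>M (borel :: (real ^ 'n bit0) measure)"
    by (intro borel_measurable_continuous_onI continuous_real_coords)
  fix l u :: "real ^ 'n bit0"
  assume le: "\<And>b. b \<in> Basis \<Longrightarrow> l \<bullet> b \<le> u \<bullet> b"
  have le': "l $ i \<le> u $ i" for i
    using le[of "axis i 1"] by (simp add: inner_axis)
  have fr: "of_real_coords x \<bullet> real_frame i = x $ i" for x :: "real ^ 'n bit0" and i
    by (simp add: of_real_coords_def inner_sum_left real_frame_inner if_distrib cong: if_cong)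
  have ball: "(\<forall>b\<in>Basis. Q b) \<longleftrightarrow> (\<forall>i. Q (real_frame i))" for Q :: "complex ^ 'n \<Rightarrow> bool"
    using bij_real_frame unfolding bij_betw_def by (metis UNIV_I image_iff)
  have vim: "to_real_coords -` box l u = box (of_real_coords l) (of_real_coords u)"
    unfolding box_def ball fr by (auto simp: mem_box_cart to_real_coords_def Basis_vec_def inner_axis)
  have "emeasure (distr lborel borel to_real_coords) (box l u) = emeasure lborel (box (of_real_coords l) (of_real_coords u))"
    by (subst emeasure_distr) (auto simp: vim)
  also have "\<dots> = (\<Prod>b\<in>Basis. (of_real_coords u - of_real_coords l) \<bullet> b)"
  proof (rule emeasure_lborel_box)
    fix b :: "complex ^ 'n" assume "b \<in> Basis"
    then show "of_real_coords l \<bullet> b \<le> of_real_coords u \<bullet> b"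
      using le' ball[of "\<lambda>b. of_real_coords l \<bullet> b \<le> of_real_coords u \<bullet> b"] by (simp add: fr)
  qed
  also have "(\<Prod>b\<in>Basis. (of_real_coords u - of_real_coords l) \<bullet> b) = (\<Prod>i\<in>UNIV. u $ i - l $ i)"
    by (subst prod.reindex_bij_betw[OF bij_real_frame, symmetric]) (simp add: inner_diff_left fr)
  also have "\<dots> = (\<Prod>b\<in>Basis. (u - l) \<bullet> b)"
  proof -
    have "bij_betw (\<lambda>i. axis i 1 :: real ^ 'n bit0) UNIV Basis"
      by (auto simp: bij_betw_def inj_on_def axis_eq_axis Basis_vec_def)
    from prod.reindex_bij_betw[OF this, of "\<lambda>b. (u - l) \<bullet> b", symmetric]
    show ?thesis by (simp add: inner_axis)
  qed
  finally show "emeasure (distr lborel borel to_real_coords) (box l u) = (\<Prod>b\<in>Basis. (u - l) \<bullet> b)" .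
qed simp

lemma continuous_on_indicator_borel:
  fixes F :: "'a::euclidean_space \<Rightarrow> real"
  assumes "open S" "continuous_on S F"
  shows "(\<lambda>x. indicator S x *\<^sub>R F x) \<in> borel_measurable borel"
  using assms by (intro borel_measurable_continuous_on_indicator) auto

text \<open>Integrals with respect to \<open>lborel\<close> on \<open>complex ^ 'n\<close> and gauge integrals in real coordinates agree. Continuity
  makes the integrand Borel measurable, which is what allows the passage from the completed measure.\<close>

lemma real_coords_integral:
  fixes F :: "complex ^ 'n \<Rightarrow> real"
  assumes "open S" "continuous_on S F"
  shows "(F \<circ> of_real_coords) absolutely_integrable_on (to_real_coords ` S) \<longleftrightarrow> set_integrable lborel S F"
    and "set_integrable lborel S F \<Longrightarrow>
      integral (to_real_coords ` S) (F \<circ> of_real_coords) = (LINT z:S|lborel. F z)"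
proof -
  define f where "f y = indicator (to_real_coords ` S) y *\<^sub>R (F \<circ> of_real_coords) y" for y
  have f: "f \<in> borel_measurable borel"
    unfolding f_def
    by (intro continuous_on_indicator_borel open_to_real_coords assms continuous_on_compose continuous_real_coords)
      (auto intro: continuous_on_subset[OF assms(2)])
  have T: "to_real_coords \<in> lborel \<rightarrow>\<^sub>M (borel :: (real ^ 'n bit0) measure)"
    using borel_measurable_continuous_onI[OF continuous_real_coords(1)] by simp
  have fT: "f (to_real_coords x) = indicator S x *\<^sub>R F x" for x
    by (auto simp: f_def to_real_coords_image indicator_def)
  have 1: "integrable lborel f \<longleftrightarrow> set_integrable lborel S F"
    using integrable_distr_eq[OF T f] by (simp add: lborel_real_coords fT set_integrable_def)
  have 2: "integral\<^sup>L lborel f = (LINT z:S|lborel. F z)"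
    using integral_distr[OF T f] by (simp add: lborel_real_coords fT set_lebesgue_integral_def)
  have 3: "(F \<circ> of_real_coords) absolutely_integrable_on (to_real_coords ` S) \<longleftrightarrow> integrable lborel f"
    using f unfolding set_integrable_def f_def[symmetric] by (intro integrable_completion) simp
  show "(F \<circ> of_real_coords) absolutely_integrable_on (to_real_coords ` S) \<longleftrightarrow> set_integrable lborel S F"
    using 1 3 by simp
  assume "set_integrable lborel S F"
  then have "integral (to_real_coords ` S) (F \<circ> of_real_coords) = integral\<^sup>L lebesgue f"
    using 1 3 by (subst set_lebesgue_integral_eq_integral(2)[symmetric])
      (auto simp: set_lebesgue_integral_def f_def[abs_def])
  also have "\<dots> = integral\<^sup>L lborel f"
    using f by (intro integral_completion) simp
  finally show "integral (to_real_coords ` S) (F \<circ> of_real_coords) = (LINT z:S|lborel. F z)"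
    using 2 by simp
qed

text \<open>The factor by which a real linear map of \<open>complex ^ 'n\<close> scales Lebesgue measure.\<close>

definition volume_factor :: "(complex ^ 'n \<Rightarrow> complex ^ 'n) \<Rightarrow> real" where
  "volume_factor L = \<bar>det (matrix (to_real_coords \<circ> L \<circ> of_real_coords))\<bar>"

lemma volume_factor_compose:
  assumes "linear L" "linear M"
  shows "volume_factor (L \<circ> M) = volume_factor L * volume_factor M"
proof -
  have "to_real_coords \<circ> (L \<circ> M) \<circ> of_real_coords =
      (to_real_coords \<circ> L \<circ> of_real_coords) \<circ> (to_real_coords \<circ> M \<circ> of_real_coords)"
    by (auto simp: o_def)
  moreover have "linear (to_real_coords \<circ> L \<circ> of_real_coords)" "linear (to_real_coords \<circ> M \<circ> of_real_coords)"
    by (intro linear_compose linear_to_real_coords linear_of_real_coords assms)+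
  ultimately show ?thesis
    by (simp add: volume_factor_def matrix_compose det_mul abs_mult)
qed

lemma volume_factor_id: "volume_factor (\<lambda>x :: complex ^ 'n. x) = 1"
proof -
  have "to_real_coords \<circ> (\<lambda>x. x :: complex ^ 'n) \<circ> of_real_coords = id"
    by (auto simp: o_def)
  then show ?thesis
    unfolding volume_factor_def by (simp only: matrix_id_mat_1 det_I abs_one)
qed

text \<open>Multiplicativity alone determines the factor of an involution. Rotations and shears are products of two
  involutions, so this replaces any computation of real determinants for them.\<close>

lemma volume_factor_involution:
  assumes "linear L" "\<And>x. L (L x) = x"
  shows "volume_factor L = 1"
proof -
  have "L \<circ> L = (\<lambda>x. x)"
    using assms(2) by auto
  then have "volume_factor L * volume_factor L = 1"
    using volume_factor_compose[OF assms(1,1)] by (simp add: volume_factor_id)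
  moreover have "volume_factor L \<ge> 0" by (simp add: volume_factor_def)
  ultimately show ?thesis
    by (metis abs_of_nonneg abs_square_eq_1 power2_eq_square)
qed

text \<open>These matrices play the role of elementary matrices: they contain both the dilations and the shears,
  and they generate all invertible matrices.\<close>

definition row_matrix :: "'n \<Rightarrow> complex ^ 'n \<Rightarrow> complex ^ 'n ^ 'n" where
  "row_matrix k r = (\<chi> i. if i = k then r else axis i 1)"

lemma sum_axis_mult: "(\<Sum>j\<in>UNIV. (axis i 1 :: complex ^ 'n) $ j * y j) = y i"
proof -
  have "(\<Sum>j\<in>UNIV. (axis i 1 :: complex ^ 'n) $ j * y j) = (\<Sum>j\<in>UNIV. if j = i then y j else 0)"
    by (intro sum.cong) (auto simp: axis_def)
  then show ?thesis by simp
qed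

lemma axis_vector_matrix_mult: "axis i 1 v* (B :: complex ^ 'm ^ 'n) = B $ i"
  by (simp add: vector_matrix_mult_def vec_eq_iff mult.commute[of "B $ _ $ _"] sum_axis_mult)

lemma row_matrix_mult_vec:
  fixes x :: "complex ^ 'n"
  shows "row_matrix k r *v x = (\<chi> i. if i = k then (\<Sum>j\<in>UNIV. r $ j * x $ j) else x $ i)"
  by (simp add: row_matrix_def matrix_vector_mult_def vec_eq_iff sum_axis_mult)

lemma det_row_matrix:
  fixes r :: "complex ^ 'n"
  shows "det (row_matrix k r) = r $ k"
proof -
  have row1: "row i (mat 1) = (axis i 1 :: complex ^ 'n)" for i
    by (auto simp: row_def mat_def vec_eq_iff axis_def)
  have "(\<Sum>i\<in>UNIV. r $ i *s axis i 1) = r"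
    by (rule basis_expansion)
  then show ?thesis
    using cramer_lemma_transpose[where x=r and A="mat 1" and k=k]
    by (simp add: row1 row_matrix_def cong: if_cong)
qed

lemma linear_matrix_vec_complex: "linear ((*v) (A :: complex ^ 'n ^ 'm))"
  by (intro linearI)
    (simp_all add: vec_eq_iff matrix_vector_mult_def algebra_simps sum.distrib scaleR_sum_right)

text \<open>A complex coordinate consists of two real ones, which is the source of the square.\<close>

lemma volume_factor_scale_coord:
  assumes "c \<ge> 0"
  shows "volume_factor (\<lambda>x :: complex ^ 'n. \<chi> i. if i = k then c *\<^sub>R x $ i else x $ i) = c\<^sup>2"
proof -
  define L where "L = (\<lambda>x :: complex ^ 'n. \<chi> i. if i = k then c *\<^sub>R x $ i else x $ i)"
  define M where "M = matrix (to_real_coords \<circ> L \<circ> of_real_coords)"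
  define \<mu> where "\<mu> v = (if v $ k = 0 then 1 else c)" for v :: "complex ^ 'n"
  have Lb: "L v = \<mu> v *\<^sub>R v" if v: "v \<in> Basis" for v
  proof -
    obtain j u where "v = axis j u" "u \<in> Basis" using v by (auto simp: Basis_vec_def)
    then show ?thesis by (auto simp: L_def \<mu>_def vec_eq_iff axis_def)
  qed
  have basis: "real_frame j \<in> Basis" for j :: "'n bit0"
    using bij_real_frame by (auto simp: bij_betw_def)
  have of_axis: "of_real_coords (axis j 1) = real_frame j" for j :: "'n bit0"
  proof -
    have "of_real_coords (axis j 1) = (\<Sum>i\<in>UNIV. if i = j then real_frame i else (0 :: complex ^ 'n))"
      unfolding of_real_coords_def by (intro sum.cong) (auto simp: axis_def)
    then show ?thesis by simp
  qed
  have M: "M $ i $ j = (if i = j then \<mu> (real_frame j) else 0)" for i j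
    unfolding M_def matrix_def
    by (simp add: of_axis Lb[OF basis] to_real_coords_def real_frame_inner)
  have "det M = (\<Prod>i\<in>UNIV. M $ i $ i)"
    by (rule det_diagonal) (simp add: M)
  also have "\<dots> = (\<Prod>i\<in>UNIV. \<mu> (real_frame i))" by (simp add: M)
  also have "\<dots> = (\<Prod>v\<in>Basis. \<mu> v)"
    by (rule prod.reindex_bij_betw[OF bij_real_frame])
  also have "\<dots> = (\<Prod>(j,u)\<in>UNIV \<times> {1,\<i>}. \<mu> (axis j u))"
  proof -
    have "bij_betw (\<lambda>(j,u). axis j u) (UNIV \<times> {1,\<i>}) (Basis :: (complex ^ 'n) set)"
      by (auto simp: bij_betw_def inj_on_def axis_eq_axis Basis_vec_def Basis_complex_def)
    from prod.reindex_bij_betw[OF this, of \<mu>, symmetric]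
    show ?thesis by (simp add: case_prod_unfold)
  qed
  also have "\<dots> = (\<Prod>j\<in>UNIV. \<Prod>u\<in>{1,\<i>}. \<mu> (axis j u))"
    by (rule prod.cartesian_product[symmetric])
  also have "\<dots> = (\<Prod>j\<in>UNIV. if j = k then c\<^sup>2 else 1)"
    by (intro prod.cong) (auto simp: \<mu>_def axis_def power2_eq_square complex_eq_iff)
  also have "\<dots> = c\<^sup>2" by simp
  finally show ?thesis
    by (simp add: volume_factor_def M_def[symmetric] L_def[symmetric])
qed

text \<open>Replacing the coordinate \<open>x\<^sub>k\<close> by \<open>\<Sum>r\<^sub>j x\<^sub>j = |c| w (\<sigma>(x) + x\<^sub>k)\<close>, where \<open>c = r\<^sub>k = |c| w\<close>, is a dilation by \<open>|c|\<close> after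
  four real linear involutions, of which \<open>x\<^sub>k \<mapsto> cnj x\<^sub>k\<close> and \<open>x\<^sub>k \<mapsto> w cnj x\<^sub>k\<close> compose to the rotation by \<open>w\<close>, and
  \<open>x\<^sub>k \<mapsto> - x\<^sub>k\<close> and \<open>x\<^sub>k \<mapsto> \<sigma>(x) - x\<^sub>k\<close> to the shear.\<close>

lemma volume_factor_row_matrix:
  fixes r :: "complex ^ 'n"
  assumes "r $ k \<noteq> 0"
  shows "volume_factor ((*v) (row_matrix k r)) = (cmod (r $ k))\<^sup>2"
proof -
  define c where "c = r $ k"
  define w where "w = c / cmod c"
  have w: "w * cnj w = 1" "cmod c * w = c"
  proof -
    have "c * cnj c = cmod c * cmod c"
      by (simp only: complex_norm_square[symmetric] power2_eq_square of_real_mult)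
    then show "w * cnj w = 1" "cmod c * w = c"
      using assms by (auto simp: w_def c_def)
  qed
  define upd where "upd f = (\<lambda>x :: complex ^ 'n. \<chi> i. if i = k then f x else x $ i)" for f
  have lin: "linear (upd f)" if "linear f" for f
    using that unfolding upd_def by (intro linearI) (simp_all add: vec_eq_iff linear_add linear_scale)
  define \<sigma> where "\<sigma> x = (\<Sum>j\<in>UNIV - {k}. r $ j / c * x $ j)" for x
  have l\<sigma>: "linear \<sigma>"
    unfolding \<sigma>_def
    by (intro linearI) (simp_all add: distrib_left add_divide_distrib sum.distrib scaleR_sum_right)
  have \<sigma>_upd: "\<sigma> (upd f x) = \<sigma> x" for f x
    unfolding \<sigma>_def upd_def by (intro sum.cong) auto
  have upd_k: "upd f x $ k = f x" for f x by (simp add: upd_def)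
  have upd_upd: "upd f (upd g x) = upd (\<lambda>x. f (upd g x)) x" for f g x
    by (simp add: upd_def vec_eq_iff)
  have upd_id: "upd (\<lambda>x. x $ k) x = x" for x
    by (simp add: upd_def vec_eq_iff)
  have l1: "linear (upd (\<lambda>x. \<sigma> x - x $ k))"
    by (intro lin) (use l\<sigma> in \<open>auto intro!: linearI simp: linear_add linear_scale algebra_simps\<close>)
  have l2: "linear (upd (\<lambda>x. - (x $ k)))"
    by (intro lin linearI) auto
  have l3: "linear (upd (\<lambda>x. w * cnj (x $ k)))"
    by (intro lin linearI) (auto simp: algebra_simps)
  have l4: "linear (upd (\<lambda>x. cnj (x $ k)))"
    by (intro lin linearI) auto
  have l5: "linear (upd (\<lambda>x. cmod c *\<^sub>R x $ k))"
    by (intro lin linearI) (auto simp: algebra_simps)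
  have inv: "volume_factor (upd (\<lambda>x. \<sigma> x - x $ k)) = 1"
     "volume_factor (upd (\<lambda>x. - (x $ k))) = 1"
     "volume_factor (upd (\<lambda>x. w * cnj (x $ k))) = 1"
     "volume_factor (upd (\<lambda>x. cnj (x $ k))) = 1"
    by (rule volume_factor_involution, fact, 
        use w in \<open>simp add: upd_upd upd_k \<sigma>_upd upd_id mult.assoc[symmetric]\<close>)+
  have sc: "volume_factor (upd (\<lambda>x. cmod c *\<^sub>R x $ k)) = (cmod c)\<^sup>2"
  proof -
    have "upd (\<lambda>x. cmod c *\<^sub>R x $ k) = (\<lambda>x :: complex ^ 'n. \<chi> i. if i = k then cmod c *\<^sub>R x $ i else x $ i)"
      by (auto simp: upd_def vec_eq_iff fun_eq_iff)
    then show ?thesis using volume_factor_scale_coord[of "cmod c" k] by simp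
  qed
  have "(*v) (row_matrix k r) = upd (\<lambda>x. cmod c *\<^sub>R x $ k) \<circ> (upd (\<lambda>x. w * cnj (x $ k)) \<circ>
     (upd (\<lambda>x. cnj (x $ k)) \<circ> (upd (\<lambda>x. \<sigma> x - x $ k) \<circ> upd (\<lambda>x. - (x $ k)))))"
  proof
    fix x
    have "(\<Sum>j\<in>UNIV. r $ j * x $ j) = c * x $ k + c * \<sigma> x"
      using assms by (subst sum.remove[of _ k]) (auto simp: \<sigma>_def c_def sum_distrib_left)
    also have "\<dots> = cmod c *\<^sub>R (w * (\<sigma> x + x $ k))"
      using w(2) by (simp add: scaleR_conv_of_real mult.assoc[symmetric] algebra_simps)
    finally show "row_matrix k r *v x = (upd (\<lambda>x. cmod c *\<^sub>R x $ k) \<circ> (upd (\<lambda>x. w * cnj (x $ k)) \<circ>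
     (upd (\<lambda>x. cnj (x $ k)) \<circ> (upd (\<lambda>x. \<sigma> x - x $ k) \<circ> upd (\<lambda>x. - (x $ k)))))) x"
      by (simp add: row_matrix_mult_vec upd_upd upd_k \<sigma>_upd) (simp add: upd_def cong: if_cong)
  qed
  then show ?thesis
    by (simp add: volume_factor_compose linear_compose l1 l2 l3 l4 l5 inv sc) (simp add: c_def)
qed

lemma matrix_mult_row: "(A ** B) $ i = A $ i v* B"
  by (simp add: matrix_matrix_mult_def vector_matrix_mult_def vec_eq_iff mult.commute)

text \<open>Gaussian elimination: the rows outside \<open>S\<close> already agree with those of the identity. If the pivot \<open>A\<^sub>k\<^sub>k\<close> is
  not zero, row \<open>k\<close> is split off as a factor on the right. Otherwise column \<open>k\<close> has a nonzero entry in some row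
  \<open>m\<close>, necessarily with \<open>m \<in> S\<close>, and adding that row to row \<open>k\<close> produces a pivot.\<close>

lemma invertible_row_matrix_induct:
  fixes A :: "complex ^ 'n ^ 'n"
  assumes "det A \<noteq> 0"
    and one: "P (mat 1)"
    and step: "\<And>k r. r $ k \<noteq> 0 \<Longrightarrow> P (row_matrix k r)"
    and mult: "\<And>A B. P A \<Longrightarrow> P B \<Longrightarrow> P (A ** B)"
  shows "P A"
proof -
  have "\<forall>A. det A \<noteq> 0 \<longrightarrow> (\<forall>i. i \<notin> S \<longrightarrow> A $ i = axis i 1) \<longrightarrow> P A" if "finite S" for S :: "'n set"
    using that
  proof (induction S)
    case empty
    have "A = mat 1" if "\<forall>i. A $ i = axis i 1" for A :: "complex ^ 'n ^ 'n"
      using that by (auto simp: vec_eq_iff mat_def axis_def)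
    then show ?case using one by auto
  next
    case (insert k S)
    have main: "P A" if A: "det A \<noteq> 0" "\<forall>i. i \<notin> insert k S \<longrightarrow> A $ i = axis i 1" and nz: "A $ k $ k \<noteq> 0" for A
    proof -
      define r where "r = A $ k"
      \<comment> \<open>Solving \<open>y = \<Sum>r\<^sub>j x\<^sub>j\<close> for \<open>x\<^sub>k\<close> gives the row of the inverse matrix.\<close>
      define r' where "r' = (\<chi> j. if j = k then 1 / r $ k else - r $ j / r $ k)"
      have r: "r $ k \<noteq> 0" "r' $ k \<noteq> 0" using nz by (auto simp: r_def r'_def)
      have inv: "row_matrix k r' ** row_matrix k r = mat 1"
      proof -
        have "row_matrix k r' *v (row_matrix k r *v x) = x" for x
        proof -
          have "(\<Sum>j\<in>UNIV. r' $ j * (row_matrix k r *v x) $ j) =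
              r' $ k * (\<Sum>j\<in>UNIV. r $ j * x $ j) + (\<Sum>j\<in>UNIV-{k}. r' $ j * x $ j)"
            by (subst sum.remove[of _ k]) (auto simp: row_matrix_mult_vec)
          also have "(\<Sum>j\<in>UNIV. r $ j * x $ j) = r $ k * x $ k + (\<Sum>j\<in>UNIV-{k}. r $ j * x $ j)"
            by (subst sum.remove[of _ k]) auto
          also have "(\<Sum>j\<in>UNIV-{k}. r' $ j * x $ j) = - r' $ k * (\<Sum>j\<in>UNIV-{k}. r $ j * x $ j)"
            unfolding sum_distrib_left by (intro sum.cong) (auto simp: r'_def)
          finally have "(\<Sum>j\<in>UNIV. r' $ j * (row_matrix k r *v x) $ j) = x $ k"
            using r by (simp add: r'_def field_simps)
          then show ?thesis
            by (subst row_matrix_mult_vec) (auto simp: vec_eq_iff row_matrix_mult_vec)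
        qed
        then show ?thesis
          by (simp add: matrix_eq matrix_vector_mul_assoc)
      qed
      define A' where "A' = A ** row_matrix k r'"
      have A_eq: "A = A' ** row_matrix k r"
        by (simp add: A'_def matrix_mul_assoc[symmetric] inv)
      have "row_matrix k r ** row_matrix k r' = mat 1"
        using inv matrix_left_right_inverse by blast
      moreover have "(row_matrix k r ** row_matrix k r') $ k = r v* row_matrix k r'"
        by (simp add: matrix_mult_row row_matrix_def)
      ultimately have rk: "r v* row_matrix k r' = axis k 1"
        by (simp add: mat_def axis_def vec_eq_iff) metis
      have "P A'"
      proof (rule insert.IH[rule_format])
        show "det A' \<noteq> 0"
          using A(1) r by (simp add: A'_def det_mul det_row_matrix)
        fix i assume i: "i \<notin> S"
        show "A' $ i = axis i 1"
        proof (cases "i = k")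
          case True
          then show ?thesis using rk by (simp add: A'_def matrix_mult_row r_def)
        next
          case False
          then show ?thesis
            using i A(2) by (simp add: A'_def matrix_mult_row axis_vector_matrix_mult) (simp add: row_matrix_def)
        qed
      qed
      then show "P A"
        unfolding A_eq using step r mult by blast
    qed
    show ?case
    proof (intro allI impI)
      fix A :: "complex ^ 'n ^ 'n"
      assume A: "det A \<noteq> 0" "\<forall>i. i \<notin> insert k S \<longrightarrow> A $ i = axis i 1"
      show "P A"
      proof (cases "A $ k $ k = 0")
        case False
        then show ?thesis using main A by blast
      next
        case True
        have "\<exists>m\<in>S. A $ m $ k \<noteq> 0"
        proof (rule ccontr)
          assume "\<not> ?thesis"
          then have "A $ m $ k = 0" for m
            using A(2) True insert.hyps by (cases "m \<in> insert k S") (auto simp: axis_def)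
          then have "column k A = 0"
            by (simp add: column_def vec_eq_iff)
          then show False using A(1) det_zero_column(1) by blast
        qed
        then obtain m where m: "m \<in> S" "A $ m $ k \<noteq> 0" by blast
        then have "m \<noteq> k" using insert.hyps by blast
        define B where "B = row_matrix k (axis k 1 + axis m 1) ** A"
        have B_row: "B $ i = (if i = k then A $ k + A $ m else A $ i)" for i
          by (simp add: B_def matrix_mult_row row_matrix_def axis_vector_matrix_mult vector_matrix_left_distrib)
        have "P B"
        proof (rule main)
          show "det B \<noteq> 0"
            using A(1) \<open>m \<noteq> k\<close> by (simp add: B_def det_mul det_row_matrix axis_def)
          show "\<forall>i. i \<notin> insert k S \<longrightarrow> B $ i = axis i 1"
            using A(2) by (simp add: B_row)
          show "B $ k $ k \<noteq> 0"
            using True m by (simp add: B_row)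
        qed
        moreover have "A = row_matrix k (axis k 1 - axis m 1) ** B"
        proof -
          have "row_matrix k (axis k 1 - axis m 1) *v (row_matrix k (axis k 1 + axis m 1) *v x) = x" for x :: "complex ^ 'n"
          proof -
            have s: "(\<Sum>j\<in>UNIV. (axis k 1 + axis m (e::complex) :: complex ^ 'n) $ j * y $ j) = y $ k + e * y $ m" for e y
            proof -
              have "(\<Sum>j\<in>UNIV. (axis k 1 + axis m (e::complex) :: complex ^ 'n) $ j * y $ j) =
                (\<Sum>j\<in>UNIV. (if j = k then y $ j else 0) + (if j = m then e * y $ j else 0))"
                by (intro sum.cong) (auto simp: axis_def algebra_simps)
              then show ?thesis by (simp add: sum.distrib)
            qed
            have neg: "axis k 1 - axis m 1 = axis k 1 + (axis m (-1) :: complex ^ 'n)"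
              by (auto simp: axis_def vec_eq_iff)
            show ?thesis
              unfolding neg row_matrix_mult_vec s using \<open>m \<noteq> k\<close> by (simp add: vec_eq_iff)
          qed
          then have "row_matrix k (axis k 1 - axis m 1) ** row_matrix k (axis k 1 + axis m 1) = (mat 1 :: complex ^ 'n ^ 'n)"
            by (simp add: matrix_eq matrix_vector_mul_assoc)
          then show ?thesis
            by (simp add: B_def matrix_mul_assoc)
        qed
        ultimately show "P A"
          using mult[OF step[of "axis k 1 - axis m 1" k], of B] \<open>m \<noteq> k\<close> by (simp add: axis_def)
      qed
    qed
  qed
  from this[of UNIV] show ?thesis using assms(1) by simp
qed

text \<open>Both sides are multiplicative, so it suffices to compare them on the generators; a singular matrix has
  factor \<open>0\<close> because it is not injective in real coordinates either.\<close>

theorem volume_factor_matrix: "volume_factor ((*v) A) = (cmod (det A))\<^sup>2"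
proof (cases "det A = 0")
  case True
  then have "\<not> invertible A" by (simp add: invertible_det_nz)
  then obtain x where x: "x \<noteq> 0" "A *v x = 0"
    by (metis invertible_left_inverse matrix_left_invertible_ker)
  define L where "L = to_real_coords \<circ> (*v) A \<circ> of_real_coords"
  have lin: "linear L"
    unfolding L_def by (intro linear_compose linear_to_real_coords linear_of_real_coords linear_matrix_vec_complex)
  have "L (to_real_coords x) = 0" "to_real_coords x \<noteq> 0"
  proof -
    show "L (to_real_coords x) = 0"
      using x(2) by (simp add: L_def linear_0 linear_to_real_coords)
    show "to_real_coords x \<noteq> 0"
    proof
      assume "to_real_coords x = 0"
      then have "x = of_real_coords 0"
        using of_to_real_coords[of x] by simp
      then show False
        using x(1) by (simp add: linear_0 linear_of_real_coords)
    qed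
  qed
  then have "\<not> inj L"
    using lin by (metis linear_injective_0)
  then have "det (matrix L) = 0"
    using det_nz_iff_inj lin by blast
  then show ?thesis
    using True by (simp add: volume_factor_def L_def)
next
  case False
  then show ?thesis
  proof (rule invertible_row_matrix_induct)
    show "volume_factor ((*v) (mat 1)) = (cmod (det (mat 1)))\<^sup>2"
      using volume_factor_id by (simp add: matrix_vector_mul_lid[abs_def])
    show "volume_factor ((*v) (row_matrix k r)) = (cmod (det (row_matrix k r)))\<^sup>2" if "r $ k \<noteq> 0" for k r
      using volume_factor_row_matrix[OF that] by (simp add: det_row_matrix)
    show "volume_factor ((*v) (A ** B)) = (cmod (det (A ** B)))\<^sup>2"
      if "volume_factor ((*v) A) = (cmod (det A))\<^sup>2" "volume_factor ((*v) B) = (cmod (det B))\<^sup>2" for A B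
      using that volume_factor_compose[OF linear_matrix_vec_complex[of A] linear_matrix_vec_complex[of B]]
      by (simp add: matrix_vector_mult_matrix_matrix_mult_compose det_mul norm_mult power_mult_distrib)
  qed
qed

lemma complex_jacobian_inverse:
  assumes "open S" "holomorphic_map_on g S" "holomorphic_map_on h E" "g ` S \<subseteq> E"
    and "\<And>z. z \<in> S \<Longrightarrow> h (g z) = z" "z \<in> S"
  shows "complex_jacobian h (g z) ** complex_jacobian g z = mat 1"
proof -
  have "g z \<in> E" using assms by auto
  have "((\<lambda>z. h (g z)) has_derivative (\<lambda>v. complex_jacobian h (g z) *v (complex_jacobian g z *v v))) (at z)"
    by (rule has_derivative_compose[OF holomorphic_map_on_has_derivative[OF assms(2,6)]
        holomorphic_map_on_has_derivative[OF assms(3) \<open>g z \<in> E\<close>]])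
  then have "((\<lambda>z. z) has_derivative (\<lambda>v. complex_jacobian h (g z) *v (complex_jacobian g z *v v))) (at z)"
    by (rule has_derivative_transform_within_open[OF _ assms(1,6)]) (simp add: assms(5))
  then have "(\<lambda>v. complex_jacobian h (g z) *v (complex_jacobian g z *v v)) = (\<lambda>v. v)"
    using has_derivative_unique has_derivative_ident by blast
  then show ?thesis
    by (simp add: matrix_eq matrix_vector_mul_assoc fun_eq_iff)
qed

text \<open>The real change of variables theorem in real coordinates, with the real Jacobian determinant
  identified as the squared modulus of the complex one.\<close>

theorem biholomorphic_change_of_variables:
  fixes g h :: "complex ^ 'n \<Rightarrow> complex ^ 'n" and F :: "complex ^ 'n \<Rightarrow> real"
  assumes S: "open S" and E: "open E"
    and g: "holomorphic_map_on g S" "g ` S \<subseteq> E" and h: "holomorphic_map_on h E" "h ` E \<subseteq> S"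
    and hg: "\<And>z. z \<in> S \<Longrightarrow> h (g z) = z" and gh: "\<And>z. z \<in> E \<Longrightarrow> g (h z) = z"
    and cont: "continuous_on S (\<lambda>z. (cmod (det (complex_jacobian g z)))\<^sup>2)"
    and F: "continuous_on E F" "set_integrable lborel E F"
  shows "set_integrable lborel S (\<lambda>z. (cmod (det (complex_jacobian g z)))\<^sup>2 * F (g z))"
    and "(LINT z:S|lborel. (cmod (det (complex_jacobian g z)))\<^sup>2 * F (g z)) = (LINT z:E|lborel. F z)"
proof -
  define lift where "lift L = to_real_coords \<circ> L \<circ> of_real_coords"
    for L :: "complex ^ 'n \<Rightarrow> complex ^ 'n"
  define J where "J z = (cmod (det (complex_jacobian g z)))\<^sup>2" for z
  have J: "\<bar>det (matrix (lift ((*v) (complex_jacobian g z))))\<bar> = J z" for z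
    using volume_factor_matrix[of "complex_jacobian g z"] by (simp add: volume_factor_def lift_def J_def)
  have der: "(lift f has_derivative lift f') (at x within X)"
    if "(f has_derivative f') (at (of_real_coords x))" for f f' x X
  proof -
    have "((\<lambda>x. f (of_real_coords x)) has_derivative (\<lambda>x. f' (of_real_coords x))) (at x within X)"
      by (rule has_derivative_compose[OF linear_imp_has_derivative[OF linear_of_real_coords]]) (rule that)
    then show ?thesis
      using has_derivative_compose[OF _ linear_imp_has_derivative[OF linear_to_real_coords]]
      by (simp add: lift_def o_def)
  qed
  have key: "(\<lambda>x. \<bar>det (matrix (lift ((*v) (complex_jacobian g (of_real_coords x)))))\<bar> * (F \<circ> of_real_coords) (lift g x))
        absolutely_integrable_on (to_real_coords ` S) \<and>
      integral (to_real_coords ` S) (\<lambda>x. \<bar>det (matrix (lift ((*v) (complex_jacobian g (of_real_coords x)))))\<bar> *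
        (F \<circ> of_real_coords) (lift g x)) = b \<longleftrightarrow>
      (F \<circ> of_real_coords) absolutely_integrable_on (to_real_coords ` E) \<and>
      integral (to_real_coords ` E) (F \<circ> of_real_coords) = b" for b
  proof (rule cov_invertible_real[where h="lift h" and h'="\<lambda>y. lift ((*v) (complex_jacobian h (of_real_coords y)))"])
    fix x assume "x \<in> to_real_coords ` S"
    then have x: "of_real_coords x \<in> S" by auto
    show "(lift g has_derivative lift ((*v) (complex_jacobian g (of_real_coords x)))) (at x within to_real_coords ` S)"
      by (rule der, rule holomorphic_map_on_has_derivative[OF g(1) x])
    show "lift g x \<in> to_real_coords ` E \<and> lift h (lift g x) = x"
      using x g(2) by (auto simp: lift_def hg)
  next
    fix y assume "y \<in> to_real_coords ` E"
    then have y: "of_real_coords y \<in> E" by auto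
    then have hy: "h (of_real_coords y) \<in> S" using h(2) by auto
    show "(lift h has_derivative lift ((*v) (complex_jacobian h (of_real_coords y)))) (at y within to_real_coords ` E)"
      by (rule der, rule holomorphic_map_on_has_derivative[OF h(1) y])
    show "lift h y \<in> to_real_coords ` S \<and> lift g (lift h y) = y"
      using y h(2) by (auto simp: lift_def gh)
    have "complex_jacobian h (of_real_coords y) ** complex_jacobian g (h (of_real_coords y)) = mat 1"
      using complex_jacobian_inverse[OF S g(1) h(1) g(2) hg hy] gh[OF y] by simp
    then show "lift ((*v) (complex_jacobian h (of_real_coords y))) \<circ>
        lift ((*v) (complex_jacobian g (of_real_coords (lift h y)))) = id"
      by (auto simp: lift_def fun_eq_iff matrix_vector_mul_assoc)
  qed
  define Fg where "Fg z = J z * F (g z)" for z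
  have eq: "(\<lambda>x. \<bar>det (matrix (lift ((*v) (complex_jacobian g (of_real_coords x)))))\<bar> * (F \<circ> of_real_coords) (lift g x))
      = Fg \<circ> of_real_coords"
    unfolding J by (auto simp: Fg_def lift_def)
  have contFg: "continuous_on S Fg"
    unfolding Fg_def J_def
    by (intro continuous_intros cont continuous_on_compose2[OF F(1) holomorphic_map_on_continuous[OF g(1)] g(2)])
  have "(Fg \<circ> of_real_coords) absolutely_integrable_on (to_real_coords ` S) \<and>
    integral (to_real_coords ` S) (Fg \<circ> of_real_coords) = (LINT z:E|lborel. F z)"
    using key[of "LINT z:E|lborel. F z", unfolded eq] real_coords_integral[OF E F(1)] F(2) by simp
  then have "set_integrable lborel S Fg" "(LINT z:S|lborel. Fg z) = (LINT z:E|lborel. F z)"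
    using real_coords_integral[OF S contFg] by auto
  then show "set_integrable lborel S (\<lambda>z. (cmod (det (complex_jacobian g z)))\<^sup>2 * F (g z))"
    and "(LINT z:S|lborel. (cmod (det (complex_jacobian g z)))\<^sup>2 * F (g z)) = (LINT z:E|lborel. F z)"
    by (simp_all add: Fg_def[abs_def] J_def)
qed

section \<open>The mean value inequality\<close>

lemma circle_mean:
  assumes "continuous_on (cball 0 1) h" "h holomorphic_on ball 0 1"
  shows "((\<lambda>t. h (exp (2 * of_real pi * \<i> * of_real t))) has_integral h 0) {0..1}"
proof -
  define c where "c = 2 * of_real pi * \<i>"
  have "((\<lambda>u. h u / (u - 0)) has_contour_integral (2 * of_real pi * \<i> * h 0)) (circlepath 0 1)"
    by (rule Cauchy_integral_circlepath) (use assms in auto)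
  then have "((\<lambda>t. (2 * of_real pi * \<i>) * h (exp (2 * of_real pi * \<i> * of_real t)))
      has_integral (2 * of_real pi * \<i>) * h 0) {0..1}"
    unfolding has_contour_integral_def
  proof (rule has_integral_eq[rotated])
    fix t :: real assume "t \<in> {0..1}"
    then show "h (circlepath 0 1 t) / (circlepath 0 1 t - 0) * vector_derivative (circlepath 0 1) (at t within {0..1}) =
        (2 * of_real pi * \<i>) * h (exp (2 * of_real pi * \<i> * of_real t))"
      by (simp add: vector_derivative_circlepath01) (simp add: circlepath)
  qed
  then have *: "((\<lambda>t. c * h (exp (2 * of_real pi * \<i> * of_real t))) has_integral c * h 0) {0..1}"
    by (simp only: c_def)
  have "c \<noteq> 0" by (simp add: c_def)
  then show ?thesis
    using has_integral_mult_right[OF *, of "inverse c"] by (simp add: mult.assoc[symmetric])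
qed

text \<open>The parameter is normalised so that \<open>t \<in> {0..1}\<close> describes a full turn; averages over \<open>t\<close> need no factor.\<close>

definition rotate_about :: "complex ^ 'n \<Rightarrow> real \<Rightarrow> complex ^ 'n \<Rightarrow> complex ^ 'n" where
  "rotate_about w t z = w + exp (2 * of_real pi * \<i> * of_real t) *s (z - w)"

lemma norm_vector_smult_complex: "norm (c *s (x :: complex ^ 'n)) = cmod c * norm x"
  by (simp add: norm_vec_def L2_set_def norm_mult power_mult_distrib sum_distrib_left[symmetric] real_sqrt_mult)

lemma dist_rotate_about: "dist w (rotate_about w t z) = dist w z"
proof -
  have "cmod (exp (2 * of_real pi * \<i> * of_real t)) = 1"
    by (simp add: norm_exp_eq_Re)
  then have "norm (rotate_about w t z - w) = norm (z - w)"
    by (simp add: rotate_about_def norm_vector_smult_complex del: norm_exp_eq_Re vector_ssub_ldistrib)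
  then show ?thesis
    by (simp add: dist_norm norm_minus_commute)
qed

lemma rotate_about_inverse: "rotate_about w (- t) (rotate_about w t z) = z"
proof -
  have "exp (2 * of_real pi * \<i> * of_real (- t)) * exp (2 * of_real pi * \<i> * of_real t) = 1"
    by (simp add: exp_add[symmetric])
  then show ?thesis
    by (simp add: rotate_about_def vec_eq_iff mult.assoc[symmetric])
qed

lemma rotate_about_holomorphic:
  fixes w :: "complex ^ 'n"
  shows "holomorphic_map_on (rotate_about w t) S"
    and "cmod (det (complex_jacobian (rotate_about w t) z)) = 1"
proof -
  define c where "c = exp (2 * of_real pi * \<i> * of_real t)"
  have *: "((\<lambda>z. rotate_about w t z $ j) has_derivative (\<lambda>h. \<Sum>k\<in>UNIV. (if k = j then c else 0) * h $ k)) (at z)" for j z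
  proof -
    have "(\<lambda>h. \<Sum>k\<in>UNIV. (if k = j then c else 0) * h $ k) = (\<lambda>h :: complex ^ 'n. c * h $ j)"
      by (simp add: if_distrib[of "\<lambda>x. x * _"] cong: if_cong)
    moreover have "((\<lambda>z. w $ j + c * (z $ j - w $ j)) has_derivative (\<lambda>h. c * h $ j)) (at z)"
      by (auto intro!: derivative_eq_intros bounded_linear_imp_has_derivative bounded_linear_vec_nth)
    ultimately show ?thesis
      by (simp add: rotate_about_def c_def right_diff_distrib)
  qed
  show "holomorphic_map_on (rotate_about w t) S"
    unfolding holomorphic_map_on_def by (intro allI holomorphic_fun_onI, rule *)
  have J: "complex_jacobian (rotate_about w t) z $ j $ k = (if k = j then c else 0)" for j k
    using complex_partial_eqI_fun[OF *[of j z], of k] by (simp add: complex_jacobian_def)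
  have "det (complex_jacobian (rotate_about w t) z) = (\<Prod>i\<in>UNIV. complex_jacobian (rotate_about w t) z $ i $ i)"
    by (rule det_diagonal) (simp add: J)
  then show "cmod (det (complex_jacobian (rotate_about w t) z)) = 1"
    by (simp add: J norm_power c_def)
qed

text \<open>The mean value property of the holomorphic function \<open>f\<^sup>2\<close> on the complex line through \<open>w\<close> and \<open>z\<close>. It is
  stated with a nonnegative integral to prepare the use of Tonelli's theorem.\<close>

lemma circle_mean_square_le:
  fixes f :: "complex ^ 'n \<Rightarrow> complex"
  assumes "open D" "holomorphic_fun_on f D" "cball w r \<subseteq> D" "z \<in> ball w r"
  shows "ennreal ((cmod (f w))\<^sup>2) \<le> (\<integral>\<^sup>+t. indicator {0..1} t * ennreal ((cmod (f (rotate_about w t z)))\<^sup>2) \<partial>lborel)"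
proof -
  define h where "h t = (f (w + t *s (z - w)))\<^sup>2" for t
  have in_D: "w + t *s (z - w) \<in> D" if "cmod t \<le> 1" for t
  proof -
    have "cmod t * norm (z - w) \<le> norm (z - w)"
      using that by (simp add: mult_left_le_one_le)
    then have "dist w (w + t *s (z - w)) \<le> dist w z"
      by (simp add: dist_norm norm_vector_smult_complex norm_minus_commute del: vector_ssub_ldistrib)
    then show ?thesis using assms(3,4) by (auto intro!: subsetD[OF assms(3)])
  qed
  have cont: "continuous_on (cball 0 1) h"
  proof -
    have "continuous_on (cball 0 1) (\<lambda>t. f (w + t *s (z - w)))"
      by (intro holomorphic_on_imp_continuous_on holomorphic_slice[OF assms(2)] in_D) simp
    then show ?thesis unfolding h_def by (intro continuous_intros)
  qed
  have hol: "h holomorphic_on ball 0 1"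
    unfolding h_def by (intro holomorphic_intros holomorphic_slice[OF assms(2)] in_D) simp
  define \<phi> where "\<phi> t = (cmod (f (rotate_about w t z)))\<^sup>2" for t
  define e where "e t = exp (2 * of_real pi * \<i> * of_real t)" for t :: real
  have \<phi>: "\<phi> t = cmod (h (e t))" for t
    by (simp add: \<phi>_def h_def e_def rotate_about_def norm_power)
  have cmod_e: "cmod (e t) = 1" for t
    by (simp add: e_def norm_exp_eq_Re)
  have cont_he: "continuous_on {0..1} (\<lambda>t. h (e t))"
    by (rule continuous_on_compose2[OF cont]) (auto simp: e_def intro!: continuous_intros)
  then have cont_\<phi>: "continuous_on {0..1} \<phi>"
    unfolding \<phi>[abs_def] by (intro continuous_intros)
  have mean: "((\<lambda>t. h (e t)) has_integral h 0) {0..1}"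
    using circle_mean[OF cont hol] by (simp add: e_def)
  have "cmod (integral {0..1} (\<lambda>t. h (e t))) \<le> integral {0..1} \<phi>"
    by (rule integral_norm_bound_integral)
      (use mean cont_\<phi> in \<open>auto simp: \<phi> intro: integrable_continuous_real\<close>)
  then have "(cmod (f w))\<^sup>2 \<le> integral {0..1} \<phi>"
    using integral_unique[OF mean] by (simp add: h_def norm_power)
  also have "integral {0..1} \<phi> = (LINT t:{0..1}|lborel. \<phi> t)"
    by (rule set_borel_integral_eq_integral(2)[symmetric, OF borel_integrable_atLeastAtMost'[OF cont_\<phi>]])
  finally have "ennreal ((cmod (f w))\<^sup>2) \<le> ennreal (LINT t:{0..1}|lborel. \<phi> t)"
    by (rule ennreal_leI)
  also have "\<dots> = (\<integral>\<^sup>+t. ennreal (indicator {0..1} t *\<^sub>R \<phi> t) \<partial>lborel)"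
    unfolding set_lebesgue_integral_def
    by (rule nn_integral_eq_integral[symmetric])
      (use borel_integrable_atLeastAtMost'[OF cont_\<phi>] in \<open>auto simp: set_integrable_def \<phi>\<close>)
  also have "\<dots> = (\<integral>\<^sup>+t. indicator {0..1} t * ennreal (\<phi> t) \<partial>lborel)"
    by (intro nn_integral_cong) (auto split: split_indicator)
  finally show ?thesis by (simp add: \<phi>_def)
qed

text \<open>Rotations are unitary, hence have Jacobian determinant of modulus 1.\<close>

lemma rotate_about_integral:
  fixes F :: "complex ^ 'n \<Rightarrow> real"
  assumes "continuous_on (ball w r) F" "set_integrable lborel (ball w r) F"
  shows "set_integrable lborel (ball w r) (\<lambda>z. F (rotate_about w t z))"
    and "(LINT z:ball w r|lborel. F (rotate_about w t z)) = (LINT z:ball w r|lborel. F z)"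
proof -
  have inv: "rotate_about w t (rotate_about w (- t) z) = z" for z
    using rotate_about_inverse[of w "- t" z] by simp
  have sub: "rotate_about w t ` ball w r \<subseteq> ball w r" for t
    by (auto simp: dist_rotate_about)
  note cv = biholomorphic_change_of_variables[where g="rotate_about w t" and h="rotate_about w (- t)"
      and S="ball w r" and E="ball w r" and F=F, OF open_ball open_ball rotate_about_holomorphic(1) sub
      rotate_about_holomorphic(1) sub]
  show "set_integrable lborel (ball w r) (\<lambda>z. F (rotate_about w t z))"
    and "(LINT z:ball w r|lborel. F (rotate_about w t z)) = (LINT z:ball w r|lborel. F z)"
    using cv(1) cv(2) assms by (simp_all add: rotate_about_inverse inv rotate_about_holomorphic(2))
qed

text \<open>The circle inequality holds for every \<open>z\<close> in the ball. Integrating it over \<open>z\<close> and exchanging the integrals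
  leaves, for each angle, the integral of \<open>|f|\<^sup>2\<close> over the rotated ball, which is the ball itself.\<close>

theorem mean_value_inequality:
  fixes f :: "complex ^ 'n \<Rightarrow> complex"
  assumes "open D" "holomorphic_fun_on f D" "cball w r \<subseteq> D" "0 < r"
    and int: "set_integrable lborel D (\<lambda>z. (cmod (f z))\<^sup>2)"
  shows "(cmod (f w))\<^sup>2 * measure lborel (ball w r) \<le> (LINT z:D|lborel. (cmod (f z))\<^sup>2)"
proof -
  define F where "F z = (cmod (f z))\<^sup>2" for z
  have sub: "ball w r \<subseteq> D" using assms(3) by auto
  have contF: "continuous_on D F"
    unfolding F_def by (intro continuous_intros holomorphic_fun_on_continuous assms)
  have intB: "set_integrable lborel (ball w r) F"
    using set_integrable_subset[OF int _ sub] by (simp add: F_def[abs_def])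
  note rot = rotate_about_integral[OF continuous_on_subset[OF contF sub] intB]
  define I where "I = (LINT z:ball w r|lborel. F z)"
  define G where "G t z = indicator {0..1} t * (indicator (ball w r) z * ennreal (F (rotate_about w t z)))"
    for t :: real and z
  have meas: "case_prod G \<in> borel_measurable (lborel \<Otimes>\<^sub>M lborel)"
  proof -
    have "continuous_on (UNIV \<times> ball w r) (\<lambda>p. F (rotate_about w (fst p) (snd p)))"
    proof (rule continuous_on_compose2[OF contF])
      show "continuous_on (UNIV \<times> ball w r) (\<lambda>p. rotate_about w (fst p) (snd p))"
        unfolding rotate_about_def vector_scalar_mult_def by (intro continuous_intros)
      show "(\<lambda>p. rotate_about w (fst p) (snd p)) ` (UNIV \<times> ball w r) \<subseteq> D"
        using sub by (auto intro!: subsetD[OF sub] simp: dist_rotate_about)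
    qed
    then have "(\<lambda>p. indicator (UNIV \<times> ball w r) p *\<^sub>R F (rotate_about w (fst p) (snd p))) \<in> borel_measurable borel"
      by (intro borel_measurable_continuous_on_indicator borel_open open_Times) auto
    then have 1: "(\<lambda>p. ennreal (indicator (UNIV \<times> ball w r) p *\<^sub>R F (rotate_about w (fst p) (snd p)))) \<in> borel_measurable borel"
      by simp
    have 2: "(\<lambda>p. indicator ({0..1} \<times> UNIV) p :: ennreal) \<in> borel_measurable (borel :: (real \<times> (complex ^ 'n)) measure)"
      by (intro borel_measurable_indicator borel_closed closed_Times) auto
    have "case_prod G = (\<lambda>p. indicator ({0..1} \<times> UNIV) p *
        ennreal (indicator (UNIV \<times> ball w r) p *\<^sub>R F (rotate_about w (fst p) (snd p))))"
      by (auto simp: G_def fun_eq_iff split: split_indicator)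
    then have "case_prod G \<in> borel_measurable (borel :: (real \<times> (complex ^ 'n)) measure)"
      using 1 2 by simp
    then show ?thesis
      by (simp add: lborel_prod)
  qed
  have F0: "F z \<ge> 0" for z by (simp add: F_def)
  have inner: "(\<integral>\<^sup>+z. G t z \<partial>lborel) = indicator {0..1} t * ennreal I" for t
  proof -
    have "(\<integral>\<^sup>+z. indicator (ball w r) z * ennreal (F (rotate_about w t z)) \<partial>lborel) =
        (\<integral>\<^sup>+z. ennreal (indicator (ball w r) z *\<^sub>R F (rotate_about w t z)) \<partial>lborel)"
      by (intro nn_integral_cong) (auto split: split_indicator)
    also have "\<dots> = ennreal (LINT z:ball w r|lborel. F (rotate_about w t z))"
      unfolding set_lebesgue_integral_def using rot(1)[of t] F0
      by (intro nn_integral_eq_integral) (auto simp: set_integrable_def)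
    finally have *: "(\<integral>\<^sup>+z. indicator (ball w r) z * ennreal (F (rotate_about w t z)) \<partial>lborel) = ennreal I"
      using rot(2)[of t] by (simp add: I_def)
    show ?thesis
      by (cases "t \<in> {0..1}") (simp_all add: G_def *)
  qed
  have "ennreal ((cmod (f w))\<^sup>2) * emeasure lborel (ball w r) =
      (\<integral>\<^sup>+z. ennreal ((cmod (f w))\<^sup>2) * indicator (ball w r) z \<partial>lborel)"
    by (rule nn_integral_cmult_indicator[symmetric]) simp
  also have "\<dots> \<le> (\<integral>\<^sup>+z. (\<integral>\<^sup>+t. G t z \<partial>lborel) \<partial>lborel)"
  proof (rule nn_integral_mono)
    fix z
    show "ennreal ((cmod (f w))\<^sup>2) * indicator (ball w r) z \<le> (\<integral>\<^sup>+t. G t z \<partial>lborel)"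
    proof (cases "z \<in> ball w r")
      case True
      then have "(\<lambda>t. G t z) = (\<lambda>t. indicator {0..1} t * ennreal ((cmod (f (rotate_about w t z)))\<^sup>2))"
        by (auto simp: G_def F_def)
      then show ?thesis
        using circle_mean_square_le[OF assms(1-3) True] True by simp
    qed simp
  qed
  also have "\<dots> = (\<integral>\<^sup>+t. (\<integral>\<^sup>+z. G t z \<partial>lborel) \<partial>lborel)"
  proof -
    have "pair_sigma_finite (lborel :: real measure) (lborel :: (complex ^ 'n) measure)"
      by (intro pair_sigma_finite.intro sigma_finite_lborel)
    then show ?thesis by (rule pair_sigma_finite.Fubini'[OF _ meas])
  qed
  also have "\<dots> = ennreal I"
    unfolding inner by (subst mult.commute, subst nn_integral_cmult_indicator) simp_all
  also have "emeasure lborel (ball w r) = ennreal (measure lborel (ball w r))"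
    by (rule emeasure_eq_ennreal_measure) (use emeasure_bounded_finite[of "ball w r"] in auto)
  finally have "ennreal ((cmod (f w))\<^sup>2 * measure lborel (ball w r)) \<le> ennreal I"
    by (simp add: ennreal_mult)
  moreover have "I \<ge> 0"
    unfolding I_def set_lebesgue_integral_def using F0 by (intro Bochner_Integration.integral_nonneg) simp
  ultimately have "(cmod (f w))\<^sup>2 * measure lborel (ball w r) \<le> I"
    by simp
  also have "I \<le> (LINT z:D|lborel. F z)"
    unfolding I_def set_lebesgue_integral_def
    using int intB sub F0 by (intro integral_mono) (auto simp: set_integrable_def F_def[abs_def] split: split_indicator)
  finally show ?thesis by (simp add: F_def)
qed

section \<open>The Bergman space as a Hilbert space\<close>

text \<open>Functions are total, so these integrals only see the values on \<open>D\<close>.\<close>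

definition bergman_inner :: "(complex ^ 'n) set \<Rightarrow> (complex ^ 'n \<Rightarrow> complex) \<Rightarrow> (complex ^ 'n \<Rightarrow> complex) \<Rightarrow> complex" where
  "bergman_inner D f g = (LINT z:D|lborel. f z * cnj (g z))"

definition bergman_sq :: "(complex ^ 'n) set \<Rightarrow> (complex ^ 'n \<Rightarrow> complex) \<Rightarrow> real" where
  "bergman_sq D f = (LINT z:D|lborel. (cmod (f z))\<^sup>2)"

lemma bergman_sq_nonneg: "bergman_sq D f \<ge> 0"
  unfolding bergman_sq_def set_lebesgue_integral_def by (intro Bochner_Integration.integral_nonneg) simp

lemma bergman_inner_self: "bergman_inner D f f = of_real (bergman_sq D f)"
  unfolding bergman_inner_def bergman_sq_def set_integral_complex_of_real[symmetric]
  by (simp add: complex_norm_square del: of_real_power)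

lemma bergman_inner_cnj: "bergman_inner D g f = cnj (bergman_inner D f g)"
  unfolding bergman_inner_def set_lebesgue_integral_def
  by (subst Bochner_Integration.integral_cnj[symmetric])
    (intro Bochner_Integration.integral_cong; simp add: mult.commute)

lemma bergman_inner_cmult: "bergman_inner D (\<lambda>z. c * f z) g = c * bergman_inner D f g"
  by (simp add: bergman_inner_def mult.assoc)

lemma bergman_sq_cmult: "bergman_sq D (\<lambda>z. c * f z) = (cmod c)\<^sup>2 * bergman_sq D f"
  by (simp add: bergman_sq_def norm_mult power_mult_distrib)

lemma set_borel_measurable_continuous_on_open:
  fixes F :: "'a::euclidean_space \<Rightarrow> 'b::real_normed_vector"
  assumes "open D" "continuous_on D F"
  shows "set_borel_measurable lborel D F"
  unfolding set_borel_measurable_def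
  using borel_measurable_continuous_on_indicator[of D F] assms by simp

lemma bergman_space_continuous: "f \<in> bergman_space D \<Longrightarrow> continuous_on D f"
  by (simp add: bergman_space_def holomorphic_fun_on_continuous)

lemma bergman_space_integrable_mult:
  assumes "open D" "f \<in> bergman_space D" "g \<in> bergman_space D"
  shows "set_integrable lborel D (\<lambda>z. f z * cnj (g z))"
proof (rule set_integrable_bound)
  show "set_integrable lborel D (\<lambda>z. (cmod (f z))\<^sup>2 + (cmod (g z))\<^sup>2)"
    using assms by (intro set_integral_add) (auto simp: bergman_space_def)
  show "set_borel_measurable lborel D (\<lambda>z. f z * cnj (g z))"
    using assms by (intro set_borel_measurable_continuous_on_open continuous_intros bergman_space_continuous)
  have "cmod (f z) * cmod (g z) \<le> (cmod (f z))\<^sup>2 + (cmod (g z))\<^sup>2" for z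
    using sum_squares_bound[of "cmod (f z)" "cmod (g z)"] mult_nonneg_nonneg[of "cmod (f z)" "cmod (g z)"]
    by (simp add: mult.assoc del: mult_nonneg_nonneg)
  then show "AE z in lborel. z \<in> D \<longrightarrow> norm (f z * cnj (g z)) \<le> norm ((cmod (f z))\<^sup>2 + (cmod (g z))\<^sup>2)"
    by (auto simp: norm_mult)
qed

lemma bergman_space_cmult:
  assumes "f \<in> bergman_space D"
  shows "(\<lambda>z. c * f z) \<in> bergman_space D"
proof -
  have "set_integrable lborel D (\<lambda>z. (cmod c)\<^sup>2 * (cmod (f z))\<^sup>2)"
    using assms by (intro set_integrable_mult_right) (auto simp: bergman_space_def)
  then show ?thesis
    using assms holomorphic_fun_on_cmult by (auto simp: bergman_space_def norm_mult power_mult_distrib)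
qed

lemma bergman_space_add:
  assumes "open D" "f \<in> bergman_space D" "g \<in> bergman_space D"
  shows "(\<lambda>z. f z + g z) \<in> bergman_space D"
proof -
  have "set_integrable lborel D (\<lambda>z. (cmod (f z + g z))\<^sup>2)"
  proof (rule set_integrable_bound)
    show "set_integrable lborel D (\<lambda>z. 2 * (cmod (f z))\<^sup>2 + 2 * (cmod (g z))\<^sup>2)"
      using assms by (intro set_integral_add set_integrable_mult_right) (auto simp: bergman_space_def)
    show "set_borel_measurable lborel D (\<lambda>z. (cmod (f z + g z))\<^sup>2)"
      using assms by (intro set_borel_measurable_continuous_on_open continuous_intros bergman_space_continuous)
    have "(cmod (f z + g z))\<^sup>2 \<le> 2 * (cmod (f z))\<^sup>2 + 2 * (cmod (g z))\<^sup>2" for z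
    proof -
      have "(cmod (f z + g z))\<^sup>2 \<le> (cmod (f z) + cmod (g z))\<^sup>2"
        by (intro power_mono norm_triangle_ineq norm_ge_zero)
      also have "\<dots> \<le> 2 * (cmod (f z))\<^sup>2 + 2 * (cmod (g z))\<^sup>2"
        using sum_squares_bound[of "cmod (f z)" "cmod (g z)"] by (simp add: power2_sum)
      finally show ?thesis .
    qed
    then show "AE z in lborel. z \<in> D \<longrightarrow> norm ((cmod (f z + g z))\<^sup>2) \<le> norm (2 * (cmod (f z))\<^sup>2 + 2 * (cmod (g z))\<^sup>2)"
      by auto
  qed
  then show ?thesis
    using assms holomorphic_fun_on_add by (auto simp: bergman_space_def)
qed

lemma bergman_inner_add:
  assumes "open D" "f \<in> bergman_space D" "g \<in> bergman_space D" "h \<in> bergman_space D"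
  shows "bergman_inner D (\<lambda>z. f z + g z) h = bergman_inner D f h + bergman_inner D g h"
  unfolding bergman_inner_def distrib_right
  by (intro set_integral_add bergman_space_integrable_mult assms)

lemma bergman_space_diff:
  assumes "open D" "f \<in> bergman_space D" "g \<in> bergman_space D"
  shows "(\<lambda>z. f z - g z) \<in> bergman_space D"
  using bergman_space_add[OF assms(1,2) bergman_space_cmult[OF assms(3), of "-1"]] by simp

lemma bergman_inner_diff:
  assumes "open D" "f \<in> bergman_space D" "g \<in> bergman_space D" "h \<in> bergman_space D"
  shows "bergman_inner D (\<lambda>z. f z - g z) h = bergman_inner D f h - bergman_inner D g h"
  using bergman_inner_add[OF assms(1,2) bergman_space_cmult[OF assms(3), of "-1"] assms(4)]
    bergman_inner_cmult[of D "-1" g h] by simp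

lemma bergman_inner_add_cmult_right:
  assumes "open D" "f \<in> bergman_space D" "g \<in> bergman_space D" "h \<in> bergman_space D"
  shows "bergman_inner D h (\<lambda>z. f z + c * g z) = bergman_inner D h f + cnj c * bergman_inner D h g"
  using bergman_inner_add[OF assms(1,2) bergman_space_cmult[OF assms(3)] assms(4), of c]
  by (subst (1 2 3) bergman_inner_cnj) (simp add: bergman_inner_cmult)

lemma bergman_sq_add_cmult:
  assumes "open D" "f \<in> bergman_space D" "g \<in> bergman_space D"
  shows "bergman_sq D (\<lambda>z. f z + c * g z) =
    bergman_sq D f + 2 * Re (cnj c * bergman_inner D f g) + (cmod c)\<^sup>2 * bergman_sq D g"
proof -
  have cg: "(\<lambda>z. c * g z) \<in> bergman_space D" by (rule bergman_space_cmult[OF assms(3)])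
  have fcg: "(\<lambda>z. f z + c * g z) \<in> bergman_space D" by (rule bergman_space_add[OF assms(1,2) cg])
  have "bergman_inner D (\<lambda>z. f z + c * g z) (\<lambda>z. f z + c * g z) =
     bergman_inner D f f + cnj c * bergman_inner D f g + c * cnj (bergman_inner D f g) + c * cnj c * bergman_inner D g g"
    unfolding bergman_inner_add[OF assms(1,2) cg fcg] bergman_inner_cmult
      bergman_inner_add_cmult_right[OF assms assms(2)] bergman_inner_add_cmult_right[OF assms assms(3)]
    by (subst bergman_inner_cnj[of D g f]) (simp add: algebra_simps)
  then have "Re (bergman_inner D (\<lambda>z. f z + c * g z) (\<lambda>z. f z + c * g z)) =
     Re (bergman_inner D f f + cnj c * bergman_inner D f g + c * cnj (bergman_inner D f g) + c * cnj c * bergman_inner D g g)"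
    by simp
  moreover have "c * cnj c = of_real ((cmod c)\<^sup>2)"
    by (rule complex_norm_square[symmetric])
  ultimately show ?thesis
    by (simp add: bergman_inner_self)
qed

lemma bergman_cauchy_schwarz:
  assumes "open D" "f \<in> bergman_space D" "g \<in> bergman_space D"
  shows "(cmod (bergman_inner D f g))\<^sup>2 \<le> bergman_sq D f * bergman_sq D g"
proof -
  define p where "p = bergman_inner D f g"
  have *: "0 \<le> bergman_sq D f - 2 * t * (cmod p)\<^sup>2 + t\<^sup>2 * (cmod p)\<^sup>2 * bergman_sq D g" for t :: real
  proof -
    have "0 \<le> bergman_sq D (\<lambda>z. f z + (- of_real t * p) * g z)" by (rule bergman_sq_nonneg)
    also have "\<dots> = bergman_sq D f + 2 * Re (cnj (- of_real t * p) * p) + (cmod (- of_real t * p))\<^sup>2 * bergman_sq D g"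
      unfolding p_def by (rule bergman_sq_add_cmult[OF assms])
    also have "cnj (- of_real t * p) * p = of_real (- t * (cmod p)\<^sup>2)"
      by (simp add: complex_norm_square mult.commute del: of_real_power)
    finally show ?thesis by (simp add: norm_mult power_mult_distrib)
  qed
  show ?thesis
  proof (cases "bergman_sq D g = 0")
    case True
    have "(cmod p)\<^sup>2 = 0"
    proof (rule ccontr)
      assume "(cmod p)\<^sup>2 \<noteq> 0"
      then have "2 * ((bergman_sq D f + 1) / (2 * (cmod p)\<^sup>2)) * (cmod p)\<^sup>2 = bergman_sq D f + 1" by simp
      then show False using *[of "(bergman_sq D f + 1) / (2 * (cmod p)\<^sup>2)"] True by simp
    qed
    then show ?thesis using True by (simp add: p_def)
  next
    case False
    then have pos: "bergman_sq D g > 0" using bergman_sq_nonneg[of D g] by simp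
    have "0 \<le> bergman_sq D f - (cmod p)\<^sup>2 / bergman_sq D g"
      using *[of "1 / bergman_sq D g"] pos by (simp add: power2_eq_square field_simps)
    then show ?thesis using pos by (simp add: p_def field_simps)
  qed
qed

lemma bergman_space_const:
  assumes "open D" "bounded D"
  shows "(\<lambda>_. c) \<in> bergman_space D"
proof -
  have "set_integrable lborel D (\<lambda>_. (cmod c)\<^sup>2)"
    unfolding set_integrable_def using assms
    using emeasure_bounded_finite[OF assms(2)]
    by (intro integrable_real_indicator integrable_scaleR_left) auto
  then show ?thesis by (auto simp: bergman_space_def intro: holomorphic_fun_on_const)
qed

lemma bergman_space_mult_bounded:
  assumes "open D" "f \<in> bergman_space D" "holomorphic_fun_on h D" "\<And>z. z \<in> D \<Longrightarrow> cmod (h z) \<le> R"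
  shows "(\<lambda>z. h z * f z) \<in> bergman_space D"
    and "bergman_sq D (\<lambda>z. h z * f z) \<le> R\<^sup>2 * bergman_sq D f"
proof -
  have hol: "holomorphic_fun_on (\<lambda>z. h z * f z) D"
    using assms holomorphic_fun_on_mult by (auto simp: bergman_space_def)
  have le: "(cmod (h z * f z))\<^sup>2 \<le> R\<^sup>2 * (cmod (f z))\<^sup>2" if "z \<in> D" for z
    unfolding norm_mult power_mult_distrib using assms(4)[OF that]
    by (intro mult_right_mono power_mono) auto
  have int: "set_integrable lborel D (\<lambda>z. R\<^sup>2 * (cmod (f z))\<^sup>2)"
    using assms by (intro set_integrable_mult_right) (auto simp: bergman_space_def)
  have int': "set_integrable lborel D (\<lambda>z. (cmod (h z * f z))\<^sup>2)"
  proof (rule set_integrable_bound[OF int])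
    show "set_borel_measurable lborel D (\<lambda>z. (cmod (h z * f z))\<^sup>2)"
      using assms(1) by (intro set_borel_measurable_continuous_on_open continuous_on_power continuous_on_norm
          holomorphic_fun_on_continuous hol)
    show "AE z in lborel. z \<in> D \<longrightarrow> norm ((cmod (h z * f z))\<^sup>2) \<le> norm (R\<^sup>2 * (cmod (f z))\<^sup>2)"
      using le by auto
  qed
  show "(\<lambda>z. h z * f z) \<in> bergman_space D"
    using hol int' by (simp add: bergman_space_def)
  show "bergman_sq D (\<lambda>z. h z * f z) \<le> R\<^sup>2 * bergman_sq D f"
    using set_integral_mono[OF int' int le] by (simp add: bergman_sq_def)
qed

text \<open>The mean value inequality on balls of a fixed radius \<open>r\<close> about the points near \<open>w\<close>; the volume of such a
  ball does not depend on its centre.\<close>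

lemma bergman_locally_uniform_bound:
  assumes "open D" "w \<in> D"
  obtains r C where "0 < r" "0 < C" "ball w r \<subseteq> D"
    "\<And>f z. f \<in> bergman_space D \<Longrightarrow> z \<in> ball w r \<Longrightarrow> (cmod (f z))\<^sup>2 \<le> C * bergman_sq D f"
proof -
  obtain e where e: "0 < e" "cball w e \<subseteq> D"
    using assms open_contains_cball by blast
  define r where "r = e / 2"
  define V where "V = unit_ball_vol DIM(complex ^ 'a) * r ^ DIM(complex ^ 'a)"
  have V: "measure lborel (ball z r) = V" for z :: "complex ^ 'a"
    using e(1) by (simp add: V_def content_ball r_def)
  have "r > 0" using e(1) by (simp add: r_def)
  have "V > 0" unfolding V_def using e(1) by (intro mult_pos_pos zero_less_power unit_ball_vol_pos) (auto simp: r_def)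
  show thesis
  proof (rule that[of r "1 / V"])
    show "0 < r" "0 < 1 / V" using e(1) \<open>V > 0\<close> by (auto simp: r_def)
    show "ball w r \<subseteq> D" using e by (auto simp: r_def intro!: subsetD[OF e(2)])
    fix f z assume f: "f \<in> bergman_space D" and z: "z \<in> ball w r"
    have "cball z r \<subseteq> D"
    proof
      fix x assume "x \<in> cball z r"
      then have "dist w x \<le> e"
        using dist_triangle[of w x z] z by (simp add: r_def)
      then show "x \<in> D" using e(2) by auto
    qed
    from mean_value_inequality[OF assms(1) _ this, of f] f \<open>r > 0\<close>
    have "(cmod (f z))\<^sup>2 * V \<le> bergman_sq D f"
      unfolding V by (simp add: bergman_space_def bergman_sq_def)
    then show "(cmod (f z))\<^sup>2 \<le> 1 / V * bergman_sq D f"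
      using \<open>V > 0\<close> by (simp add: field_simps)
  qed
qed

text \<open>Convergence in norm implies locally uniform convergence, by the uniform bound on point evaluations. The
  pointwise limit is therefore holomorphic, and Fatou's lemma transfers the norm estimates to it.\<close>

theorem bergman_space_complete:
  fixes D :: "(complex ^ 'n) set"
  assumes D: "open D" and f: "\<And>n. f n \<in> bergman_space D"
    and cauchy: "\<And>e. e > 0 \<Longrightarrow> \<exists>N. \<forall>m\<ge>N. \<forall>n\<ge>N. bergman_sq D (\<lambda>z. f m z - f n z) \<le> e"
  obtains g where "g \<in> bergman_space D" "(\<lambda>n. bergman_sq D (\<lambda>z. f n z - g z)) \<longlonglongrightarrow> 0"
proof -
  have loc: "\<exists>r>0. ball w r \<subseteq> D \<and> (\<forall>e>0. \<exists>N. \<forall>m\<ge>N. \<forall>n\<ge>N. \<forall>z\<in>ball w r. cmod (f m z - f n z) \<le> e)"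
    if "w \<in> D" for w
  proof -
    obtain r C where r: "0 < r" "0 < C" "ball w r \<subseteq> D"
      and C: "\<And>f z. f \<in> bergman_space D \<Longrightarrow> z \<in> ball w r \<Longrightarrow> (cmod (f z))\<^sup>2 \<le> C * bergman_sq D f"
      using bergman_locally_uniform_bound[OF D \<open>w \<in> D\<close>] by metis
    have "\<exists>N. \<forall>m\<ge>N. \<forall>n\<ge>N. \<forall>z\<in>ball w r. cmod (f m z - f n z) \<le> e" if "e > 0" for e
    proof -
      have "e\<^sup>2 / C > 0" using r(2) that by simp
      then obtain N where N: "\<forall>m\<ge>N. \<forall>n\<ge>N. bergman_sq D (\<lambda>z. f m z - f n z) \<le> e\<^sup>2 / C"
        using cauchy by blast
      have "cmod (f m z - f n z) \<le> e" if "m \<ge> N" "n \<ge> N" "z \<in> ball w r" for m n z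
      proof -
        have "(cmod (f m z - f n z))\<^sup>2 \<le> C * bergman_sq D (\<lambda>z. f m z - f n z)"
          using C[OF bergman_space_diff[OF D f f] that(3)] .
        also have "\<dots> \<le> C * (e\<^sup>2 / C)"
          using N that r(2) by (intro mult_left_mono) auto
        finally have "(cmod (f m z - f n z))\<^sup>2 \<le> e\<^sup>2" using r(2) by simp
        then show ?thesis by (rule power2_le_imp_le) (use \<open>e > 0\<close> in simp)
      qed
      then show ?thesis by blast
    qed
    then show ?thesis using r by blast
  qed
  define g where "g z = lim (\<lambda>n. f n z)" for z
  have lim: "(\<lambda>n. f n z) \<longlonglongrightarrow> g z" if "z \<in> D" for z
  proof -
    obtain r where r: "r > 0" "\<forall>e>0. \<exists>N. \<forall>m\<ge>N. \<forall>n\<ge>N. \<forall>z'\<in>ball z r. cmod (f m z' - f n z') \<le> e"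
      using loc[OF \<open>z \<in> D\<close>] by blast
    have "Cauchy (\<lambda>n. f n z)"
    proof (rule CauchyI)
      fix e :: real assume "e > 0"
      then obtain N where "\<forall>m\<ge>N. \<forall>n\<ge>N. \<forall>z'\<in>ball z r. cmod (f m z' - f n z') \<le> e/2"
        using r(2)[rule_format, of "e/2"] by auto
      then have "cmod (f m z - f n z) \<le> e/2" if "m \<ge> N" "n \<ge> N" for m n
        using r(1) that by simp
      moreover have "e/2 < e" using \<open>e > 0\<close> by simp
      ultimately have "\<forall>m\<ge>N. \<forall>n\<ge>N. cmod (f m z - f n z) < e"
        by (blast intro: le_less_trans)
      then show "\<exists>M. \<forall>m\<ge>M. \<forall>n\<ge>M. norm (f m z - f n z) < e" by blast
    qed
    then show ?thesis
      unfolding g_def by (simp add: Cauchy_convergent_iff convergent_LIMSEQ_iff)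
  qed
  have unif: "\<exists>r>0. ball w r \<subseteq> D \<and> uniform_limit (ball w r) f g sequentially" if "w \<in> D" for w
  proof -
    obtain r where r: "r > 0" "ball w r \<subseteq> D" "\<forall>e>0. \<exists>N. \<forall>m\<ge>N. \<forall>n\<ge>N. \<forall>z'\<in>ball w r. cmod (f m z' - f n z') \<le> e"
      using loc[OF \<open>w \<in> D\<close>] by blast
    have "uniform_limit (ball w r) f g sequentially"
    proof (rule uniform_limitI)
      fix e :: real assume "e > 0"
      then obtain N where N: "\<forall>m\<ge>N. \<forall>n\<ge>N. \<forall>z'\<in>ball w r. cmod (f m z' - f n z') \<le> e/2"
        using r(3)[rule_format, of "e/2"] by auto
      have "dist (f n z) (g z) < e" if "n \<ge> N" "z \<in> ball w r" for n z
      proof -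
        have "(\<lambda>m. cmod (f n z - f m z)) \<longlonglongrightarrow> cmod (f n z - g z)"
          using lim that r(2) by (intro tendsto_intros) auto
        then have "cmod (f n z - g z) \<le> e/2"
          by (rule LIMSEQ_le_const2) (use N that in blast)
        then show ?thesis using \<open>e > 0\<close> by (simp add: dist_norm)
      qed
      then show "\<forall>\<^sub>F n in sequentially. \<forall>z\<in>ball w r. dist (f n z) (g z) < e"
        unfolding eventually_sequentially by blast
    qed
    then show ?thesis using r by blast
  qed
  have hol_f: "holomorphic_fun_on (f n) D" for n using f[of n] by (simp add: bergman_space_def)
  have hol_g: "holomorphic_fun_on g D"
  proof (rule osgood[OF D])
    show "locally_bounded_on g D"
    proof (rule locally_bounded_on_continuous[OF _ D])
      show "continuous_on D g"
        unfolding continuous_on_eq_continuous_at[OF D]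
      proof
        fix w assume "w \<in> D"
        then obtain r where r: "r > 0" "ball w r \<subseteq> D" "uniform_limit (ball w r) f g sequentially"
          using unif by blast
        have "continuous_on (ball w r) g"
          by (rule uniform_limit_theorem[OF _ r(3)])
            (auto intro!: always_eventually continuous_on_subset[OF holomorphic_fun_on_continuous[OF hol_f] r(2)])
        then show "isCont g w"
          using r(1) by (simp add: continuous_on_eq_continuous_at)
      qed
    qed
    show "separately_holomorphic_on g D"
      unfolding separately_holomorphic_on_def
    proof (intro ballI allI)
      fix w k assume "w \<in> D"
      then obtain r where r: "r > 0" "ball w r \<subseteq> D" "uniform_limit (ball w r) f g sequentially"
        using unif by blast
      have in_ball: "w + t *s axis k 1 \<in> ball w r" if "t \<in> cball 0 (r/2)" for t
        using that r(1) by (simp add: dist_norm)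
      have "\<forall>\<^sub>F n in sequentially. continuous_on (cball 0 (r/2)) (\<lambda>t. f n (w + t *s axis k 1)) \<and>
          (\<lambda>t. f n (w + t *s axis k 1)) holomorphic_on ball 0 (r/2)"
      proof (intro always_eventually allI)
        fix n
        have "(\<lambda>t. f n (w + t *s axis k 1)) holomorphic_on cball 0 (r/2)"
          by (rule holomorphic_slice[OF hol_f]) (use in_ball r(2) in blast)
        then show "continuous_on (cball 0 (r/2)) (\<lambda>t. f n (w + t *s axis k 1)) \<and>
          (\<lambda>t. f n (w + t *s axis k 1)) holomorphic_on ball 0 (r/2)"
          using holomorphic_on_imp_continuous_on holomorphic_on_subset ball_subset_cball by blast
      qed
      moreover have "uniform_limit (cball 0 (r/2)) (\<lambda>n t. f n (w + t *s axis k 1)) (\<lambda>t. g (w + t *s axis k 1)) sequentially"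
        using r(3) in_ball unfolding uniform_limit_iff by (fast elim: eventually_mono)
      ultimately have "(\<lambda>t. g (w + t *s axis k 1)) holomorphic_on ball 0 (r/2)"
        by (rule holomorphic_uniform_limit) auto
      then show "(\<lambda>t. g (w + t *s axis k 1)) field_differentiable at 0"
        using r(1) holomorphic_on_imp_differentiable_at by auto
    qed
  qed
  \<comment> \<open>The difference \<open>f n - g\<close> is the pointwise limit of \<open>f n - f m\<close> as \<open>m\<close> grows.\<close>
  have fatou: "(\<lambda>z. f n z - g z) \<in> bergman_space D \<and> bergman_sq D (\<lambda>z. f n z - g z) \<le> e"
    if e: "e \<ge> 0" and N: "\<forall>m\<ge>N. bergman_sq D (\<lambda>z. f n z - f m z) \<le> e" for n N e
  proof -
    define u where "u m z = ennreal (indicator D z *\<^sub>R (cmod (f n z - f m z))\<^sup>2)" for m z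
    define u0 where "u0 z = indicator D z *\<^sub>R (cmod (f n z - g z))\<^sup>2" for z
    have hol: "holomorphic_fun_on (\<lambda>z. f n z - g z) D"
      using holomorphic_fun_on_add[OF hol_f holomorphic_fun_on_cmult[OF hol_g, of "-1"]] by simp
    have meas0: "u0 \<in> borel_measurable borel"
      unfolding u0_def by (intro borel_measurable_continuous_on_indicator continuous_intros
          holomorphic_fun_on_continuous hol) (use D in auto)
    have meas: "u m \<in> borel_measurable lborel" for m
    proof -
      have "(\<lambda>z. indicator D z *\<^sub>R (cmod (f n z - f m z))\<^sup>2) \<in> borel_measurable borel"
        by (intro borel_measurable_continuous_on_indicator continuous_intros
          holomorphic_fun_on_continuous hol_f) (use D in auto)
      then show ?thesis unfolding u_def by simp
    qed
    have "(\<lambda>m. u m z) \<longlonglongrightarrow> ennreal (u0 z)" for z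
    proof (cases "z \<in> D")
      case True
      then show ?thesis
        unfolding u_def u0_def by (intro tendsto_intros lim)
    qed (simp add: u_def u0_def)
    then have "ennreal (u0 z) = liminf (\<lambda>m. u m z)" for z
      by (intro lim_imp_Liminf[symmetric]) auto
    then have "(\<integral>\<^sup>+z. ennreal (u0 z) \<partial>lborel) \<le> liminf (\<lambda>m. \<integral>\<^sup>+z. u m z \<partial>lborel)"
      using nn_integral_liminf[of u lborel, OF meas] by simp
    also have "\<dots> \<le> limsup (\<lambda>m. \<integral>\<^sup>+z. u m z \<partial>lborel)"
      by (rule Liminf_le_Limsup) simp
    also have "\<dots> \<le> ennreal e"
    proof (rule Limsup_bounded)
      have "(\<integral>\<^sup>+z. u m z \<partial>lborel) \<le> ennreal e" if "m \<ge> N" for m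
      proof -
        have "(\<integral>\<^sup>+z. u m z \<partial>lborel) = ennreal (bergman_sq D (\<lambda>z. f n z - f m z))"
          unfolding u_def bergman_sq_def set_lebesgue_integral_def
          using bergman_space_diff[OF D f f, of n m]
          by (intro nn_integral_eq_integral) (auto simp: bergman_space_def set_integrable_def)
        then show ?thesis using N that by (simp add: ennreal_leI)
      qed
      then show "\<forall>\<^sub>F m in sequentially. (\<integral>\<^sup>+z. u m z \<partial>lborel) \<le> ennreal e"
        unfolding eventually_sequentially by blast
    qed
    finally have le: "(\<integral>\<^sup>+z. ennreal (u0 z) \<partial>lborel) \<le> ennreal e" .
    have u0: "u0 z \<ge> 0" for z by (simp add: u0_def)
    have "integrable lborel u0"
      unfolding integrable_iff_bounded using meas0 u0 le
      by (auto intro: le_less_trans[OF le] simp: ennreal_less_top)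
    then have int: "set_integrable lborel D (\<lambda>z. (cmod (f n z - g z))\<^sup>2)"
      by (simp add: set_integrable_def u0_def[abs_def])
    have "ennreal (bergman_sq D (\<lambda>z. f n z - g z)) = (\<integral>\<^sup>+z. ennreal (u0 z) \<partial>lborel)"
      unfolding bergman_sq_def set_lebesgue_integral_def u0_def[symmetric]
      using \<open>integrable lborel u0\<close> u0 by (intro nn_integral_eq_integral[symmetric]) auto
    then have "ennreal (bergman_sq D (\<lambda>z. f n z - g z)) \<le> ennreal e"
      using le by (simp only:)
    then have "bergman_sq D (\<lambda>z. f n z - g z) \<le> e"
      by (simp only: ennreal_le_iff[OF e])
    then show ?thesis using hol int by (simp add: bergman_space_def)
  qed
  show thesis
  proof (rule that[of g])
    obtain N where "\<forall>m\<ge>N. \<forall>n\<ge>N. bergman_sq D (\<lambda>z. f m z - f n z) \<le> 1"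
      using cauchy[of 1] by auto
    then have "(\<lambda>z. f N z - g z) \<in> bergman_space D"
      using fatou[of 1 N N] by auto
    from bergman_space_diff[OF D f[of N] this] show "g \<in> bergman_space D" by simp
    show "(\<lambda>n. bergman_sq D (\<lambda>z. f n z - g z)) \<longlonglongrightarrow> 0"
    proof (rule LIMSEQ_I)
      fix e :: real assume "e > 0"
      then obtain N where "\<forall>m\<ge>N. \<forall>n\<ge>N. bergman_sq D (\<lambda>z. f m z - f n z) \<le> e / 2"
        using cauchy[of "e/2"] by auto
      then have "bergman_sq D (\<lambda>z. f n z - g z) \<le> e / 2" if "n \<ge> N" for n
        using fatou[of "e/2" N n] that \<open>e > 0\<close> by auto
      then have "\<forall>n\<ge>N. norm (bergman_sq D (\<lambda>z. f n z - g z) - 0) < e"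
        using \<open>e > 0\<close> bergman_sq_nonneg[of D] by (fastforce simp: abs_of_nonneg)
      then show "\<exists>N. \<forall>n\<ge>N. norm (bergman_sq D (\<lambda>z. f n z - g z) - 0) < e" by blast
    qed
  qed
qed

text \<open>The representer is the element of least norm on the hyperplane \<open>L = 1\<close>, divided by the square of its norm.
  A minimising sequence is Cauchy by the parallelogram law. Orthogonality of its limit \<open>h\<close> to the kernel of
  \<open>L\<close> is obtained from the almost minimality of the sequence, by passing to the limit in the first variation.\<close>

theorem bergman_riesz:
  fixes L :: "(complex ^ 'n \<Rightarrow> complex) \<Rightarrow> complex"
  assumes D: "open D" "bounded D"
    and add: "\<And>f g. f \<in> bergman_space D \<Longrightarrow> g \<in> bergman_space D \<Longrightarrow> L (\<lambda>z. f z + g z) = L f + L g"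
    and scale: "\<And>c f. f \<in> bergman_space D \<Longrightarrow> L (\<lambda>z. c * f z) = c * L f"
    and bound: "\<And>f. f \<in> bergman_space D \<Longrightarrow> (cmod (L f))\<^sup>2 \<le> C * bergman_sq D f"
  obtains e where "e \<in> bergman_space D" "\<And>f. f \<in> bergman_space D \<Longrightarrow> L f = bergman_inner D f e"
proof (cases "\<forall>f\<in>bergman_space D. L f = 0")
  case True
  show ?thesis
    by (rule that[of "\<lambda>_. 0"]) (use True bergman_space_const[OF D] in \<open>auto simp: bergman_inner_def\<close>)
next
  case False
  then obtain f0 where f0: "f0 \<in> bergman_space D" "L f0 \<noteq> 0" by blast
  have diff: "L (\<lambda>z. f z - c * g z) = L f - c * L g" if "f \<in> bergman_space D" "g \<in> bergman_space D" for f g c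
    using add[OF that(1) bergman_space_cmult[OF that(2), of "-c"]] scale[OF that(2), of "-c"] by simp
  define A where "A = {f \<in> bergman_space D. L f = 1}"
  have "(\<lambda>z. (1 / L f0) * f0 z) \<in> A"
    unfolding A_def using f0(2) bergman_space_cmult[OF f0(1), of "1 / L f0"] scale[OF f0(1), of "1 / L f0"] by simp
  then have "A \<noteq> {}" by blast
  define d where "d = (INF f\<in>A. bergman_sq D f)"
  have bdd: "bdd_below (bergman_sq D ` A)"
    by (rule bdd_belowI2[of _ 0]) (rule bergman_sq_nonneg)
  have d_le: "d \<le> bergman_sq D f" if "f \<in> A" for f
    unfolding d_def using bdd that by (rule cINF_lower)
  have "\<exists>f\<in>A. bergman_sq D f < d + e" if "e > 0" for e
    using cINF_less_iff[OF \<open>A \<noteq> {}\<close> bdd, of "d + e"] that by (simp add: d_def)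
  then have "\<exists>f\<in>A. bergman_sq D f < d + 1 / real (Suc n)" for n by simp
  then obtain f where f: "\<And>n. f n \<in> A" "\<And>n. bergman_sq D (f n) < d + 1 / real (Suc n)"
    by metis
  have fB: "f n \<in> bergman_space D" "L (f n) = 1" for n using f(1) by (auto simp: A_def)
  have par: "bergman_sq D (\<lambda>z. f m z - f n z) \<le> 2 / real (Suc m) + 2 / real (Suc n)" for m n
  proof -
    have "(\<lambda>z. (1/2) * (f m z + f n z)) \<in> A"
      unfolding A_def using fB bergman_space_cmult[OF bergman_space_add[OF D(1) fB(1)[of m] fB(1)[of n]], of "1/2"]
        scale[OF bergman_space_add[OF D(1) fB(1)[of m] fB(1)[of n]], of "1/2"] add[OF fB(1) fB(1)] by simp
    from d_le[OF this] have "4 * d \<le> bergman_sq D (\<lambda>z. f m z + f n z)"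
      unfolding bergman_sq_cmult by (simp add: norm_divide power2_eq_square)
    moreover have "bergman_sq D (\<lambda>z. f m z + f n z) + bergman_sq D (\<lambda>z. f m z - f n z) =
        2 * bergman_sq D (f m) + 2 * bergman_sq D (f n)"
      using bergman_sq_add_cmult[OF D(1) fB(1)[of m] fB(1)[of n], of 1]
        bergman_sq_add_cmult[OF D(1) fB(1)[of m] fB(1)[of n], of "-1"] by simp
    ultimately show ?thesis using f(2)[of m] f(2)[of n] by simp
  qed
  obtain h where h: "h \<in> bergman_space D" "(\<lambda>n. bergman_sq D (\<lambda>z. f n z - h z)) \<longlonglongrightarrow> 0"
  proof (rule bergman_space_complete[OF D(1) fB(1)])
    fix e :: real assume "e > 0"
    obtain N where N: "1 / real (Suc N) < e / 4"
      using nat_approx_posE[of "e/4"] \<open>e > 0\<close> by auto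
    have "bergman_sq D (\<lambda>z. f m z - f n z) \<le> e" if "m \<ge> N" "n \<ge> N" for m n
    proof -
      have "1 / real (Suc k) \<le> 1 / real (Suc N)" if "k \<ge> N" for k
        using that by (intro divide_left_mono) auto
      from this[OF that(1)] this[OF that(2)] show ?thesis
        using par[of m n] N by simp
    qed
    then show "\<exists>N. \<forall>m\<ge>N. \<forall>n\<ge>N. bergman_sq D (\<lambda>z. f m z - f n z) \<le> e" by blast
  qed
  have "L h = 1"
  proof -
    have "(cmod (1 - L h))\<^sup>2 \<le> C * bergman_sq D (\<lambda>z. f n z - h z)" for n
      using bound[OF bergman_space_diff[OF D(1) fB(1)[of n] h(1)]] diff[OF fB(1)[of n] h(1), of 1] fB(2)[of n] by simp
    moreover have "(\<lambda>n. C * bergman_sq D (\<lambda>z. f n z - h z)) \<longlonglongrightarrow> C * 0"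
      by (intro tendsto_intros h(2))
    ultimately have "(cmod (1 - L h))\<^sup>2 \<le> C * 0"
      by (meson LIMSEQ_le_const)
    then show ?thesis by simp
  qed
  have orth: "bergman_inner D h g = 0" if g: "g \<in> bergman_space D" "L g = 0" for g
  proof -
    define p where "p = bergman_inner D h g"
    have lim: "(\<lambda>n. bergman_inner D (f n) g) \<longlonglongrightarrow> p"
    proof -
      have "(\<lambda>n. bergman_inner D (f n) g - p) \<longlonglongrightarrow> 0"
      proof (rule Lim_null_comparison)
        have "norm (bergman_inner D (f n) g - p) \<le> sqrt (bergman_sq D (\<lambda>z. f n z - h z) * bergman_sq D g)" for n
          using bergman_cauchy_schwarz[OF D(1) bergman_space_diff[OF D(1) fB(1)[of n] h(1)] g(1)]
          by (intro real_le_rsqrt) (simp add: bergman_inner_diff[OF D(1) fB(1) h(1) g(1)] p_def)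
        then show "\<forall>\<^sub>F n in sequentially. norm (bergman_inner D (f n) g - p) \<le> sqrt (bergman_sq D (\<lambda>z. f n z - h z) * bergman_sq D g)"
          by simp
        have "(\<lambda>n. sqrt (bergman_sq D (\<lambda>z. f n z - h z) * bergman_sq D g)) \<longlonglongrightarrow> sqrt (0 * bergman_sq D g)"
          by (intro tendsto_intros h(2))
        then show "(\<lambda>n. sqrt (bergman_sq D (\<lambda>z. f n z - h z) * bergman_sq D g)) \<longlonglongrightarrow> 0" by simp
      qed
      then show ?thesis by (simp add: LIM_zero_iff)
    qed
    have main: "2 * s * (cmod p)\<^sup>2 \<le> s\<^sup>2 * (cmod p)\<^sup>2 * bergman_sq D g" for s :: real
    proof -
      \<comment> \<open>Moving from \<open>f n\<close> in direction \<open>g\<close> by \<open>c\<close> stays in \<open>A\<close> and has first-order effect \<open>- 2 s |p|\<^sup>2\<close>.\<close>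
      define c where "c = - of_real s * p"
      have "d \<le> bergman_sq D (f n) + 2 * Re (cnj c * bergman_inner D (f n) g) + (cmod c)\<^sup>2 * bergman_sq D g" for n
      proof -
        have "(\<lambda>z. f n z + c * g z) \<in> A"
          unfolding A_def using bergman_space_add[OF D(1) fB(1)[of n] bergman_space_cmult[OF g(1)], of c]
            diff[OF fB(1)[of n] g(1), of "-c"] g(2) fB(2)[of n] by simp
        from d_le[OF this] show ?thesis
          unfolding bergman_sq_add_cmult[OF D(1) fB(1) g(1)] .
      qed
      then have "0 \<le> 1 / real (Suc n) + 2 * Re (cnj c * bergman_inner D (f n) g) + (cmod c)\<^sup>2 * bergman_sq D g" for n
        using f(2)[of n] by (smt (verit))
      moreover have "(\<lambda>n. 1 / real (Suc n) + 2 * Re (cnj c * bergman_inner D (f n) g) + (cmod c)\<^sup>2 * bergman_sq D g)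
          \<longlonglongrightarrow> 0 + 2 * Re (cnj c * p) + (cmod c)\<^sup>2 * bergman_sq D g"
        by (intro tendsto_intros lim LIMSEQ_Suc[OF lim_1_over_n])
      ultimately have "0 \<le> 0 + 2 * Re (cnj c * p) + (cmod c)\<^sup>2 * bergman_sq D g"
        by (meson LIMSEQ_le_const)
      moreover have "Re (cnj c * p) = - s * (cmod p)\<^sup>2"
      proof -
        have "cnj c * p = - of_real s * of_real ((cmod p)\<^sup>2)"
          unfolding complex_norm_square by (simp add: c_def mult_ac)
        then show ?thesis
          by (simp only: of_real_minus[symmetric] of_real_mult[symmetric] Re_complex_of_real)
      qed
      moreover have "(cmod c)\<^sup>2 = s\<^sup>2 * (cmod p)\<^sup>2"
        by (simp add: c_def norm_mult power_mult_distrib)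
      ultimately show ?thesis by simp
    qed
    have "cmod p = 0"
    proof (rule ccontr)
      assume "cmod p \<noteq> 0"
      \<comment> \<open>A step so small that the quadratic term loses against the linear one.\<close>
      define s where "s = 1 / (bergman_sq D g + 1)"
      have s: "s > 0" "s * bergman_sq D g < 1"
        using bergman_sq_nonneg[of D g] by (auto simp: s_def divide_simps)
      have "s * (2 * (cmod p)\<^sup>2) \<le> s * ((s * bergman_sq D g) * (cmod p)\<^sup>2)"
        using main[of s] by (simp add: power2_eq_square mult_ac)
      then have "2 * (cmod p)\<^sup>2 \<le> (s * bergman_sq D g) * (cmod p)\<^sup>2"
        using s(1) by (simp add: mult_le_cancel_left_pos)
      then have "2 \<le> s * bergman_sq D g"
        using \<open>cmod p \<noteq> 0\<close> by (simp add: mult_le_cancel_right_pos)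
      then show False using s(2) by simp
    qed
    then show ?thesis by (simp add: p_def)
  qed
  have sq_h: "bergman_sq D h \<noteq> 0"
    using bound[OF h(1)] \<open>L h = 1\<close> by auto
  show ?thesis
  proof (rule that[of "\<lambda>z. (1 / of_real (bergman_sq D h)) * h z"])
    show "(\<lambda>z. (1 / of_real (bergman_sq D h)) * h z) \<in> bergman_space D"
      by (rule bergman_space_cmult[OF h(1)])
    fix k assume k: "k \<in> bergman_space D"
    have kh: "(\<lambda>z. k z - L k * h z) \<in> bergman_space D"
      by (rule bergman_space_diff[OF D(1) k bergman_space_cmult[OF h(1)]])
    have "bergman_inner D (\<lambda>z. k z - L k * h z) h = 0"
      using orth[OF kh] diff[OF k h(1), of "L k"] \<open>L h = 1\<close> by (subst bergman_inner_cnj) simp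
    then have "bergman_inner D k h = L k * of_real (bergman_sq D h)"
      unfolding bergman_inner_diff[OF D(1) k bergman_space_cmult[OF h(1)] h(1)] bergman_inner_cmult
      by (simp add: bergman_inner_self)
    moreover have "bergman_inner D k (\<lambda>z. (1 / of_real (bergman_sq D h)) * h z) =
       (1 / of_real (bergman_sq D h)) * bergman_inner D k h"
      by (subst (1 2) bergman_inner_cnj) (simp only: bergman_inner_cmult, simp)
    ultimately show "L k = bergman_inner D k (\<lambda>z. (1 / of_real (bergman_sq D h)) * h z)"
      using sq_h by simp
  qed
qed

section \<open>The Bergman kernel\<close>

text \<open>The kernel is assembled from the representers of the point evaluations.\<close>

theorem bergman_kernel_exists:
  fixes D :: "(complex ^ 'n) set"
  assumes "open D" "bounded D"
  shows "is_bergman_kernel D (bergman_kernel D)"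
proof -
  have "\<exists>e\<in>bergman_space D. \<forall>f\<in>bergman_space D. f w = bergman_inner D f e" if w: "w \<in> D" for w
  proof -
    obtain r C where "0 < r" and C: "\<And>f z. f \<in> bergman_space D \<Longrightarrow> z \<in> ball w r \<Longrightarrow> (cmod (f z))\<^sup>2 \<le> C * bergman_sq D f"
      using bergman_locally_uniform_bound[OF assms(1) w] by metis
    then have "(cmod (f w))\<^sup>2 \<le> C * bergman_sq D f" if "f \<in> bergman_space D" for f
      using that by simp
    then obtain e where "e \<in> bergman_space D" "\<And>f. f \<in> bergman_space D \<Longrightarrow> f w = bergman_inner D f e"
      using bergman_riesz[OF assms, of "\<lambda>f. f w" C] by auto
    then show ?thesis by blast
  qed
  then obtain k where "\<And>w. w \<in> D \<Longrightarrow> k w \<in> bergman_space D \<and> (\<forall>f\<in>bergman_space D. f w = bergman_inner D f (k w))"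
    by metis
  then have "is_bergman_kernel D (\<lambda>z w. k w z)"
    by (simp add: is_bergman_kernel_def bergman_inner_def)
  then show ?thesis
    unfolding bergman_kernel_def by (rule someI[where P="is_bergman_kernel D"])
qed

lemma bergman_kernel_mem:
  assumes "open D" "bounded D" "w \<in> D"
  shows "(\<lambda>z. bergman_kernel D z w) \<in> bergman_space D"
  using bergman_kernel_exists[OF assms(1,2)] assms(3) by (simp add: is_bergman_kernel_def)

lemma bergman_kernel_reproducing:
  assumes "open D" "bounded D" "w \<in> D" "f \<in> bergman_space D"
  shows "bergman_inner D f (\<lambda>z. bergman_kernel D z w) = f w"
  using bergman_kernel_exists[OF assms(1,2)] assms(3,4) by (simp add: is_bergman_kernel_def bergman_inner_def)

lemma bergman_kernel_cnj:
  assumes "open D" "bounded D" "w \<in> D" "z \<in> D"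
  shows "bergman_kernel D w z = cnj (bergman_kernel D z w)"
proof -
  have "bergman_kernel D z w = bergman_inner D (\<lambda>x. bergman_kernel D x w) (\<lambda>x. bergman_kernel D x z)"
    using bergman_kernel_reproducing[OF assms(1,2,4) bergman_kernel_mem[OF assms(1-3)]] by simp
  moreover have "bergman_kernel D w z = bergman_inner D (\<lambda>x. bergman_kernel D x z) (\<lambda>x. bergman_kernel D x w)"
    using bergman_kernel_reproducing[OF assms(1-3) bergman_kernel_mem[OF assms(1,2,4)]] by simp
  ultimately show ?thesis
    using bergman_inner_cnj[of D "\<lambda>x. bergman_kernel D x z" "\<lambda>x. bergman_kernel D x w"] by simp
qed

lemma bergman_kernel_diag:
  assumes "open D" "bounded D" "w \<in> D"
  shows "bergman_kernel D w w = of_real (bergman_sq D (\<lambda>z. bergman_kernel D z w))"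
  using bergman_kernel_reproducing[OF assms bergman_kernel_mem[OF assms]] by (simp add: bergman_inner_self)

lemma bergman_point_bound:
  assumes "open D" "bounded D" "w \<in> D" "f \<in> bergman_space D"
  shows "(cmod (f w))\<^sup>2 \<le> bergman_sq D f * Re (bergman_kernel D w w)"
  using bergman_cauchy_schwarz[OF assms(1,4) bergman_kernel_mem[OF assms(1-3)]]
    bergman_kernel_reproducing[OF assms] bergman_kernel_diag[OF assms(1-3)] by simp

lemma bergman_kernel_pos:
  assumes "open D" "bounded D" "w \<in> D"
  shows "Re (bergman_kernel D w w) > 0"
proof -
  have "1 \<le> bergman_sq D (\<lambda>_. 1) * Re (bergman_kernel D w w)"
    using bergman_point_bound[OF assms bergman_space_const[OF assms(1,2), of 1]] by simp
  moreover have "Re (bergman_kernel D w w) \<ge> 0"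
    using bergman_kernel_diag[OF assms] bergman_sq_nonneg by simp
  ultimately show ?thesis
    by (cases "Re (bergman_kernel D w w) = 0") auto
qed

lemma bergman_kernel_real:
  assumes "open D" "bounded D" "w \<in> D"
  shows "bergman_kernel D w w = of_real (Re (bergman_kernel D w w))"
  using bergman_kernel_diag[OF assms] by simp

section \<open>The polarised kernel\<close>

text \<open>The diagonal \<open>K(z,z)\<close> is not holomorphic, but \<open>K(z,w)\<close> is holomorphic in \<open>(z, cnj w)\<close>. Coordinates of the
  doubled space are indexed by \<open>'n + 'n\<close>: \<open>Inl\<close> for \<open>z\<close> and \<open>Inr\<close> for the conjugate of \<open>w\<close>.\<close>

definition polarise :: "complex ^ 'n \<Rightarrow> complex ^ 'n \<Rightarrow> complex ^ ('n + 'n)" where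
  "polarise z w = (\<chi> s. case s of Inl i \<Rightarrow> z $ i | Inr i \<Rightarrow> cnj (w $ i))"

definition left_part :: "complex ^ ('n + 'n) \<Rightarrow> complex ^ 'n" where
  "left_part x = (\<chi> i. x $ Inl i)"

definition right_part :: "complex ^ ('n + 'n) \<Rightarrow> complex ^ 'n" where
  "right_part x = (\<chi> i. cnj (x $ Inr i))"

lemma polarise_parts [simp]: "left_part (polarise z w) = z" "right_part (polarise z w) = w"
  by (simp_all add: left_part_def right_part_def polarise_def vec_eq_iff)

lemma polarise_nth [simp]: "polarise z w $ Inl i = z $ i" "polarise z w $ Inr i = cnj (w $ i)"
  by (simp_all add: polarise_def)

lemma vec_sum_eq_iff: "(x :: complex ^ ('n::finite + 'n)) = y \<longleftrightarrow> (\<forall>i. x $ Inl i = y $ Inl i) \<and> (\<forall>i. x $ Inr i = y $ Inr i)"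
  unfolding vec_eq_iff by (metis sum.exhaust)

lemma polarise_left_right [simp]: "polarise (left_part x) (right_part x) = x"
  by (simp add: vec_sum_eq_iff left_part_def right_part_def)

lemma sum_over_sum_type:
  fixes g :: "'n::finite + 'n \<Rightarrow> complex"
  shows "(\<Sum>s\<in>UNIV. g s) = (\<Sum>i\<in>UNIV. g (Inl i)) + (\<Sum>i\<in>UNIV. g (Inr i))"
  using sum.Plus[of "UNIV :: 'n set" "UNIV :: 'n set" g] by (simp add: UNIV_Plus_UNIV)

lemma polarise_add_left: "polarise (z + t *s axis i 1) w = polarise z w + t *s axis (Inl i) 1"
  by (auto simp: vec_sum_eq_iff axis_def)

lemma polarise_add_right: "polarise z (w + t *s axis i 1) = polarise z w + cnj t *s axis (Inr i) 1"
  by (auto simp: vec_sum_eq_iff axis_def)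

lemma bounded_linear_polarise_diag: "bounded_linear (\<lambda>z. polarise z z)"
  unfolding linear_conv_bounded_linear[symmetric]
  by (intro linearI) (simp_all add: vec_sum_eq_iff)

lemma bounded_linear_left_part: "bounded_linear left_part"
  unfolding linear_conv_bounded_linear[symmetric]
  by (intro linearI) (simp_all add: vec_eq_iff left_part_def)

lemma bounded_linear_right_part: "bounded_linear right_part"
  unfolding linear_conv_bounded_linear[symmetric]
  by (intro linearI) (simp_all add: vec_eq_iff right_part_def)

definition polarised_domain :: "(complex ^ 'n) set \<Rightarrow> (complex ^ ('n + 'n)) set" where
  "polarised_domain D = left_part -` D \<inter> right_part -` D"

definition polarised_kernel :: "(complex ^ 'n) set \<Rightarrow> complex ^ ('n + 'n) \<Rightarrow> complex" where
  "polarised_kernel D x = bergman_kernel D (left_part x) (right_part x)"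

lemma open_polarised_domain: "open D \<Longrightarrow> open (polarised_domain D)"
  unfolding polarised_domain_def
  by (intro open_Int open_vimage linear_continuous_on bounded_linear_left_part bounded_linear_right_part)

lemma polarise_mem [simp]: "polarise z w \<in> polarised_domain D \<longleftrightarrow> z \<in> D \<and> w \<in> D"
  by (simp add: polarised_domain_def)

lemma polarised_kernel_polarise [simp]: "polarised_kernel D (polarise z w) = bergman_kernel D z w"
  by (simp add: polarised_kernel_def)

lemma polarised_kernel_left_derivative:
  assumes "open D" "bounded D" "z \<in> D" "w \<in> D"
  shows "((\<lambda>t. polarised_kernel D (polarise z w + t *s axis (Inl i) 1)) has_field_derivative
     complex_partial i (\<lambda>z. bergman_kernel D z w) z) (at 0)"
  using partial_has_field_derivative[of "\<lambda>z. bergman_kernel D z w" D z i] bergman_kernel_mem[OF assms(1,2,4)] assms(3)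
  by (simp add: bergman_space_def polarise_add_left[symmetric])

lemma open_slice:
  fixes w :: "complex ^ 'n"
  assumes "open D"
  shows "open {t. w + t *s axis i 1 \<in> D}"
proof -
  have "continuous_on UNIV (\<lambda>t. w + t *s axis i 1)"
    unfolding vector_scalar_mult_def by (intro continuous_intros)
  from open_vimage[OF assms this] show ?thesis by (simp add: vimage_def)
qed

text \<open>By Hermitian symmetry \<open>K(z, w + cnj t e\<^sub>i)\<close> is the conjugate of \<open>K(w + cnj t e\<^sub>i, z)\<close>, so the slice is a
  holomorphic function conjugated in argument and value.\<close>

lemma polarised_kernel_right_derivative:
  assumes "open D" "bounded D" "z \<in> D" "w \<in> D"
  shows "((\<lambda>t. polarised_kernel D (polarise z w + t *s axis (Inr i) 1)) has_field_derivative
     cnj (complex_partial i (\<lambda>x. bergman_kernel D x z) w)) (at 0)"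
proof -
  define h where "h t = bergman_kernel D (w + t *s axis i 1) z" for t
  have "(h has_field_derivative complex_partial i (\<lambda>x. bergman_kernel D x z) w) (at (cnj 0))"
    using partial_has_field_derivative[of "\<lambda>x. bergman_kernel D x z" D w i] bergman_kernel_mem[OF assms(1,2,3)] assms(4)
    by (simp add: bergman_space_def h_def[abs_def])
  then have "(cnj \<circ> h \<circ> cnj has_field_derivative cnj (complex_partial i (\<lambda>x. bergman_kernel D x z) w)) (at 0)"
    by (rule has_field_derivative_cnj_cnj)
  moreover have "open (cnj -` {t. w + t *s axis i 1 \<in> D})"
    by (intro open_vimage open_slice assms continuous_intros)
  ultimately show ?thesis
  proof (rule has_field_derivative_transform_within_open)
    fix t assume "t \<in> cnj -` {t. w + t *s axis i 1 \<in> D}"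
    then have "w + cnj t *s axis i 1 \<in> D" by simp
    from bergman_kernel_cnj[OF assms(1,2) assms(3) this]
    show "(cnj \<circ> h \<circ> cnj) t = polarised_kernel D (polarise z w + t *s axis (Inr i) 1)"
      using polarise_add_right[of z w "cnj t" i] by (simp add: h_def flip: polarised_kernel_polarise)
  qed (use assms in simp)
qed

lemma bergman_kernel_le:
  assumes "open D" "bounded D" "z \<in> D" "w \<in> D"
  shows "(cmod (bergman_kernel D z w))\<^sup>2 \<le> Re (bergman_kernel D w w) * Re (bergman_kernel D z z)"
  using bergman_point_bound[OF assms(1-3) bergman_kernel_mem[OF assms(1,2,4)]] bergman_kernel_diag[OF assms(1,2,4)]
  by simp

text \<open>The function \<open>K(-,z)\<close> takes the value \<open>\<parallel>K(-,z)\<parallel>\<^sup>2\<close> at \<open>z\<close>. Applied to it, the bound \<open>|f(z)|\<^sup>2 \<le> C \<parallel>f\<parallel>\<^sup>2\<close>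
  becomes \<open>K(z,z)\<^sup>2 \<le> C K(z,z)\<close>.\<close>

lemma bergman_kernel_diag_locally_bounded:
  assumes "open D" "bounded D" "w \<in> D"
  obtains r C where "0 < r" "0 < C" "ball w r \<subseteq> D" "\<And>z. z \<in> ball w r \<Longrightarrow> Re (bergman_kernel D z z) \<le> C"
proof -
  obtain r C where r: "0 < r" "0 < C" "ball w r \<subseteq> D"
    and C: "\<And>f z. f \<in> bergman_space D \<Longrightarrow> z \<in> ball w r \<Longrightarrow> (cmod (f z))\<^sup>2 \<le> C * bergman_sq D f"
    using bergman_locally_uniform_bound[OF assms(1,3)] by metis
  show thesis
  proof (rule that[OF r])
    fix z assume z: "z \<in> ball w r"
    then have zD: "z \<in> D" using r by blast
    have "cmod (bergman_kernel D z z) = Re (bergman_kernel D z z)"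
      using bergman_kernel_real[OF assms(1,2) zD] bergman_kernel_pos[OF assms(1,2) zD]
      by (metis abs_of_pos norm_of_real)
    then have "Re (bergman_kernel D z z) * Re (bergman_kernel D z z) \<le> C * Re (bergman_kernel D z z)"
      using C[OF bergman_kernel_mem[OF assms(1,2) zD] z] bergman_kernel_diag[OF assms(1,2) zD]
      by (simp add: power2_eq_square)
    then show "Re (bergman_kernel D z z) \<le> C"
      using bergman_kernel_pos[OF assms(1,2) zD] by simp
  qed
qed

lemma norm_left_part_le: "norm (left_part x) \<le> norm x"
proof -
  have "(\<Sum>i\<in>UNIV. (cmod (x $ Inl i))\<^sup>2) \<le> (\<Sum>s\<in>UNIV. (cmod (x $ s))\<^sup>2)"
    by (subst sum.reindex[of Inl, symmetric, unfolded o_def]) (auto intro: sum_mono2)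
  then show ?thesis
    by (simp add: norm_vec_def L2_set_def left_part_def)
qed

lemma norm_right_part_le: "norm (right_part x) \<le> norm x"
proof -
  have "(\<Sum>i\<in>UNIV. (cmod (x $ Inr i))\<^sup>2) \<le> (\<Sum>s\<in>UNIV. (cmod (x $ s))\<^sup>2)"
    by (subst sum.reindex[of Inr, symmetric, unfolded o_def]) (auto intro: sum_mono2)
  then show ?thesis
    by (simp add: norm_vec_def L2_set_def right_part_def)
qed

text \<open>Osgood's lemma; local boundedness off the diagonal follows from that on the diagonal by Cauchy-Schwarz.\<close>

theorem polarised_kernel_holomorphic:
  fixes D :: "(complex ^ 'n) set"
  assumes "open D" "bounded D"
  shows "holomorphic_fun_on (polarised_kernel D) (polarised_domain D)"
proof (rule osgood[OF open_polarised_domain[OF assms(1)]])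
  show "separately_holomorphic_on (polarised_kernel D) (polarised_domain D)"
    unfolding separately_holomorphic_on_def
  proof (intro ballI allI)
    fix x k assume "x \<in> polarised_domain D"
    then have x: "left_part x \<in> D" "right_part x \<in> D" by (auto simp: polarised_domain_def)
    show "(\<lambda>t. polarised_kernel D (x + t *s axis k 1)) field_differentiable at 0"
    proof (cases k)
      case (Inl i)
      then show ?thesis
        using polarised_kernel_left_derivative[OF assms x, of i] by (auto simp: field_differentiable_def)
    next
      case (Inr i)
      then show ?thesis
        using polarised_kernel_right_derivative[OF assms x, of i] by (auto simp: field_differentiable_def)
    qed
  qed
  show "locally_bounded_on (polarised_kernel D) (polarised_domain D)"
    unfolding locally_bounded_on_def
  proof
    fix x assume "x \<in> polarised_domain D"
    then have x: "left_part x \<in> D" "right_part x \<in> D" by (auto simp: polarised_domain_def)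
    obtain r1 C1 where r1: "0 < r1" "0 < C1" "ball (left_part x) r1 \<subseteq> D"
      and C1: "\<And>z. z \<in> ball (left_part x) r1 \<Longrightarrow> Re (bergman_kernel D z z) \<le> C1"
      using bergman_kernel_diag_locally_bounded[OF assms x(1)] by metis
    obtain r2 C2 where r2: "0 < r2" "0 < C2" "ball (right_part x) r2 \<subseteq> D"
      and C2: "\<And>z. z \<in> ball (right_part x) r2 \<Longrightarrow> Re (bergman_kernel D z z) \<le> C2"
      using bergman_kernel_diag_locally_bounded[OF assms x(2)] by metis
    have "cmod (polarised_kernel D y) \<le> sqrt (C2 * C1)" if "y \<in> ball x (min r1 r2)" for y
    proof (rule real_le_rsqrt)
      have d: "dist x y < r1" "dist x y < r2" using that by auto
      have "dist (left_part x) (left_part y) \<le> dist x y" "dist (right_part x) (right_part y) \<le> dist x y"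
        using norm_left_part_le[of "x - y"] norm_right_part_le[of "x - y"]
        by (simp_all add: dist_norm linear_diff bounded_linear.linear bounded_linear_left_part bounded_linear_right_part)
      then have b: "left_part y \<in> ball (left_part x) r1" "right_part y \<in> ball (right_part x) r2"
        using d by auto
      then have yD: "left_part y \<in> D" "right_part y \<in> D" using r1 r2 by auto
      have "(cmod (polarised_kernel D y))\<^sup>2 \<le> Re (bergman_kernel D (right_part y) (right_part y)) *
          Re (bergman_kernel D (left_part y) (left_part y))"
        unfolding polarised_kernel_def by (rule bergman_kernel_le[OF assms yD])
      also have "\<dots> \<le> C2 * C1"
        using C1[OF b(1)] C2[OF b(2)] bergman_kernel_pos[OF assms yD(1)] bergman_kernel_pos[OF assms yD(2)] r2(2)
        by (intro mult_mono) auto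
      finally show "(cmod (polarised_kernel D y))\<^sup>2 \<le> C2 * C1" .
    qed
    then show "\<exists>r>0. \<exists>M. \<forall>y\<in>ball x r. cmod (polarised_kernel D y) \<le> M"
      using r1(1) r2(1) by (intro exI[of _ "min r1 r2"] conjI exI[of _ "sqrt (C2 * C1)"]) auto
  qed
qed

lemma polarised_kernel_partials:
  assumes "open D" "bounded D" "z \<in> D" "w \<in> D"
  shows "complex_partial (Inl i) (polarised_kernel D) (polarise z w) = complex_partial i (\<lambda>x. bergman_kernel D x w) z"
    and "complex_partial (Inr i) (polarised_kernel D) (polarise z w) = cnj (complex_partial i (\<lambda>x. bergman_kernel D x z) w)"
  using DERIV_imp_deriv[OF polarised_kernel_left_derivative[OF assms]]
    DERIV_imp_deriv[OF polarised_kernel_right_derivative[OF assms]]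
  by (simp_all add: complex_partial_def[of _ "polarised_kernel D"])

section \<open>Wirtinger derivatives along the diagonal\<close>

text \<open>Along the diagonal \<open>z \<mapsto> (z, cnj z)\<close> the operator \<open>\<partial>/\<partial>z\<^sub>k\<close> only sees the first group of variables and
  \<open>\<partial>/\<partial>cnj z\<^sub>k\<close> only the second: a real direction \<open>v\<close> contributes \<open>v\<close> to the first and \<open>cnj v\<close> to the second.\<close>

lemma wirtinger_polarise:
  fixes \<Phi> :: "complex ^ ('n::finite + 'n) \<Rightarrow> complex"
  assumes "holomorphic_fun_on \<Phi> E" "open U" "\<And>z. z \<in> U \<Longrightarrow> polarise z z \<in> E"
    and F: "\<And>z. z \<in> U \<Longrightarrow> F z = \<Phi> (polarise z z)" and "z \<in> U"
  shows "wirtinger k F z = complex_partial (Inl k) \<Phi> (polarise z z)"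
    and "wirtinger_bar k F z = complex_partial (Inr k) \<Phi> (polarise z z)"
proof -
  let ?d = "\<lambda>s. complex_partial s \<Phi> (polarise z z)"
  have "((\<lambda>z. \<Phi> (polarise z z)) has_derivative (\<lambda>h. \<Sum>s\<in>UNIV. ?d s * polarise h h $ s)) (at z)"
    by (rule has_derivative_compose[OF bounded_linear_imp_has_derivative[OF bounded_linear_polarise_diag]
        holomorphic_fun_on_has_derivative[OF assms(1) assms(3)[OF assms(5)]]])
  then have "(F has_derivative (\<lambda>h. \<Sum>s\<in>UNIV. ?d s * polarise h h $ s)) (at z)"
    by (rule has_derivative_transform_within_open[OF _ assms(2,5)]) (simp add: F)
  then have dF: "(F has_derivative (\<lambda>h. \<Sum>i\<in>UNIV. ?d (Inl i) * h $ i + ?d (Inr i) * cnj (h $ i))) (at z)"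
    by (simp add: sum_over_sum_type sum.distrib)
  have dir: "real_directional v F z = (\<Sum>i\<in>UNIV. ?d (Inl i) * v $ i + ?d (Inr i) * cnj (v $ i))" for v
  proof -
    have line: "((\<lambda>t. z + t *\<^sub>R v) has_derivative (\<lambda>t. t *\<^sub>R v)) (at 0)"
      by (auto intro!: derivative_eq_intros)
    have "(F has_derivative (\<lambda>h. \<Sum>i\<in>UNIV. ?d (Inl i) * h $ i + ?d (Inr i) * cnj (h $ i))) (at (z + 0 *\<^sub>R v))"
      using dF by simp
    from has_derivative_compose[OF line this]
    have "((\<lambda>t. F (z + t *\<^sub>R v)) has_derivative
        (\<lambda>t. \<Sum>i\<in>UNIV. ?d (Inl i) * (t *\<^sub>R v) $ i + ?d (Inr i) * cnj ((t *\<^sub>R v) $ i))) (at 0)" .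
    moreover have "(\<Sum>i\<in>UNIV. ?d (Inl i) * (t *\<^sub>R v) $ i + ?d (Inr i) * cnj ((t *\<^sub>R v) $ i)) =
       t *\<^sub>R (\<Sum>i\<in>UNIV. ?d (Inl i) * v $ i + ?d (Inr i) * cnj (v $ i))" for t
      by (simp add: scaleR_sum_right scaleR_add_right)
    ultimately have "((\<lambda>t. F (z + t *\<^sub>R v)) has_vector_derivative
        (\<Sum>i\<in>UNIV. ?d (Inl i) * v $ i + ?d (Inr i) * cnj (v $ i))) (at 0)"
      by (simp add: has_vector_derivative_def)
    then show ?thesis
      unfolding real_directional_def by (rule vector_derivative_at)
  qed
  have ax: "real_directional (axis k c) F z = ?d (Inl k) * c + ?d (Inr k) * cnj c" for c
  proof -
    have "real_directional (axis k c) F z = (\<Sum>i\<in>UNIV. if i = k then ?d (Inl i) * c + ?d (Inr i) * cnj c else 0)"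
      unfolding dir by (intro sum.cong) (auto simp: axis_def)
    then show ?thesis by simp
  qed
  show "wirtinger k F z = ?d (Inl k)" "wirtinger_bar k F z = ?d (Inr k)"
    by (simp_all add: wirtinger_def wirtinger_bar_def ax algebra_simps)
qed

definition polarised_log :: "(complex ^ 'n) set \<Rightarrow> complex ^ ('n + 'n) \<Rightarrow> complex" where
  "polarised_log D x = Ln (polarised_kernel D x)"

text \<open>A neighbourhood of the diagonal on which the principal branch of the logarithm applies.\<close>

definition polarised_log_domain :: "(complex ^ 'n) set \<Rightarrow> (complex ^ ('n + 'n)) set" where
  "polarised_log_domain D = {x \<in> polarised_domain D. Re (polarised_kernel D x) > 0}"

lemma open_polarised_log_domain:
  assumes "open D" "bounded D"
  shows "open (polarised_log_domain D)"
proof -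
  have "continuous_on (polarised_domain D) (\<lambda>x. Re (polarised_kernel D x))"
    by (intro continuous_intros holomorphic_fun_on_continuous polarised_kernel_holomorphic assms)
  from continuous_open_preimage[OF this open_polarised_domain[OF assms(1)] open_greaterThan[of 0]]
  show ?thesis
    by (simp add: polarised_log_domain_def vimage_def Int_def)
qed

lemma diagonal_in_log_domain:
  "open D \<Longrightarrow> bounded D \<Longrightarrow> z \<in> D \<Longrightarrow> polarise z z \<in> polarised_log_domain D"
  by (simp add: polarised_log_domain_def bergman_kernel_pos)

lemma polarised_kernel_holomorphic_log_domain:
  assumes "open D" "bounded D"
  shows "holomorphic_fun_on (polarised_kernel D) (polarised_log_domain D)"
    and "holomorphic_fun_on (complex_partial s (polarised_kernel D)) (polarised_log_domain D)"
proof -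
  have sub: "polarised_log_domain D \<subseteq> polarised_domain D"
    by (auto simp: polarised_log_domain_def)
  note hol = polarised_kernel_holomorphic[OF assms]
  show "holomorphic_fun_on (polarised_kernel D) (polarised_log_domain D)"
    by (rule holomorphic_fun_on_subset[OF hol sub])
  show "holomorphic_fun_on (complex_partial s (polarised_kernel D)) (polarised_log_domain D)"
    by (rule holomorphic_fun_on_subset[OF holomorphic_complex_partial[OF open_polarised_domain[OF assms(1)] hol] sub])
qed

lemma polarised_log_holomorphic:
  assumes "open D" "bounded D"
  shows "holomorphic_fun_on (polarised_log D) (polarised_log_domain D)"
    and "x \<in> polarised_log_domain D \<Longrightarrow>
      complex_partial s (polarised_log D) x = inverse (polarised_kernel D x) * complex_partial s (polarised_kernel D) x"
proof -
  have sub: "polarised_kernel D ` polarised_log_domain D \<subseteq> {z. Re z > 0}"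
    by (auto simp: polarised_log_domain_def)
  have op: "open {z. Re z > 0}" by (rule open_halfspace_Re_gt)
  have hol: "Ln holomorphic_on {z. Re z > 0}"
    by (rule holomorphic_on_Ln) (auto simp: complex_nonpos_Reals_iff)
  note c = holomorphic_fun_on_compose_outer[OF polarised_kernel_holomorphic_log_domain(1)[OF assms] sub hol op]
    complex_partial_compose_outer[OF polarised_kernel_holomorphic_log_domain(1)[OF assms] sub hol op]
  show "holomorphic_fun_on (polarised_log D) (polarised_log_domain D)"
    using c(1) by (simp add: polarised_log_def[abs_def])
  assume x: "x \<in> polarised_log_domain D"
  then have "polarised_kernel D x \<notin> \<real>\<^sub>\<le>\<^sub>0"
    by (auto simp: polarised_log_domain_def complex_nonpos_Reals_iff)
  then have "deriv Ln (polarised_kernel D x) = inverse (polarised_kernel D x)"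
    using has_field_derivative_Ln DERIV_imp_deriv by blast
  then show "complex_partial s (polarised_log D) x = inverse (polarised_kernel D x) * complex_partial s (polarised_kernel D) x"
    using c(2)[OF x] by (simp add: polarised_log_def[abs_def])
qed

lemma polarised_log_second_partial:
  assumes "open D" "bounded D" "x \<in> polarised_log_domain D"
  defines "G \<equiv> polarised_kernel D"
  shows "complex_partial s (complex_partial s' (polarised_log D)) x =
    complex_partial s (complex_partial s' G) x / G x - complex_partial s G x * complex_partial s' G x / (G x)\<^sup>2"
proof -
  let ?E = "polarised_log_domain D"
  note opn = open_polarised_log_domain[OF assms(1,2)]
  have sub: "G ` ?E \<subseteq> - {0}"
    by (auto simp: polarised_log_domain_def G_def)
  have hol: "inverse holomorphic_on - {0 :: complex}"
    by (intro holomorphic_on_inverse holomorphic_on_ident) auto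
  have op: "open (- {0 :: complex})" by auto
  note hG = polarised_kernel_holomorphic_log_domain[OF assms(1,2), folded G_def]
  have hI: "holomorphic_fun_on (\<lambda>x. inverse (G x)) ?E"
    and dI: "complex_partial s (\<lambda>x. inverse (G x)) x = deriv inverse (G x) * complex_partial s G x"
    using holomorphic_fun_on_compose_outer[OF hG(1) sub hol op] complex_partial_compose_outer[OF hG(1) sub hol op assms(3)]
    by auto
  have G0: "G x \<noteq> 0" using sub assms(3) by auto
  then have "(inverse has_field_derivative - (inverse (G x) ^ Suc (Suc 0))) (at (G x))"
    by (rule DERIV_inverse)
  then have di: "deriv inverse (G x) = - 1 / (G x)\<^sup>2"
    by (simp add: DERIV_imp_deriv power2_eq_square divide_inverse)
  have "complex_partial s (complex_partial s' (polarised_log D)) x =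
      complex_partial s (\<lambda>x. inverse (G x) * complex_partial s' G x) x"
    by (rule holomorphic_fun_on_transform(2)[OF holomorphic_fun_on_mult[OF hI hG(2)] opn _ assms(3)])
      (simp add: polarised_log_holomorphic(2)[OF assms(1,2)] G_def)
  also have "\<dots> = complex_partial s (\<lambda>x. inverse (G x)) x * complex_partial s' G x +
      inverse (G x) * complex_partial s (complex_partial s' G) x"
    by (rule complex_partial_mult[OF hI hG(2) assms(3)])
  finally have eq: "complex_partial s (complex_partial s' (polarised_log D)) x =
      complex_partial s (\<lambda>x. inverse (G x)) x * complex_partial s' G x +
      inverse (G x) * complex_partial s (complex_partial s' G) x" .
  show ?thesis
    unfolding eq dI di using G0 by (simp add: field_simps power2_eq_square)
qed

text \<open>The matrix of mixed second derivatives of \<open>log K(z,z)\<close>. As second partials of a holomorphic function of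
  \<open>(z, cnj z)\<close> its entries are visibly continuous.\<close>

definition bergman_coeff :: "(complex ^ 'n) set \<Rightarrow> 'n \<Rightarrow> 'n \<Rightarrow> complex ^ 'n \<Rightarrow> complex" where
  "bergman_coeff D j k z = complex_partial (Inl j) (complex_partial (Inr k) (polarised_log D)) (polarise z z)"

lemma bergman_form_coeff:
  assumes "open D" "bounded D" "z \<in> D"
  shows "bergman_form D z u v = (1/2) * (\<Sum>j\<in>UNIV. \<Sum>k\<in>UNIV. bergman_coeff D j k z * u $ j * cnj (v $ k))"
proof -
  let ?E = "polarised_log_domain D"
  let ?F = "\<lambda>w. complex_of_real (ln (Re (bergman_kernel D w w)))"
  note opn = open_polarised_log_domain[OF assms(1,2)]
  have mem: "\<And>w. w \<in> D \<Longrightarrow> polarise w w \<in> ?E"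
    using diagonal_in_log_domain assms by blast
  have F: "?F w = polarised_log D (polarise w w)" if "w \<in> D" for w
  proof -
    have "Ln (bergman_kernel D w w) = Ln (of_real (Re (bergman_kernel D w w)))"
      using bergman_kernel_real[OF assms(1,2) that] by simp
    also have "\<dots> = ?F w"
      by (rule Ln_of_real[OF bergman_kernel_pos[OF assms(1,2) that]])
    finally show ?thesis by (simp add: polarised_log_def)
  qed
  have bar: "wirtinger_bar k ?F w = complex_partial (Inr k) (polarised_log D) (polarise w w)" if "w \<in> D" for w k
    by (rule wirtinger_polarise(2)[OF polarised_log_holomorphic(1)[OF assms(1,2)] assms(1) mem F that])
  have "wirtinger j (wirtinger_bar k ?F) z = bergman_coeff D j k z" for j k
    unfolding bergman_coeff_def
    by (rule wirtinger_polarise(1)[OF holomorphic_complex_partial[OF opn polarised_log_holomorphic(1)[OF assms(1,2)]]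
         assms(1) mem bar assms(3)])
  then show ?thesis
    by (simp add: bergman_form_def)
qed

lemma continuous_bergman_coeff:
  assumes "open D" "bounded D"
  shows "continuous_on D (bergman_coeff D j k)"
proof -
  have "continuous_on (polarised_log_domain D) (complex_partial (Inl j) (complex_partial (Inr k) (polarised_log D)))"
    by (intro holomorphic_fun_on_continuous holomorphic_complex_partial open_polarised_log_domain assms
        polarised_log_holomorphic(1))
  moreover have "continuous_on D (\<lambda>z. polarise z z)"
    by (rule linear_continuous_on[OF bounded_linear_polarise_diag])
  moreover have "(\<lambda>z. polarise z z) ` D \<subseteq> polarised_log_domain D"
    using assms diagonal_in_log_domain by blast
  ultimately show ?thesis
    unfolding bergman_coeff_def[abs_def] by (rule continuous_on_compose2)
qed

section \<open>The Bergman metric as an extremal problem\<close>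

abbreviation dir_deriv :: "(complex ^ 'n \<Rightarrow> complex) \<Rightarrow> complex ^ 'n \<Rightarrow> complex ^ 'n \<Rightarrow> complex" where
  "dir_deriv f z u \<equiv> \<Sum>k\<in>UNIV. complex_partial k f z * u $ k"

text \<open>Cauchy estimates turn the locally uniform bound on values into a bound on derivatives.\<close>

lemma dir_deriv_bounded:
  assumes "open D" "w \<in> D"
  obtains C where "\<And>f. f \<in> bergman_space D \<Longrightarrow> (cmod (dir_deriv f w u))\<^sup>2 \<le> C * bergman_sq D f"
proof -
  obtain r C where r: "0 < r" "0 < C" "ball w r \<subseteq> D"
    and C: "\<And>f z. f \<in> bergman_space D \<Longrightarrow> z \<in> ball w r \<Longrightarrow> (cmod (f z))\<^sup>2 \<le> C * bergman_sq D f"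
    using bergman_locally_uniform_bound[OF assms] by metis
  define s where "s = (\<Sum>k\<in>UNIV. 4 / r * cmod (u $ k))"
  have "(cmod (dir_deriv f w u))\<^sup>2 \<le> (s\<^sup>2 * C) * bergman_sq D f" if f: "f \<in> bergman_space D" for f
  proof -
    define M where "M = sqrt (C * bergman_sq D f)"
    have M2: "M\<^sup>2 = C * bergman_sq D f"
      unfolding M_def using r(2) bergman_sq_nonneg[of D f] by auto
    have M: "cmod (f z) \<le> M" if "z \<in> ball w r" for z
      unfolding M_def by (rule real_le_rsqrt[OF C[OF f that]])
    have hol: "holomorphic_fun_on f D" using f by (simp add: bergman_space_def)
    have d: "cmod (complex_partial k f w) \<le> 4 * M / r" for k
      using separately_holomorphic_estimates(1)[OF holomorphic_fun_on_separately[OF hol] r(3,1) M, of w k] r(1) by simp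
    have "cmod (dir_deriv f w u) \<le> (\<Sum>k\<in>UNIV. 4 * M / r * cmod (u $ k))"
      by (intro sum_norm_le) (unfold norm_mult, rule mult_right_mono[OF d norm_ge_zero])
    also have "\<dots> = s * M"
      unfolding s_def sum_distrib_right by (intro sum.cong) (auto simp: field_simps)
    finally have "(cmod (dir_deriv f w u))\<^sup>2 \<le> (s * M)\<^sup>2"
      by (intro power_mono) auto
    then show ?thesis by (simp add: power_mult_distrib M2 mult.assoc)
  qed
  then show thesis by (rule that)
qed

text \<open>Evaluating the representer \<open>e\<close> of \<open>f \<mapsto> \<nabla>f(w) u\<close> against \<open>K(-,z)\<close> shows that
  \<open>e(z) = \<Sum>\<^sub>k \<partial>K/\<partial>cnj w\<^sub>k (z,w) cnj u\<^sub>k\<close>. Differentiating once more, and using \<open>\<parallel>e\<parallel>\<^sup>2 = \<nabla>e(w) u\<close>, expresses every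
  derivative of \<open>K\<close> that occurs in the Bergman form through \<open>e\<close>.\<close>

lemma dir_deriv_representer_eq:
  assumes D: "open D" "bounded D" and w: "w \<in> D" and e: "e \<in> bergman_space D"
    and rep: "\<And>f. f \<in> bergman_space D \<Longrightarrow> dir_deriv f w u = bergman_inner D f e"
  defines "G \<equiv> polarised_kernel D"
  shows "(\<Sum>k\<in>UNIV. complex_partial (Inr k) G (polarise w w) * cnj (u $ k)) = e w"
    and "(\<Sum>j\<in>UNIV. complex_partial (Inl j) G (polarise w w) * u $ j) = cnj (e w)"
    and "(\<Sum>j\<in>UNIV. \<Sum>k\<in>UNIV. complex_partial (Inl j) (complex_partial (Inr k) G) (polarise w w) * u $ j * cnj (u $ k)) =
      of_real (bergman_sq D e)"
proof -
  have ez: "e z = (\<Sum>k\<in>UNIV. complex_partial (Inr k) G (polarise z w) * cnj (u $ k))" if z: "z \<in> D" for z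
  proof -
    have "e z = bergman_inner D e (\<lambda>x. bergman_kernel D x z)"
      using bergman_kernel_reproducing[OF D z e] by simp
    also have "\<dots> = cnj (dir_deriv (\<lambda>x. bergman_kernel D x z) w u)"
      unfolding rep[OF bergman_kernel_mem[OF D z]] by (rule bergman_inner_cnj)
    finally show ?thesis
      by (simp add: G_def polarised_kernel_partials[OF D z w])
  qed
  show "(\<Sum>k\<in>UNIV. complex_partial (Inr k) G (polarise w w) * cnj (u $ k)) = e w"
    using ez[OF w] by simp
  have "cnj (e w) = dir_deriv (\<lambda>x. bergman_kernel D x w) w u"
    unfolding rep[OF bergman_kernel_mem[OF D w]] bergman_kernel_reproducing[OF D w e, symmetric]
    by (rule bergman_inner_cnj[symmetric])
  then show "(\<Sum>j\<in>UNIV. complex_partial (Inl j) G (polarise w w) * u $ j) = cnj (e w)"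
    by (simp add: G_def polarised_kernel_partials[OF D w w])
  have d: "complex_partial j e w =
      (\<Sum>k\<in>UNIV. complex_partial (Inl j) (complex_partial (Inr k) G) (polarise w w) * cnj (u $ k))" for j
  proof -
    have "((\<lambda>t. \<Sum>k\<in>UNIV. complex_partial (Inr k) G (polarise w w + t *s axis (Inl j) 1) * cnj (u $ k))
        has_field_derivative
        (\<Sum>k\<in>UNIV. complex_partial (Inl j) (complex_partial (Inr k) G) (polarise w w) * cnj (u $ k))) (at 0)"
      unfolding G_def
      by (intro DERIV_sum DERIV_cmult_right partial_has_field_derivative[OF holomorphic_complex_partial[OF
            open_polarised_domain[OF D(1)] polarised_kernel_holomorphic[OF D]]]) (simp add: w)
    then have "((\<lambda>t. e (w + t *s axis j 1)) has_field_derivative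
        (\<Sum>k\<in>UNIV. complex_partial (Inl j) (complex_partial (Inr k) G) (polarise w w) * cnj (u $ k))) (at 0)"
      by (rule has_field_derivative_transform_within_open[OF _ open_slice[OF D(1), of w j]])
        (use w in \<open>auto simp: ez polarise_add_left\<close>)
    then show ?thesis
      unfolding complex_partial_def[of j e] by (rule DERIV_imp_deriv)
  qed
  have "of_real (bergman_sq D e) = dir_deriv e w u"
    by (simp add: rep[OF e] bergman_inner_self)
  also have "\<dots> = (\<Sum>j\<in>UNIV. \<Sum>k\<in>UNIV. complex_partial (Inl j) (complex_partial (Inr k) G) (polarise w w) * u $ j * cnj (u $ k))"
    unfolding d sum_distrib_right by (intro sum.cong refl) (simp only: mult_ac)
  finally show "(\<Sum>j\<in>UNIV. \<Sum>k\<in>UNIV. complex_partial (Inl j) (complex_partial (Inr k) G) (polarise w w) * u $ j * cnj (u $ k)) =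
      of_real (bergman_sq D e)" by simp
qed

text \<open>With \<open>\<kappa> = K(w,w)\<close> the quotient rule for \<open>Ln G\<close> gives \<open>2 H\<^sub>w(u,u) = \<parallel>e\<parallel>\<^sup>2/\<kappa> - |e(w)|\<^sup>2/\<kappa>\<^sup>2\<close>, where \<open>e\<close> represents
  \<open>f \<mapsto> \<nabla>f(w) u\<close>. Since \<open>e(w)\<close> is the inner product of \<open>e\<close> with \<open>K(-,w)\<close> and \<open>\<kappa> = \<parallel>K(-,w)\<parallel>\<^sup>2\<close>, this is
  \<open>\<parallel>e'\<parallel>\<^sup>2/\<kappa>\<close> for the component \<open>e'\<close> of \<open>e\<close> orthogonal to \<open>K(-,w)\<close>. It vanishes at \<open>w\<close>, and represents the same
  functional as \<open>e\<close> on the functions that vanish at \<open>w\<close>.\<close>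

lemma bergman_length_extremal:
  assumes D: "open D" "bounded D" and w: "w \<in> D"
  obtains e where "e \<in> bergman_space D" "e w = 0" "bergman_length D w u \<ge> 0"
    "bergman_sq D e = 2 * Re (bergman_kernel D w w) * (bergman_length D w u)\<^sup>2"
    "\<And>f. f \<in> bergman_space D \<Longrightarrow> f w = 0 \<Longrightarrow> dir_deriv f w u = bergman_inner D f e"
proof -
  obtain C where C: "\<And>f. f \<in> bergman_space D \<Longrightarrow> (cmod (dir_deriv f w u))\<^sup>2 \<le> C * bergman_sq D f"
    using dir_deriv_bounded[OF D(1) w] by metis
  have add: "dir_deriv (\<lambda>z. f z + g z) w u = dir_deriv f w u + dir_deriv g w u"
    if "f \<in> bergman_space D" "g \<in> bergman_space D" for f g
    using that complex_partial_add[of f D g w] w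
    by (simp add: bergman_space_def distrib_right sum.distrib)
  have scale: "dir_deriv (\<lambda>z. c * f z) w u = c * dir_deriv f w u" if "f \<in> bergman_space D" for f c
    using that complex_partial_cmult[of f D w] w
    by (simp add: bergman_space_def sum_distrib_left mult.assoc)
  obtain e where e: "e \<in> bergman_space D"
    and rep: "\<And>f. f \<in> bergman_space D \<Longrightarrow> dir_deriv f w u = bergman_inner D f e"
    by (rule bergman_riesz[OF D, where L="\<lambda>f. dir_deriv f w u" and C=C])
      ((rule add; assumption) | (rule scale; assumption) | (rule C; assumption) | (rule that; blast))+
  define \<kappa> where "\<kappa> = Re (bergman_kernel D w w)"
  have \<kappa>: "\<kappa> > 0" "bergman_kernel D w w = of_real \<kappa>" "bergman_sq D (\<lambda>z. bergman_kernel D z w) = \<kappa>"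
    unfolding \<kappa>_def using bergman_kernel_pos[OF D w] bergman_kernel_real[OF D w] bergman_kernel_diag[OF D w] by auto
  let ?G = "polarised_kernel D" and ?p = "polarise w w"
  have eqs: "(\<Sum>k\<in>UNIV. complex_partial (Inr k) ?G ?p * cnj (u $ k)) = e w"
    "(\<Sum>j\<in>UNIV. complex_partial (Inl j) ?G ?p * u $ j) = cnj (e w)"
    "(\<Sum>j\<in>UNIV. \<Sum>k\<in>UNIV. complex_partial (Inl j) (complex_partial (Inr k) ?G) ?p * u $ j * cnj (u $ k)) =
      of_real (bergman_sq D e)"
    by (rule dir_deriv_representer_eq[OF D w e rep]; assumption)+
  note kw = bergman_kernel_mem[OF D w]
  have coeff: "bergman_coeff D j k w = complex_partial (Inl j) (complex_partial (Inr k) ?G) ?p / of_real \<kappa> -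
      complex_partial (Inl j) ?G ?p * complex_partial (Inr k) ?G ?p / (of_real \<kappa>)\<^sup>2" for j k
    using polarised_log_second_partial[OF D diagonal_in_log_domain[OF D w], of "Inl j" "Inr k"]
    by (simp add: bergman_coeff_def \<kappa>(2))
  have "(\<Sum>j\<in>UNIV. \<Sum>k\<in>UNIV. bergman_coeff D j k w * u $ j * cnj (u $ k)) =
      (\<Sum>j\<in>UNIV. \<Sum>k\<in>UNIV. complex_partial (Inl j) (complex_partial (Inr k) ?G) ?p * u $ j * cnj (u $ k)) / of_real \<kappa> -
      (\<Sum>j\<in>UNIV. complex_partial (Inl j) ?G ?p * u $ j) * (\<Sum>k\<in>UNIV. complex_partial (Inr k) ?G ?p * cnj (u $ k)) / (of_real \<kappa>)\<^sup>2"
    unfolding coeff sum_product sum_divide_distrib sum_subtractf[symmetric]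
    by (intro sum.cong refl) (simp add: algebra_simps)
  also have "\<dots> = of_real (bergman_sq D e) / of_real \<kappa> - cnj (e w) * e w / (of_real \<kappa>)\<^sup>2"
    unfolding eqs ..
  also have "cnj (e w) * e w = of_real ((cmod (e w))\<^sup>2)"
    by (subst complex_norm_square) (rule mult.commute)
  finally have form: "bergman_form D w u u = of_real ((bergman_sq D e / \<kappa> - (cmod (e w))\<^sup>2 / \<kappa>\<^sup>2) / 2)"
    unfolding bergman_form_coeff[OF D w] by simp
  define c where "c = - e w / of_real \<kappa>"
  \<comment> \<open>Subtracting the projection onto the line spanned by \<open>K(-,w)\<close>.\<close>
  define e' where "e' z = e z + c * bergman_kernel D z w" for z
  have e': "e' \<in> bergman_space D"
    unfolding e'_def by (intro bergman_space_add bergman_space_cmult D e kw)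
  have "bergman_sq D e' = bergman_sq D e + 2 * Re (cnj c * e w) + (cmod c)\<^sup>2 * \<kappa>"
    unfolding e'_def bergman_sq_add_cmult[OF D(1) e kw] bergman_kernel_reproducing[OF D w e] \<kappa>(3) ..
  also have "cnj c * e w = of_real (- (cmod (e w))\<^sup>2 / \<kappa>)"
  proof -
    have "cnj c * e w = - (e w * cnj (e w)) / of_real \<kappa>"
      by (simp add: c_def mult.commute)
    then show ?thesis
      unfolding complex_norm_square[symmetric] by simp
  qed
  also have "(cmod c)\<^sup>2 * \<kappa> = (cmod (e w))\<^sup>2 / \<kappa>"
    using \<kappa>(1) by (simp add: c_def norm_divide power_divide power2_eq_square)
  finally have sq: "bergman_sq D e' = bergman_sq D e - (cmod (e w))\<^sup>2 / \<kappa>"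
    by simp
  have form': "Re (bergman_form D w u u) = bergman_sq D e' / (2 * \<kappa>)"
    unfolding form sq Re_complex_of_real using \<kappa>(1) by (simp add: field_simps power2_eq_square)
  then have nonneg: "Re (bergman_form D w u u) \<ge> 0"
    using bergman_sq_nonneg[of D e'] \<kappa>(1) by simp
  show thesis
  proof (rule that[of e'])
    show "e' w = 0" using \<kappa> by (simp add: e'_def c_def)
    show "bergman_length D w u \<ge> 0"
      using nonneg by (simp add: bergman_length_def)
    show "bergman_sq D e' = 2 * Re (bergman_kernel D w w) * (bergman_length D w u)\<^sup>2"
      using nonneg form' \<kappa>(1) by (simp add: bergman_length_def \<kappa>_def[symmetric])
    show "dir_deriv f w u = bergman_inner D f e'" if f: "f \<in> bergman_space D" "f w = 0" for f
      unfolding e'_def bergman_inner_add_cmult_right[OF D(1) e kw f(1)] bergman_kernel_reproducing[OF D w f(1)] rep[OF f(1)] f(2)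
      by simp
  qed (rule e')
qed

lemma bergman_length_nonneg:
  assumes "open D" "bounded D" "w \<in> D"
  shows "bergman_length D w u \<ge> 0"
  by (rule bergman_length_extremal[OF assms])

lemma dir_deriv_le_bergman_length:
  assumes D: "open D" "bounded D" and w: "w \<in> D" and f: "f \<in> bergman_space D" "f w = 0"
  shows "(cmod (dir_deriv f w u))\<^sup>2 \<le> bergman_sq D f * (2 * Re (bergman_kernel D w w) * (bergman_length D w u)\<^sup>2)"
proof -
  obtain e where e: "e \<in> bergman_space D" "e w = 0" "bergman_length D w u \<ge> 0"
    "bergman_sq D e = 2 * Re (bergman_kernel D w w) * (bergman_length D w u)\<^sup>2"
    "\<And>f. f \<in> bergman_space D \<Longrightarrow> f w = 0 \<Longrightarrow> dir_deriv f w u = bergman_inner D f e"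
    by (rule bergman_length_extremal[OF D w, of u]) (rule that; blast)
  show ?thesis
    using bergman_cauchy_schwarz[OF D(1) f(1) e(1)] by (simp add: e(4) e(5)[OF f])
qed

text \<open>The test function \<open>F K(-,w)\<close> vanishes at \<open>w\<close>, has norm at most \<open>R \<parallel>K(-,w)\<parallel>\<close>, and its derivative at \<open>w\<close> is
  \<open>K(w,w)\<close> times that of \<open>F\<close>. The factors \<open>K(w,w) = \<parallel>K(-,w)\<parallel>\<^sup>2\<close> cancel.\<close>

lemma caratheodory_le_bergman:
  assumes D: "open D" "bounded D" and w: "w \<in> D"
    and F: "holomorphic_fun_on F D" "\<And>z. z \<in> D \<Longrightarrow> cmod (F z) \<le> R" "F w = 0"
  shows "(cmod (dir_deriv F w u))\<^sup>2 \<le> 2 * R\<^sup>2 * (bergman_length D w u)\<^sup>2"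
proof -
  define \<kappa> where "\<kappa> = Re (bergman_kernel D w w)"
  note kw = bergman_kernel_mem[OF D w]
  have \<kappa>: "\<kappa> > 0" "bergman_kernel D w w = of_real \<kappa>" "bergman_sq D (\<lambda>z. bergman_kernel D z w) = \<kappa>"
    unfolding \<kappa>_def using bergman_kernel_pos[OF D w] bergman_kernel_real[OF D w] bergman_kernel_diag[OF D w] by auto
  have m: "(\<lambda>z. F z * bergman_kernel D z w) \<in> bergman_space D"
    "bergman_sq D (\<lambda>z. F z * bergman_kernel D z w) \<le> R\<^sup>2 * bergman_sq D (\<lambda>z. bergman_kernel D z w)"
    by (rule bergman_space_mult_bounded[OF D(1) kw F(1,2)]; assumption)+
  have "dir_deriv (\<lambda>z. F z * bergman_kernel D z w) w u = of_real \<kappa> * dir_deriv F w u"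
  proof -
    have "holomorphic_fun_on (\<lambda>z. bergman_kernel D z w) D"
      using kw by (simp add: bergman_space_def)
    from complex_partial_mult[OF F(1) this w] show ?thesis
      by (simp add: F(3) \<kappa>(2) sum_distrib_left mult_ac)
  qed
  then have "\<kappa>\<^sup>2 * (cmod (dir_deriv F w u))\<^sup>2 \<le>
      bergman_sq D (\<lambda>z. F z * bergman_kernel D z w) * (2 * \<kappa> * (bergman_length D w u)\<^sup>2)"
    using dir_deriv_le_bergman_length[OF D w m(1), of u] F(3) by (simp add: norm_mult power_mult_distrib \<kappa>_def)
  also have "\<dots> \<le> (R\<^sup>2 * \<kappa>) * (2 * \<kappa> * (bergman_length D w u)\<^sup>2)"
    using m(2) \<kappa>(1,3) by (intro mult_right_mono) auto
  also have "\<dots> = \<kappa>\<^sup>2 * (2 * R\<^sup>2 * (bergman_length D w u)\<^sup>2)"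
    by (simp add: power2_eq_square)
  finally show ?thesis
    using \<kappa>(1) by simp
qed

text \<open>If \<open>u\<^sub>k \<noteq> 0\<close>, the function \<open>z\<^sub>k - w\<^sub>k\<close>, which is bounded on \<open>D\<close>, has derivative \<open>u\<^sub>k\<close> in direction \<open>u\<close>.\<close>

lemma bergman_length_pos:
  fixes D :: "(complex ^ 'n) set"
  assumes D: "open D" "bounded D" and w: "w \<in> D" and "u \<noteq> 0"
  shows "bergman_length D w u > 0"
proof -
  obtain k where k: "u $ k \<noteq> 0" using \<open>u \<noteq> 0\<close> by (auto simp: vec_eq_iff)
  obtain B where B: "\<And>z. z \<in> D \<Longrightarrow> norm z \<le> B" using D(2) by (auto simp: bounded_iff)
  define F where "F z = z $ k + (- (w $ k))" for z
  have hol: "holomorphic_fun_on F D"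
    unfolding F_def by (intro holomorphic_fun_on_add holomorphic_fun_on_coord holomorphic_fun_on_const)
  have "cmod (F z) \<le> 2 * B" if "z \<in> D" for z
    using norm_triangle_ineq4[of "z $ k" "w $ k"] B[OF that] B[OF w]
      Finite_Cartesian_Product.norm_nth_le[of z k] Finite_Cartesian_Product.norm_nth_le[of w k]
    unfolding F_def by simp
  then have le: "(cmod (dir_deriv F w u))\<^sup>2 \<le> 2 * (2 * B)\<^sup>2 * (bergman_length D w u)\<^sup>2"
    by (rule caratheodory_le_bergman[OF D w hol]) (simp_all add: F_def)
  have "complex_partial j F w = (if j = k then 1 else 0)" for j
    unfolding F_def complex_partial_add[OF holomorphic_fun_on_coord holomorphic_fun_on_const w]
    by (simp add: complex_partial_coord complex_partial_const)
  then have "dir_deriv F w u = u $ k"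
    by (simp add: if_distrib[of "\<lambda>x. x * _"] cong: if_cong)
  then have "bergman_length D w u \<noteq> 0"
    using le k by auto
  then show ?thesis
    using bergman_length_nonneg[OF D w, of u] by simp
qed

lemma bergman_length_formula:
  assumes "open D" "bounded D" "z \<in> D"
  shows "bergman_length D z u =
    sqrt (Re ((1/2) * (\<Sum>j\<in>UNIV. \<Sum>k\<in>UNIV. bergman_coeff D j k z * u $ j * cnj (u $ k))))"
  unfolding bergman_length_def bergman_form_coeff[OF assms] ..

lemma bergman_length_zero:
  assumes "open D" "bounded D" "z \<in> D"
  shows "bergman_length D z 0 = 0"
  by (simp add: bergman_length_formula[OF assms])

lemma bergman_length_le_norm:
  assumes D: "open D" "bounded D" and z: "z \<in> D"
  obtains C where "C \<ge> 0" "\<And>u. bergman_length D z u \<le> C * norm u"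
proof -
  define S where "S = (\<Sum>j\<in>UNIV. \<Sum>k\<in>UNIV. cmod (bergman_coeff D j k z))"
  have S: "S \<ge> 0" unfolding S_def by (intro sum_nonneg) simp
  have "bergman_length D z u \<le> sqrt (S / 2) * norm u" for u
  proof -
    have "Re ((1/2) * (\<Sum>j\<in>UNIV. \<Sum>k\<in>UNIV. bergman_coeff D j k z * u $ j * cnj (u $ k)))
      \<le> cmod ((1/2) * (\<Sum>j\<in>UNIV. \<Sum>k\<in>UNIV. bergman_coeff D j k z * u $ j * cnj (u $ k)))"
      by (rule complex_Re_le_cmod)
    also have "\<dots> = (1/2) * cmod (\<Sum>j\<in>UNIV. \<Sum>k\<in>UNIV. bergman_coeff D j k z * u $ j * cnj (u $ k))"
      by (simp add: norm_divide)
    also have "cmod (\<Sum>j\<in>UNIV. \<Sum>k\<in>UNIV. bergman_coeff D j k z * u $ j * cnj (u $ k)) \<le>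
        (\<Sum>j\<in>UNIV. \<Sum>k\<in>UNIV. cmod (bergman_coeff D j k z) * (norm u * norm u))"
      unfolding norm_mult mult.assoc complex_mod_cnj
      by (intro sum_norm_le) (auto simp: norm_mult intro!: mult_left_mono mult_mono Finite_Cartesian_Product.norm_nth_le)
    also have "\<dots> = S * (norm u)\<^sup>2"
      by (simp add: S_def sum_distrib_right power2_eq_square)
    finally have "bergman_length D z u \<le> sqrt (S / 2 * (norm u)\<^sup>2)"
      unfolding bergman_length_formula[OF D z] by (intro real_sqrt_le_mono) simp
    then show ?thesis by (simp only: real_sqrt_mult real_sqrt_abs abs_norm_cancel)
  qed
  then show thesis using that[of "sqrt (S / 2)"] S by simp
qed

lemma continuous_bergman_length:
  assumes D: "open D" "bounded D" and "continuous_on T \<gamma>" "continuous_on T v" "\<gamma> ` T \<subseteq> D"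
  shows "continuous_on T (\<lambda>t. bergman_length D (\<gamma> t) (v t))"
proof -
  have "continuous_on T (\<lambda>t. bergman_coeff D j k (\<gamma> t))" for j k
    by (rule continuous_on_compose2[OF continuous_bergman_coeff[OF D] assms(3,5)])
  then have "continuous_on T (\<lambda>t. sqrt (Re ((1/2) *
      (\<Sum>j\<in>UNIV. \<Sum>k\<in>UNIV. bergman_coeff D j k (\<gamma> t) * v t $ j * cnj (v t $ k)))))"
    using assms(4) by (intro continuous_intros)
  then show ?thesis
    by (rule continuous_on_eq) (use assms(5) in \<open>auto simp: bergman_length_formula[OF D]\<close>)
qed

section \<open>Automorphisms and the Bergman constant\<close>

lemma holomorphic_det_jacobian:
  fixes g :: "complex ^ 'n \<Rightarrow> complex ^ 'n"
  assumes "open D" "holomorphic_map_on g D"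
  shows "holomorphic_fun_on (\<lambda>z. det (complex_jacobian g z)) D"
proof -
  have "holomorphic_fun_on (\<lambda>z. complex_jacobian g z $ i $ j) D" for i j
    using holomorphic_complex_partial[OF assms(1), of "\<lambda>w. g w $ i" j] assms(2)
    by (simp add: complex_jacobian_def holomorphic_map_on_def)
  then show ?thesis
    unfolding det_def by (intro holomorphic_fun_on_sum holomorphic_fun_on_mult holomorphic_fun_on_const holomorphic_fun_on_prod)
qed

lemma bergman_pullback:
  fixes g h :: "complex ^ 'n \<Rightarrow> complex ^ 'n"
  assumes D: "open D" and g: "holomorphic_map_on g D" "g ` D \<subseteq> D" and h: "holomorphic_map_on h D" "h ` D \<subseteq> D"
    and hg: "\<And>z. z \<in> D \<Longrightarrow> h (g z) = z" and gh: "\<And>z. z \<in> D \<Longrightarrow> g (h z) = z"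
    and f: "f \<in> bergman_space D"
  shows "(\<lambda>z. det (complex_jacobian g z) * f (g z)) \<in> bergman_space D"
    and "bergman_sq D (\<lambda>z. det (complex_jacobian g z) * f (g z)) = bergman_sq D f"
proof -
  note hJ = holomorphic_det_jacobian[OF D g(1)]
  have hf: "holomorphic_fun_on f D" using f by (simp add: bergman_space_def)
  have hol: "holomorphic_fun_on (\<lambda>z. det (complex_jacobian g z) * f (g z)) D"
    by (intro holomorphic_fun_on_mult hJ holomorphic_fun_on_compose[OF hf g])
  have cJ: "continuous_on D (\<lambda>z. (cmod (det (complex_jacobian g z)))\<^sup>2)"
    by (intro continuous_intros holomorphic_fun_on_continuous hJ)
  have cf: "continuous_on D (\<lambda>z. (cmod (f z))\<^sup>2)"
    by (intro continuous_intros holomorphic_fun_on_continuous hf)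
  have int: "set_integrable lborel D (\<lambda>z. (cmod (f z))\<^sup>2)" using f by (simp add: bergman_space_def)
  note cv = biholomorphic_change_of_variables[OF D D g h hg gh cJ cf int]
  show "(\<lambda>z. det (complex_jacobian g z) * f (g z)) \<in> bergman_space D"
    using cv(1) hol by (simp add: bergman_space_def norm_mult power_mult_distrib)
  show "bergman_sq D (\<lambda>z. det (complex_jacobian g z) * f (g z)) = bergman_sq D f"
    using cv(2) by (simp add: bergman_sq_def norm_mult power_mult_distrib)
qed

text \<open>Let \<open>q = h(p)\<close> and let \<open>e\<close> be the extremal function for \<open>(p,v)\<close>. Its pullback under \<open>g\<close> is a competitor at
  \<open>(q,u)\<close> with the same norm, which gives \<open>|det Jg(q)|\<^sup>2 K(p,p) H\<^sub>p(v,v) \<le> K(q,q) H\<^sub>q(u,u)\<close>. Pulling back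
  \<open>K(-,q)\<close> under \<open>h\<close> gives \<open>K(q,q) \<le> |det Jg(q)|\<^sup>2 K(p,p)\<close>. Only one inequality between the lengths is
  recorded; the other is the same statement for \<open>g\<close>.\<close>

theorem bergman_length_automorphism:
  fixes g h :: "complex ^ 'n \<Rightarrow> complex ^ 'n"
  assumes D: "open D" "bounded D"
    and g: "holomorphic_map_on g D" "g ` D \<subseteq> D" and h: "holomorphic_map_on h D" "h ` D \<subseteq> D"
    and hg: "\<And>z. z \<in> D \<Longrightarrow> h (g z) = z" and gh: "\<And>z. z \<in> D \<Longrightarrow> g (h z) = z"
    and p: "p \<in> D"
  shows "bergman_length D p v \<le> bergman_length D (h p) (complex_jacobian h p *v v)"
proof -
  define q where "q = h p"
  define u where "u = complex_jacobian h p *v v"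
  have q: "q \<in> D" "g q = p" using h(2) p gh by (auto simp: q_def)
  have JJ: "complex_jacobian g q ** complex_jacobian h p = mat 1"
    unfolding q_def by (rule complex_jacobian_inverse[OF D(1) h(1) g(1) h(2) gh p])
  define a where "a = cmod (det (complex_jacobian g q))"
  define b where "b = cmod (det (complex_jacobian h p))"
  have ab: "a * b = 1"
    using arg_cong[OF JJ, of "\<lambda>A. cmod (det A)"] by (simp add: det_mul norm_mult a_def b_def)
  define kp where "kp = Re (bergman_kernel D p p)"
  define kq where "kq = Re (bergman_kernel D q q)"
  have k: "kp > 0" "kq > 0" "cmod (bergman_kernel D q q) = kq"
    using bergman_kernel_pos[OF D p] bergman_kernel_pos[OF D q(1)] bergman_kernel_real[OF D q(1)]
    by (auto simp: kp_def kq_def) (metis abs_of_pos norm_of_real)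
  have kq_le: "kq \<le> a\<^sup>2 * kp"
  proof -
    note kqm = bergman_kernel_mem[OF D q(1)]
    have pb: "(\<lambda>z. det (complex_jacobian h z) * bergman_kernel D (h z) q) \<in> bergman_space D"
      "bergman_sq D (\<lambda>z. det (complex_jacobian h z) * bergman_kernel D (h z) q) = bergman_sq D (\<lambda>z. bergman_kernel D z q)"
      by (rule bergman_pullback[OF D(1) h g gh hg kqm]; assumption)+
    have "(b * kq)\<^sup>2 \<le> kq * kp"
      using bergman_point_bound[OF D p pb(1)] pb(2) bergman_kernel_diag[OF D q(1)] k(3)
      by (simp add: norm_mult b_def kp_def q_def[symmetric]) (simp add: kq_def)
    then have "b\<^sup>2 * kq \<le> kp"
      using k(2) by (simp add: power2_eq_square mult_ac)
    then have "a\<^sup>2 * (b\<^sup>2 * kq) \<le> a\<^sup>2 * kp"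
      by (intro mult_left_mono) auto
    then show ?thesis
      using ab by (simp add: mult.assoc[symmetric] power_mult_distrib[symmetric])
  qed
  obtain e where e: "e \<in> bergman_space D" "e p = 0" "bergman_length D p v \<ge> 0"
    "bergman_sq D e = 2 * kp * (bergman_length D p v)\<^sup>2"
    "\<And>f. f \<in> bergman_space D \<Longrightarrow> f p = 0 \<Longrightarrow> dir_deriv f p v = bergman_inner D f e"
    by (rule bergman_length_extremal[OF D p, of v, folded kp_def]) (rule that; blast)
  define x where "x = 2 * kp * (bergman_length D p v)\<^sup>2"
  define y where "y = 2 * kq * (bergman_length D q u)\<^sup>2"
  have e_der: "dir_deriv e p v = of_real x"
    using e(5)[OF e(1,2)] e(4) by (simp add: bergman_inner_self x_def)
  have pb: "(\<lambda>z. det (complex_jacobian g z) * e (g z)) \<in> bergman_space D"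
    "bergman_sq D (\<lambda>z. det (complex_jacobian g z) * e (g z)) = bergman_sq D e"
    by (rule bergman_pullback[OF D(1) g h hg gh e(1)]; assumption)+
  have he: "holomorphic_fun_on e D" using e(1) by (simp add: bergman_space_def)
  have "dir_deriv (\<lambda>z. det (complex_jacobian g z) * e (g z)) q u =
     det (complex_jacobian g q) * dir_deriv (\<lambda>z. e (g z)) q u"
    using complex_partial_mult[OF holomorphic_det_jacobian[OF D(1) g(1)] holomorphic_fun_on_compose[OF he g] q(1)] q(2) e(2)
    by (simp add: sum_distrib_left mult.assoc)
  also have "dir_deriv (\<lambda>z. e (g z)) q u = dir_deriv e p v"
  proof -
    have "complex_jacobian g q *v u = v"
      by (simp add: u_def matrix_vector_mul_assoc JJ)
    then show ?thesis
      using complex_directional_compose[OF he g q(1), of u] q(2) by simp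
  qed
  finally have der: "cmod (dir_deriv (\<lambda>z. det (complex_jacobian g z) * e (g z)) q u) = a * \<bar>x\<bar>"
    by (simp add: e_der norm_mult a_def)
  have "(a * \<bar>x\<bar>)\<^sup>2 \<le> x * y"
    using dir_deriv_le_bergman_length[OF D q(1) pb(1), of u] q(2) e(2,4)
    by (simp only: der pb(2)) (simp add: x_def y_def kq_def)
  then have "x * (a\<^sup>2 * x) \<le> x * y"
    by (simp add: power2_eq_square mult_ac)
  moreover have "x \<ge> 0" using k(1) by (simp add: x_def)
  moreover have "y \<ge> 0" using k(2) by (simp add: y_def)
  ultimately have "a\<^sup>2 * x \<le> y"
    by (cases "x = 0") (auto simp: mult_le_cancel_left)
  then have "a\<^sup>2 * kp * (bergman_length D p v)\<^sup>2 \<le> kq * (bergman_length D q u)\<^sup>2"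
    by (simp add: x_def y_def mult_ac)
  moreover have "kq * (bergman_length D p v)\<^sup>2 \<le> a\<^sup>2 * kp * (bergman_length D p v)\<^sup>2"
    using kq_le by (intro mult_right_mono) auto
  ultimately have "kq * (bergman_length D p v)\<^sup>2 \<le> kq * (bergman_length D q u)\<^sup>2"
    by linarith
  then have "(bergman_length D p v)\<^sup>2 \<le> (bergman_length D q u)\<^sup>2"
    using k(2) by simp
  then show ?thesis
    unfolding q_def[symmetric] u_def[symmetric]
    by (rule power2_le_imp_le) (rule bergman_length_nonneg[OF D q(1)])
qed

text \<open>Only the image point is moved by an automorphism. At the point \<open>z\<close> itself the Caratheodory estimate is
  already uniform, since it involves nothing but a bound for the size of \<open>D\<close>.\<close>

theorem bergman_length_holomorphic_map_bound:
  fixes D :: "(complex ^ 'n) set" and \<phi> :: "complex ^ 'n \<Rightarrow> complex ^ 'n"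
  assumes hom: "bounded_homogeneous_domain D" and \<phi>: "holomorphic_map_on \<phi> D" "\<phi> ` D \<subseteq> D"
  obtains C where "C \<ge> 0"
    "\<And>z u. z \<in> D \<Longrightarrow> bergman_length D (\<phi> z) (complex_jacobian \<phi> z *v u) \<le> C * bergman_length D z u"
proof -
  have D: "open D" "bounded D" "D \<noteq> {}"
    and trans: "\<And>z w. z \<in> D \<Longrightarrow> w \<in> D \<Longrightarrow> \<exists>g\<in>holomorphic_automorphisms D. g z = w"
    using hom by (auto simp: bounded_homogeneous_domain_def)
  obtain a where a: "a \<in> D" using D(3) by blast
  obtain C where C: "C \<ge> 0" "\<And>u. bergman_length D a u \<le> C * norm u"
    by (rule bergman_length_le_norm[OF D(1,2) a]) (rule that; blast)
  obtain B where B: "\<And>z. z \<in> D \<Longrightarrow> norm z \<le> B" using D(2) by (auto simp: bounded_iff)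
  have "B \<ge> 0" using B[OF a] norm_ge_zero order_trans by blast
  define C' where "C' = C * (CARD('n) * (sqrt 2 * (2 * B)))"
  have "bergman_length D (\<phi> z) (complex_jacobian \<phi> z *v u) \<le> C' * bergman_length D z u" if z: "z \<in> D" for z u
  proof -
    have \<phi>z: "\<phi> z \<in> D" using \<phi>(2) z by auto
    obtain h where "h \<in> holomorphic_automorphisms D" and ha: "h (\<phi> z) = a"
      using trans[OF \<phi>z a] by blast
    then have bij: "bij_betw h D D" and h: "holomorphic_map_on h D" and g: "holomorphic_map_on (inv_into D h) D"
      by (auto simp: holomorphic_automorphisms_def)
    have hD: "h ` D \<subseteq> D" and gD: "inv_into D h ` D \<subseteq> D"
      using bij bij_betw_inv_into[OF bij] by (auto simp: bij_betw_def)
    define v where "v = complex_jacobian \<phi> z *v u"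
    define y where "y = complex_jacobian h (\<phi> z) *v v"
    have "bergman_length D (\<phi> z) v \<le> bergman_length D (h (\<phi> z)) y"
      unfolding y_def
      by (rule bergman_length_automorphism[OF D(1,2) g gD h hD _ _ \<phi>z])
        (use bij in \<open>auto simp: bij_betw_inv_into_left bij_betw_inv_into_right\<close>)
    also have "\<dots> \<le> C * norm y" using C(2) by (simp add: ha)
    also have "norm y \<le> CARD('n) * (sqrt 2 * (2 * B)) * bergman_length D z u"
    proof -
      have "cmod (y $ j) \<le> sqrt 2 * (2 * B) * bergman_length D z u" for j
      proof -
        define F where "F x = h (\<phi> x) $ j + (- (a $ j))" for x
        have hj: "holomorphic_fun_on (\<lambda>x. h x $ j) D"
          using h by (simp add: holomorphic_map_on_def)
        have hol1: "holomorphic_fun_on (\<lambda>x. h (\<phi> x) $ j) D"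
          by (rule holomorphic_fun_on_compose[OF hj \<phi>])
        have hol: "holomorphic_fun_on F D"
          unfolding F_def by (intro holomorphic_fun_on_add hol1 holomorphic_fun_on_const)
        have "cmod (F x) \<le> 2 * B" if "x \<in> D" for x
        proof -
          have "h (\<phi> x) \<in> D" using that \<phi>(2) hD by auto
          from B[OF this] B[OF a] show ?thesis
            using norm_triangle_ineq4[of "h (\<phi> x) $ j" "a $ j"]
              Finite_Cartesian_Product.norm_nth_le[of "h (\<phi> x)" j] Finite_Cartesian_Product.norm_nth_le[of a j]
            unfolding F_def by simp
        qed
        then have le: "(cmod (dir_deriv F z u))\<^sup>2 \<le> 2 * (2 * B)\<^sup>2 * (bergman_length D z u)\<^sup>2"
          by (rule caratheodory_le_bergman[OF D(1,2) z hol]) (simp_all add: F_def ha)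
        have "dir_deriv F z u = dir_deriv (\<lambda>x. h (\<phi> x) $ j) z u"
          unfolding F_def complex_partial_add[OF hol1 holomorphic_fun_on_const z] by (simp add: complex_partial_const)
        also have "\<dots> = dir_deriv (\<lambda>x. h x $ j) (\<phi> z) v"
          unfolding v_def by (rule complex_directional_compose[OF hj \<phi> z])
        also have "\<dots> = y $ j"
          by (simp add: y_def matrix_vector_mult_def complex_jacobian_def)
        finally have "(cmod (y $ j))\<^sup>2 \<le> (sqrt 2 * (2 * B) * bergman_length D z u)\<^sup>2"
          using le by (simp add: power_mult_distrib)
        then show ?thesis
          by (rule power2_le_imp_le)
            (use \<open>B \<ge> 0\<close> bergman_length_nonneg[OF D(1,2) z, of u] in simp)
      qed
      then have "(\<Sum>j\<in>UNIV. cmod (y $ j)) \<le> (\<Sum>j\<in>(UNIV :: 'n set). sqrt 2 * (2 * B) * bergman_length D z u)"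
        by (intro sum_mono)
      then show ?thesis
        using norm_vec_le_sum_norm[of y] by simp
    qed
    then have "C * norm y \<le> C' * bergman_length D z u"
      unfolding C'_def mult.assoc[of C] using C(1) by (intro mult_left_mono)
    finally show ?thesis by (simp add: v_def)
  qed
  then show thesis
    using that[of C'] C(1) \<open>B \<ge> 0\<close> by (simp add: C'_def)
qed

section \<open>Bloch functions along curves\<close>

text \<open>The derivative \<open>d 1\<close> of the smooth piece is continuous up to the end points, where it may differ from the
  derivative of the whole curve relative to \<open>{0..1}\<close>. Two points do not affect the integral.\<close>

lemma smooth_piece:
  fixes \<gamma> :: "real \<Rightarrow> complex ^ 'n"
  assumes D: "open D" "bounded D" and f: "holomorphic_fun_on f D"
    and \<beta>: "\<And>z u. z \<in> D \<Longrightarrow> cmod (dir_deriv f z u) \<le> \<beta> * bergman_length D z u"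
    and ab: "0 \<le> a" "a < b" "b \<le> 1" and sm: "smooth_on_interval \<gamma> a b"
    and im: "\<gamma> ` {a..b} \<subseteq> D"
  defines "l \<equiv> \<lambda>t. bergman_length D (\<gamma> t) (vector_derivative \<gamma> (at t within {0..1}))"
  shows "l integrable_on {a..b}" and "cmod (f (\<gamma> b) - f (\<gamma> a)) \<le> \<beta> * integral {a..b} l"
proof -
  obtain d where d: "d 0 = \<gamma>"
    "\<And>m t. t \<in> {a..b} \<Longrightarrow> (d m has_vector_derivative d (Suc m) t) (at t within {a..b})"
    using sm unfolding smooth_on_interval_def by blast
  have dv: "(\<gamma> has_vector_derivative d 1 t) (at t within {a..b})" if "t \<in> {a..b}" for t
    using d(2)[OF that, of 0] d(1) by simp
  define l' where "l' t = bergman_length D (\<gamma> t) (d 1 t)" for t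
  have cont: "continuous_on {a..b} l'"
    unfolding l'_def
  proof (rule continuous_bergman_length[OF D _ _ im])
    show "continuous_on {a..b} \<gamma>"
      using dv by (rule continuous_on_vector_derivative)
    show "continuous_on {a..b} (d 1)"
      using d(2)[of _ 1] by (rule continuous_on_vector_derivative)
  qed
  have l': "l' integrable_on {a..b}"
    by (rule integrable_continuous_real[OF cont])
  have eq: "l t = l' t" if t: "t \<in> {a..b} - {a, b}" for t
  proof -
    have t': "t \<in> {a<..<b}" "t \<in> {a..b}" using t by auto
    have at1: "at t within {a..b} = at t"
      by (rule at_within_interior) (use t' in \<open>simp add: interior_atLeastAtMost_real\<close>)
    have at2: "at t within {0..1} = at t"
      by (rule at_within_interior) (use t' ab in \<open>simp add: interior_atLeastAtMost_real\<close>)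
    have "vector_derivative \<gamma> (at t within {0..1}) = d 1 t"
      unfolding at2 using dv[OF t'(2)] unfolding at1 by (rule vector_derivative_at)
    then show ?thesis by (simp add: l_def l'_def)
  qed
  show int: "l integrable_on {a..b}"
    by (rule integrable_spike_finite[where S="{a, b}", OF _ eq l']) simp
  have int_eq: "integral {a..b} l = integral {a..b} l'"
    by (rule integral_spike[of "{a, b}"]) (use eq in auto)
  have "((\<lambda>t. dir_deriv f (\<gamma> t) (d 1 t)) has_integral (f (\<gamma> b) - f (\<gamma> a))) {a..b}"
  proof (rule fundamental_theorem_of_calculus)
    fix t assume t: "t \<in> {a..b}"
    have "(\<gamma> has_derivative (\<lambda>s. s *\<^sub>R d 1 t)) (at t within {a..b})"
      using dv[OF t] by (simp add: has_vector_derivative_def)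
    moreover have "(f has_derivative (\<lambda>h. \<Sum>k\<in>UNIV. complex_partial k f (\<gamma> t) * h $ k)) (at (\<gamma> t))"
      by (rule holomorphic_fun_on_has_derivative[OF f]) (use im t in auto)
    ultimately have "((\<lambda>t. f (\<gamma> t)) has_derivative (\<lambda>s. \<Sum>k\<in>UNIV. complex_partial k f (\<gamma> t) * (s *\<^sub>R d 1 t) $ k))
        (at t within {a..b})"
      by (rule has_derivative_compose)
    moreover have "(\<Sum>k\<in>UNIV. complex_partial k f (\<gamma> t) * (s *\<^sub>R d 1 t) $ k) = s *\<^sub>R dir_deriv f (\<gamma> t) (d 1 t)" for s
      by (simp add: scaleR_sum_right)
    ultimately show "((\<lambda>t. f (\<gamma> t)) has_vector_derivative dir_deriv f (\<gamma> t) (d 1 t)) (at t within {a..b})"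
      by (simp add: has_vector_derivative_def)
  qed (use ab in simp)
  note ftc = this
  have "cmod (integral {a..b} (\<lambda>t. dir_deriv f (\<gamma> t) (d 1 t))) \<le> integral {a..b} (\<lambda>t. \<beta> * l' t)"
  proof (rule integral_norm_bound_integral)
    show "(\<lambda>t. dir_deriv f (\<gamma> t) (d 1 t)) integrable_on {a..b}" using ftc by blast
    show "(\<lambda>t. \<beta> * l' t) integrable_on {a..b}" by (intro integrable_on_mult_right l')
    show "cmod (dir_deriv f (\<gamma> t) (d 1 t)) \<le> \<beta> * l' t" if "t \<in> {a..b}" for t
      unfolding l'_def by (rule \<beta>) (use im that in auto)
  qed
  then show "cmod (f (\<gamma> b) - f (\<gamma> a)) \<le> \<beta> * integral {a..b} l"
    unfolding integral_unique[OF ftc] int_eq by simp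
qed

lemma piecewise_smooth_length_bound:
  fixes \<gamma> :: "real \<Rightarrow> complex ^ 'n"
  assumes D: "open D" "bounded D" and f: "holomorphic_fun_on f D"
    and \<beta>: "\<And>z u. z \<in> D \<Longrightarrow> cmod (dir_deriv f z u) \<le> \<beta> * bergman_length D z u"
    and ps: "piecewise_smooth_path \<gamma>" and im: "path_image \<gamma> \<subseteq> D"
  shows "cmod (f (pathfinish \<gamma>) - f (pathstart \<gamma>)) \<le>
    \<beta> * integral {0..1} (\<lambda>t. bergman_length D (\<gamma> t) (vector_derivative \<gamma> (at t within {0..1})))"
proof -
  define l where "l t = bergman_length D (\<gamma> t) (vector_derivative \<gamma> (at t within {0..1}))" for t
  obtain N s where s: "s 0 = 0" "s N = (1::real)"
    and piece: "\<And>i. i < N \<Longrightarrow> s i < s (Suc i) \<and> smooth_on_interval \<gamma> (s i) (s (Suc i))"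
    using ps unfolding piecewise_smooth_path_def by blast
  have mono: "s i \<le> s j" if "i \<le> j" "j \<le> N" for i j
    using that
  proof (induction j rule: dec_induct)
    case (step n)
    then show ?case using piece[of n] by simp
  qed simp
  have "l integrable_on {0..s i} \<and> cmod (f (\<gamma> (s i)) - f (\<gamma> 0)) \<le> \<beta> * integral {0..s i} l" if "i \<le> N" for i
    using that
  proof (induction i)
    case 0
    have "l integrable_on {0}"
      using has_integral_refl(2)[of l 0] by blast
    then show ?case by (simp add: s(1))
  next
    case (Suc i)
    have ab: "0 \<le> s i" "s i < s (Suc i)" "s (Suc i) \<le> 1"
      using mono[of 0 i] mono[of "Suc i" N] piece[of i] Suc.prems s by auto
    have sm: "smooth_on_interval \<gamma> (s i) (s (Suc i))" using piece[of i] Suc.prems by simp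
    have imi: "\<gamma> ` {s i..s (Suc i)} \<subseteq> D"
      using im ab unfolding path_image_def by force
    have p: "l integrable_on {s i..s (Suc i)}"
        "cmod (f (\<gamma> (s (Suc i))) - f (\<gamma> (s i))) \<le> \<beta> * integral {s i..s (Suc i)} l"
      unfolding l_def by (rule smooth_piece[OF D f \<beta> ab sm imi]; assumption)+
    have IH: "l integrable_on {0..s i}" "cmod (f (\<gamma> (s i)) - f (\<gamma> 0)) \<le> \<beta> * integral {0..s i} l"
      using Suc by auto
    have int: "l integrable_on {0..s (Suc i)}"
      by (rule Henstock_Kurzweil_Integration.integrable_combine[OF _ _ IH(1) p(1)]) (use ab in auto)
    have "cmod (f (\<gamma> (s (Suc i))) - f (\<gamma> 0)) \<le>
        cmod (f (\<gamma> (s (Suc i))) - f (\<gamma> (s i))) + cmod (f (\<gamma> (s i)) - f (\<gamma> 0))"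
      by (rule norm_triangle_sub[of "f (\<gamma> (s (Suc i))) - f (\<gamma> 0)" "f (\<gamma> (s i)) - f (\<gamma> 0)", simplified, THEN order_trans]) simp
    also have "\<dots> \<le> \<beta> * (integral {0..s i} l + integral {s i..s (Suc i)} l)"
      using IH(2) p(2) by (simp add: distrib_left)
    also have "integral {0..s i} l + integral {s i..s (Suc i)} l = integral {0..s (Suc i)} l"
      by (rule Henstock_Kurzweil_Integration.integral_combine[OF _ _ int]) (use ab in auto)
    finally show ?case using int by simp
  qed
  from this[of N] show ?thesis
    by (simp add: s(2) l_def[abs_def] pathfinish_def pathstart_def)
qed

text \<open>Any two points of a connected open set are joined by a polynomial curve inside it. This makes the
  infimum defining the distance range over a nonempty set.\<close>

lemma polynomial_path_piecewise_smooth: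
  fixes g :: "real \<Rightarrow> 'a::euclidean_space"
  assumes "polynomial_function g"
  shows "piecewise_smooth_path g"
proof -
  have step: "\<exists>q. polynomial_function q \<and> (\<forall>x. (p has_vector_derivative q x) (at x))" if "polynomial_function p" for p :: "real \<Rightarrow> 'a"
    using has_vector_derivative_polynomial_function[OF that] by metis
  define nxt where "nxt p = (SOME q. polynomial_function q \<and> (\<forall>x. (p has_vector_derivative q x) (at x)))" for p :: "real \<Rightarrow> 'a"
  define d where "d = rec_nat g (\<lambda>_. nxt)"
  have nxt: "polynomial_function (nxt p)" "(p has_vector_derivative nxt p x) (at x)" if "polynomial_function p" for p x
    using someI_ex[OF step[OF that]] unfolding nxt_def by auto
  have d_simps: "d 0 = g" "d (Suc m) = nxt (d m)" for m by (simp_all add: d_def)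
  have pd: "polynomial_function (d m)" for m
    by (induction m) (simp_all add: d_simps assms nxt)
  have "smooth_on_interval g 0 1"
    unfolding smooth_on_interval_def
    using pd nxt(2)[OF pd] by (intro exI[of _ d]) (auto simp: d_simps intro: has_vector_derivative_at_within)
  moreover have "path g"
    unfolding path_def using assms continuous_on_polymonial_function by blast
  ultimately show ?thesis
    unfolding piecewise_smooth_path_def by (intro conjI exI[of _ "1::nat"] exI[of _ "\<lambda>i. real i"]) auto
qed

text \<open>The case \<open>\<beta> = 0\<close> is separate because the estimate along each curve is divided by \<open>\<beta>\<close> before taking the infimum.\<close>

lemma bloch_distance_bound:
  fixes D :: "(complex ^ 'n) set"
  assumes D: "open D" "bounded D" "connected D" and f: "holomorphic_fun_on f D"
    and \<beta>: "\<And>z u. z \<in> D \<Longrightarrow> cmod (dir_deriv f z u) \<le> \<beta> * bergman_length D z u"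
    and "\<beta> \<ge> 0" and zw: "z \<in> D" "w \<in> D"
  shows "cmod (f w - f z) \<le> \<beta> * bergman_distance D z w"
proof -
  define P where "P = {\<gamma>. piecewise_smooth_path \<gamma> \<and> path_image \<gamma> \<subseteq> D \<and> pathstart \<gamma> = z \<and> pathfinish \<gamma> = w}"
  define len where "len \<gamma> = integral {0..1} (\<lambda>t. bergman_length D (\<gamma> t) (vector_derivative \<gamma> (at t within {0..1})))" for \<gamma>
  have "P \<noteq> {}"
    using connected_open_polynomial_connected[OF D(1,3) zw] polynomial_path_piecewise_smooth unfolding P_def by blast
  have le: "cmod (f w - f z) \<le> \<beta> * len \<gamma>" if "\<gamma> \<in> P" for \<gamma>
    using piecewise_smooth_length_bound[OF D(1,2) f \<beta>, of \<gamma>] that by (auto simp: P_def len_def)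
  have dist: "bergman_distance D z w = (INF \<gamma>\<in>P. len \<gamma>)"
    by (simp add: bergman_distance_def P_def len_def)
  show ?thesis
  proof (cases "\<beta> = 0")
    case True
    then show ?thesis using le \<open>P \<noteq> {}\<close> by auto
  next
    case False
    then have "\<beta> > 0" using \<open>\<beta> \<ge> 0\<close> by simp
    then have "cmod (f w - f z) / \<beta> \<le> bergman_distance D z w"
      unfolding dist using le by (intro cINF_greatest \<open>P \<noteq> {}\<close>) (simp add: field_simps)
    then show ?thesis using \<open>\<beta> > 0\<close> by (simp add: field_simps)
  qed
qed

text \<open>The constant function \<open>0\<close> satisfies the hypotheses of the distance bound with \<open>\<beta> = 1\<close>.\<close>

lemma bergman_distance_nonneg:
  fixes D :: "(complex ^ 'n) set"
  assumes D: "open D" "bounded D" "connected D" and zw: "z \<in> D" "w \<in> D"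
  shows "bergman_distance D z w \<ge> 0"
proof -
  have "cmod (0 - 0) \<le> 1 * bergman_distance D z w"
    by (rule bloch_distance_bound[OF D holomorphic_fun_on_const _ _ zw])
      (simp_all add: complex_partial_const bergman_length_nonneg[OF D(1,2)])
  then show ?thesis by simp
qed

section \<open>Bloch seminorms and the Bergman constant\<close>

lemma nonzero_vec_exists: "(- {0} :: (complex ^ 'n) set) \<noteq> {}"
proof -
  have "axis (undefined :: 'n) (1::complex) \<noteq> 0" by simp
  then show ?thesis by blast
qed

lemma bloch_seminorm_nonneg:
  assumes "open D" "bounded D" "D \<noteq> {}"
  shows "bloch_seminorm D f \<ge> 0"
proof -
  obtain z where z: "z \<in> D" using assms(3) by blast
  obtain u :: "complex ^ 'a" where u: "u \<in> - {0}" using nonzero_vec_exists by blast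
  have "0 \<le> ereal (cmod (dir_deriv f z u) / bergman_length D z u)"
    using bergman_length_nonneg[OF assms(1,2) z] by simp
  also have "\<dots> \<le> bloch_Q D f z"
    unfolding bloch_Q_def using u by (rule SUP_upper)
  also have "\<dots> \<le> bloch_seminorm D f"
    unfolding bloch_seminorm_def using z by (rule SUP_upper)
  finally show ?thesis .
qed

text \<open>Positive definiteness enters here: a vector \<open>u \<noteq> 0\<close> of length \<open>0\<close> would put a quotient by \<open>0\<close> into the
  supremum, and the supremum would say nothing about the derivative in direction \<open>u\<close>.\<close>

lemma bloch_seminorm_bound:
  assumes "open D" "bounded D" "bloch_seminorm D f \<le> ereal \<beta>" "z \<in> D"
  shows "cmod (dir_deriv f z u) \<le> \<beta> * bergman_length D z u"
proof (cases "u = 0")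
  case True
  then show ?thesis by (simp add: bergman_length_zero[OF assms(1,2,4)])
next
  case False
  then have "ereal (cmod (dir_deriv f z u) / bergman_length D z u) \<le> bloch_Q D f z"
    unfolding bloch_Q_def by (intro SUP_upper) simp
  also have "\<dots> \<le> bloch_seminorm D f"
    unfolding bloch_seminorm_def using assms(4) by (rule SUP_upper)
  also note assms(3)
  finally show ?thesis
    using bergman_length_pos[OF assms(1,2,4) False] by (simp add: field_simps)
qed

lemma bloch_seminorm_leI:
  assumes "open D" "bounded D" "\<And>z u. z \<in> D \<Longrightarrow> cmod (dir_deriv f z u) \<le> \<beta> * bergman_length D z u"
  shows "bloch_seminorm D f \<le> ereal \<beta>"
  unfolding bloch_seminorm_def bloch_Q_def
proof (intro SUP_least)
  fix z and u :: "complex ^ 'a" assume "z \<in> D" "u \<in> - {0}"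
  then show "ereal (cmod (dir_deriv f z u) / bergman_length D z u) \<le> ereal \<beta>"
    using assms(3)[of z u] bergman_length_pos[OF assms(1,2), of z u] by (simp add: field_simps)
qed

lemma bergman_constant_finite:
  fixes D :: "(complex ^ 'n) set" and \<phi> :: "complex ^ 'n \<Rightarrow> complex ^ 'n"
  assumes hom: "bounded_homogeneous_domain D" and \<phi>: "holomorphic_map_on \<phi> D" "\<phi> ` D \<subseteq> D"
  obtains B where "bergman_constant D \<phi> = ereal B" "B \<ge> 0"
    "\<And>z u. z \<in> D \<Longrightarrow> bergman_length D (\<phi> z) (complex_jacobian \<phi> z *v u) \<le> B * bergman_length D z u"
proof -
  have D: "open D" "bounded D" "D \<noteq> {}" using hom by (auto simp: bounded_homogeneous_domain_def)
  obtain C where C: "C \<ge> 0"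
    "\<And>z u. z \<in> D \<Longrightarrow> bergman_length D (\<phi> z) (complex_jacobian \<phi> z *v u) \<le> C * bergman_length D z u"
    by (rule bergman_length_holomorphic_map_bound[OF hom \<phi>]) (rule that; blast)
  have up: "bergman_constant D \<phi> \<le> ereal C"
    unfolding bergman_constant_def
  proof (intro SUP_least)
    fix z and u :: "complex ^ 'n" assume "z \<in> D" "u \<in> - {0}"
    then show "ereal (bergman_length D (\<phi> z) (complex_jacobian \<phi> z *v u) / bergman_length D z u) \<le> ereal C"
      using C(2)[of z u] bergman_length_pos[OF D(1,2), of z u] by (simp add: field_simps)
  qed
  have ge: "ereal (bergman_length D (\<phi> z) (complex_jacobian \<phi> z *v u) / bergman_length D z u) \<le> bergman_constant D \<phi>"
    if "z \<in> D" "u \<noteq> 0" for z u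
    unfolding bergman_constant_def
    by (rule SUP_upper2[OF that(1)], rule SUP_upper) (use that(2) in simp)
  have \<phi>D: "\<phi> z \<in> D" if "z \<in> D" for z using \<phi>(2) that by auto
  obtain z where z: "z \<in> D" using D(3) by blast
  obtain u :: "complex ^ 'n" where u: "u \<noteq> 0" using nonzero_vec_exists by blast
  have "0 \<le> ereal (bergman_length D (\<phi> z) (complex_jacobian \<phi> z *v u) / bergman_length D z u)"
    using bergman_length_nonneg[OF D(1,2) z] bergman_length_nonneg[OF D(1,2) \<phi>D[OF z]] by simp
  then have nonneg: "0 \<le> bergman_constant D \<phi>" using ge[OF z u] by (rule order_trans)
  then obtain B where B: "bergman_constant D \<phi> = ereal B"
    using up by (cases "bergman_constant D \<phi>") auto
  show thesis
  proof (rule that[OF B])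
    show "B \<ge> 0" using nonneg B by simp
    fix z u assume z: "z \<in> D"
    show "bergman_length D (\<phi> z) (complex_jacobian \<phi> z *v u) \<le> B * bergman_length D z u"
    proof (cases "u = 0")
      case True
      then show ?thesis
        by (simp add: bergman_length_zero[OF D(1,2) z] bergman_length_zero[OF D(1,2) \<phi>D[OF z]])
    next
      case False
      then show ?thesis
        using ge[OF z False] bergman_length_pos[OF D(1,2) z False] by (simp add: B field_simps)
    qed
  qed
qed

lemma bloch_spaceE:
  assumes D: "open D" "bounded D" "D \<noteq> {}" and f: "f \<in> bloch_space D"
  obtains \<beta> where "bloch_seminorm D f = ereal \<beta>" "\<beta> \<ge> 0" "bloch_norm D f = ereal (cmod (f 0) + \<beta>)"
    "holomorphic_fun_on f D" "\<And>z u. z \<in> D \<Longrightarrow> cmod (dir_deriv f z u) \<le> \<beta> * bergman_length D z u"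
proof -
  have hol: "holomorphic_fun_on f D" and fin: "bloch_seminorm D f < \<infinity>"
    using f by (auto simp: bloch_space_def)
  obtain \<beta> where \<beta>: "bloch_seminorm D f = ereal \<beta>"
    using fin bloch_seminorm_nonneg[OF D, of f] by (cases "bloch_seminorm D f") auto
  show thesis
  proof (rule that[OF \<beta>])
    show "\<beta> \<ge> 0" using bloch_seminorm_nonneg[OF D, of f] \<beta> by simp
    show "bloch_norm D f = ereal (cmod (f 0) + \<beta>)" by (simp add: bloch_norm_def \<beta>)
    show "cmod (dir_deriv f z u) \<le> \<beta> * bergman_length D z u" if "z \<in> D" for z u
      by (rule bloch_seminorm_bound[OF D(1,2) _ that]) (simp add: \<beta>)
  qed (rule hol)
qed

lemma bloch_composition_bound:
  fixes D :: "(complex ^ 'n) set" and \<phi> :: "complex ^ 'n \<Rightarrow> complex ^ 'n"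
  assumes hom: "bounded_homogeneous_domain D" and \<phi>: "holomorphic_map_on \<phi> D" "\<phi> ` D \<subseteq> D"
    and B: "bergman_constant D \<phi> = ereal B" "B \<ge> 0"
    and f: "f \<in> bloch_space D" "bloch_seminorm D f = ereal \<beta>"
  shows "f \<circ> \<phi> \<in> bloch_space D" "bloch_norm D (f \<circ> \<phi>) \<le> ereal (cmod (f (\<phi> 0)) + \<beta> * B)"
proof -
  have D: "open D" "bounded D" "D \<noteq> {}" using hom by (auto simp: bounded_homogeneous_domain_def)
  obtain B' where "bergman_constant D \<phi> = ereal B'" "B' \<ge> 0"
    "\<And>z u. z \<in> D \<Longrightarrow> bergman_length D (\<phi> z) (complex_jacobian \<phi> z *v u) \<le> B' * bergman_length D z u"
    by (rule bergman_constant_finite[OF hom \<phi>]) (rule that; blast)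
  then have len: "bergman_length D (\<phi> z) (complex_jacobian \<phi> z *v u) \<le> B * bergman_length D z u" if "z \<in> D" for z u
    using B(1) that by simp
  obtain \<beta>' where \<beta>: "bloch_seminorm D f = ereal \<beta>'" "\<beta>' \<ge> 0" "bloch_norm D f = ereal (cmod (f 0) + \<beta>')"
    and hf: "holomorphic_fun_on f D" and bd: "\<And>z u. z \<in> D \<Longrightarrow> cmod (dir_deriv f z u) \<le> \<beta>' * bergman_length D z u"
    by (rule bloch_spaceE[OF D f(1)]) (rule that; blast)
  have \<beta>': "\<beta>' = \<beta>" using \<beta>(1) f(2) by simp
  have hol: "holomorphic_fun_on (f \<circ> \<phi>) D"
    using holomorphic_fun_on_compose[OF hf \<phi>] by (simp add: o_def)
  have "cmod (dir_deriv (f \<circ> \<phi>) z u) \<le> \<beta> * B * bergman_length D z u" if z: "z \<in> D" for z u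
  proof -
    have "cmod (dir_deriv (f \<circ> \<phi>) z u) = cmod (dir_deriv f (\<phi> z) (complex_jacobian \<phi> z *v u))"
      using complex_directional_compose[OF hf \<phi> z, of u] by (simp add: o_def)
    also have "\<dots> \<le> \<beta> * bergman_length D (\<phi> z) (complex_jacobian \<phi> z *v u)"
      unfolding \<beta>'[symmetric] by (rule bd) (use \<phi>(2) z in auto)
    also have "\<dots> \<le> \<beta> * (B * bergman_length D z u)"
      using len[OF z] \<beta>(2) \<beta>' by (intro mult_left_mono) auto
    finally show ?thesis by (simp add: mult.assoc)
  qed
  then have semi: "bloch_seminorm D (f \<circ> \<phi>) \<le> ereal (\<beta> * B)"
    by (rule bloch_seminorm_leI[OF D(1,2)])
  then show "f \<circ> \<phi> \<in> bloch_space D"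
    using hol by (auto simp: bloch_space_def)
  have "bloch_norm D (f \<circ> \<phi>) \<le> ereal (cmod (f (\<phi> 0))) + ereal (\<beta> * B)"
    unfolding bloch_norm_def o_apply[of f \<phi> 0] by (rule add_left_mono[OF semi])
  then show "bloch_norm D (f \<circ> \<phi>) \<le> ereal (cmod (f (\<phi> 0)) + \<beta> * B)" by simp
qed

theorem theorem3p2:
  fixes D :: "(complex ^ 'n) set" and \<phi> :: "complex ^ 'n \<Rightarrow> complex ^ 'n"
  assumes "bounded_homogeneous_domain D" and "0 \<in> D"
    and "holomorphic_map_on \<phi> D" and "\<phi> ` D \<subseteq> D"
  shows "bounded_operator_on_bloch D (composition_operator \<phi>) \<and>
    1 \<le> bloch_operator_norm D (composition_operator \<phi>) \<and>
    bloch_operator_norm D (composition_operator \<phi>)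
      \<le> max 1 (ereal (bergman_distance D (\<phi> 0) 0) + bergman_constant D \<phi>) \<and>
    (\<phi> 0 = 0 \<longrightarrow>
      1 \<le> bloch_operator_norm D (composition_operator \<phi>) \<and>
      bloch_operator_norm D (composition_operator \<phi>) \<le> max 1 (bergman_constant D \<phi>))"
proof -
  let ?C = "composition_operator \<phi>"
  note hom = assms(1) and \<phi> = assms(3,4)
  have D: "open D" "bounded D" "D \<noteq> {}" "connected D"
    using hom by (auto simp: bounded_homogeneous_domain_def)
  have \<phi>0: "\<phi> 0 \<in> D" using assms(2,4) by auto
  obtain B where B: "bergman_constant D \<phi> = ereal B" "B \<ge> 0"
    by (rule bergman_constant_finite[OF hom \<phi>]) (rule that; assumption)
  define \<rho> where "\<rho> = bergman_distance D (\<phi> 0) 0"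
  have \<rho>: "\<rho> \<ge> 0"
    unfolding \<rho>_def by (rule bergman_distance_nonneg[OF D(1,2,4) \<phi>0 assms(2)])
  note comp = bloch_composition_bound[OF hom \<phi> B]
  have bound: "\<exists>\<beta>\<ge>0. bloch_norm D f = ereal (cmod (f 0) + \<beta>) \<and> ?C f \<in> bloch_space D \<and>
      bloch_norm D (?C f) \<le> ereal (cmod (f (\<phi> 0)) + \<beta> * B) \<and> cmod (f (\<phi> 0)) \<le> cmod (f 0) + \<beta> * \<rho>"
    if f: "f \<in> bloch_space D" for f
  proof -
    obtain \<beta> where \<beta>: "bloch_seminorm D f = ereal \<beta>" "\<beta> \<ge> 0" "bloch_norm D f = ereal (cmod (f 0) + \<beta>)"
      "holomorphic_fun_on f D" "\<And>z u. z \<in> D \<Longrightarrow> cmod (dir_deriv f z u) \<le> \<beta> * bergman_length D z u"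
      by (rule bloch_spaceE[OF D(1-3) f]) (rule that; blast)
    have "cmod (f 0 - f (\<phi> 0)) \<le> \<beta> * \<rho>"
      unfolding \<rho>_def by (rule bloch_distance_bound[OF D(1,2,4) \<beta>(4,5,2) \<phi>0 assms(2)])
    then have "cmod (f (\<phi> 0)) \<le> cmod (f 0) + \<beta> * \<rho>"
      using norm_triangle_sub[of "f (\<phi> 0)" "f 0"] by (simp add: norm_minus_commute)
    then show ?thesis
      using \<beta>(2,3) comp[OF f \<beta>(1)] by (auto simp: composition_operator_def)
  qed
  have norm_le: "bloch_norm D (?C f) \<le> ereal (max 1 (\<rho> + B)) * bloch_norm D f" if f: "f \<in> bloch_space D" for f
  proof -
    obtain \<beta> where \<beta>: "\<beta> \<ge> 0" "bloch_norm D f = ereal (cmod (f 0) + \<beta>)"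
      "bloch_norm D (?C f) \<le> ereal (cmod (f (\<phi> 0)) + \<beta> * B)" "cmod (f (\<phi> 0)) \<le> cmod (f 0) + \<beta> * \<rho>"
      using bound[OF f] by blast
    have "cmod (f (\<phi> 0)) + \<beta> * B \<le> 1 * cmod (f 0) + (\<rho> + B) * \<beta>"
      using \<beta>(4) by (simp add: algebra_simps)
    also have "\<dots> \<le> max 1 (\<rho> + B) * cmod (f 0) + max 1 (\<rho> + B) * \<beta>"
      using \<beta>(1) by (intro add_mono mult_right_mono) auto
    finally have "cmod (f (\<phi> 0)) + \<beta> * B \<le> max 1 (\<rho> + B) * (cmod (f 0) + \<beta>)"
      by (simp add: distrib_left)
    then have "ereal (cmod (f (\<phi> 0)) + \<beta> * B) \<le> ereal (max 1 (\<rho> + B)) * bloch_norm D f"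
      by (simp only: \<beta>(2) times_ereal.simps ereal_less_eq)
    with \<beta>(3) show ?thesis by (rule order_trans)
  qed
  have "bounded_operator_on_bloch D ?C"
    unfolding bounded_operator_on_bloch_def
  proof (intro conjI ballI allI)
    show "?C f \<in> bloch_space D" if "f \<in> bloch_space D" for f
      using bound[OF that] by blast
    show "\<exists>M. \<forall>f\<in>bloch_space D. bloch_norm D (?C f) \<le> ereal M * bloch_norm D f"
      using norm_le by blast
  qed (simp add: composition_operator_def)
  moreover have "1 \<le> bloch_operator_norm D ?C"
  proof -
    let ?one = "\<lambda>_ :: complex ^ 'n. 1 :: complex"
    have "bloch_seminorm D ?one \<le> ereal 0"
      by (rule bloch_seminorm_leI[OF D(1,2)]) (simp add: complex_partial_const)
    then have semi: "bloch_seminorm D ?one = 0"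
      using bloch_seminorm_nonneg[OF D(1-3), of ?one] unfolding zero_ereal_def by (rule antisym)
    then have one: "?one \<in> bloch_space D" "bloch_norm D ?one = 1"
      by (auto simp: bloch_space_def bloch_norm_def holomorphic_fun_on_const one_ereal_def)
    have "?C ?one = ?one" by (auto simp: composition_operator_def)
    then have "bloch_norm D (?C ?one) = 1" using one by simp
    then show ?thesis
      unfolding bloch_operator_norm_def using one by (intro SUP_upper2[of ?one]) auto
  qed
  moreover have "bloch_operator_norm D ?C \<le> max 1 (ereal (bergman_distance D (\<phi> 0) 0) + bergman_constant D \<phi>)"
    unfolding bloch_operator_norm_def
  proof (rule SUP_least)
    fix f assume "f \<in> {f \<in> bloch_space D. bloch_norm D f \<le> 1}"
    then have f: "f \<in> bloch_space D" "bloch_norm D f \<le> 1" by auto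
    have "bloch_norm D (?C f) \<le> ereal (max 1 (\<rho> + B)) * bloch_norm D f" by (rule norm_le[OF f(1)])
    also have "\<dots> \<le> ereal (max 1 (\<rho> + B)) * 1"
      using f(2) by (intro ereal_mult_left_mono) (auto simp: le_max_iff_disj)
    also have "\<dots> = max 1 (ereal (bergman_distance D (\<phi> 0) 0) + bergman_constant D \<phi>)"
      by (simp add: B(1) \<rho>_def max_def one_ereal_def)
    finally show "bloch_norm D (?C f) \<le> max 1 (ereal (bergman_distance D (\<phi> 0) 0) + bergman_constant D \<phi>)" .
  qed
  moreover have "bloch_operator_norm D ?C \<le> max 1 (bergman_constant D \<phi>)" if "\<phi> 0 = 0"
    unfolding bloch_operator_norm_def
  proof (rule SUP_least)
    fix f assume "f \<in> {f \<in> bloch_space D. bloch_norm D f \<le> 1}"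
    then have f: "f \<in> bloch_space D" "bloch_norm D f \<le> 1" by auto
    obtain \<beta> where \<beta>: "\<beta> \<ge> 0" "bloch_norm D f = ereal (cmod (f 0) + \<beta>)"
      "bloch_norm D (?C f) \<le> ereal (cmod (f (\<phi> 0)) + \<beta> * B)"
      using bound[OF f(1)] by blast
    have le1: "cmod (f 0) + \<beta> \<le> 1" using f(2) by (simp add: \<beta>(2) one_ereal_def)
    have "1 * cmod (f 0) + B * \<beta> \<le> max 1 B * cmod (f 0) + max 1 B * \<beta>"
      using \<beta>(1) by (intro add_mono mult_right_mono) auto
    also have "\<dots> = max 1 B * (cmod (f 0) + \<beta>)" by (simp add: distrib_left)
    also have "\<dots> \<le> max 1 B * 1" using le1 by (intro mult_left_mono) auto
    finally have "cmod (f (\<phi> 0)) + \<beta> * B \<le> max 1 B" by (simp add: that mult.commute)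
    then have "ereal (cmod (f (\<phi> 0)) + \<beta> * B) \<le> max 1 (bergman_constant D \<phi>)"
      by (simp add: B(1) max_def one_ereal_def split: if_splits)
    with \<beta>(3) show "bloch_norm D (?C f) \<le> max 1 (bergman_constant D \<phi>)" by (rule order_trans)
  qed
  ultimately show ?thesis by blast
qed

end
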